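(* For $s,t>0$ with $s>t/2$ and $N\in\mathbb{N}$, let $Z^N_{s,t}$ be a random matrix in $\mathbb{GL}_N$ with law $\mu^N_{s,t}$, and let $\widetilde{\varphi}^N_{s,t}$ be its empirical noncommutative distribution, i.e. the random linear functional $\widetilde{\varphi}^N_{s,t}(f)=\mathrm{tr}\big(f(Z^N_{s,t},(Z^N_{s,t})^* )\big)$ on $\mathbb{C}\langle A,A^{-1},A^*,A^{-*}\rangle$. There exists a noncommutative distribution $\varphi_{s,t}$ such that $\widetilde{\varphi}^N_{s,t}\to\varphi_{s,t}$ weakly almost surely: for each noncommutative Laurent polynomial $f\in\mathbb{C}\langle A,A^{-1},A^*,A^{-*}\rangle$ and all $N\in\mathbb{N}$, $$\left|\mathbb{E}[\widetilde{\varphi}^N_{s,t}(f)]-\varphi_{s,t}(f)\right|\le\frac{C_1(s,t,f)}{N^2},\qquad \mathrm{Var}[\widetilde{\varphi}^N_{s,t}(f)]\le\frac{C_2(s,t,f)}{N^2},$$ for some constants $C_1(s,t,f),C_2(s,t,f)<\infty$ that depend continuously on $s,t$.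
   Context: $\mathrm{tr}=\frac1N\mathrm{Tr}$ on $\mathbb{M}_N$; $\mathbb{GL}_N$ is the group of invertible $N\times N$ complex matrices. $\mathfrak{u}_N=\{X\in\mathbb{M}_N:X^*=-X\}$ carries the inner product $\langle X,Y\rangle_N=-N\,\mathrm{Tr}(XY)$, with orthonormal basis $\beta_N$. For $\xi\in\mathbb{M}_N$, $(\partial_\xi f)(g)=\frac{d}{du}\big|_{u=0}f(ge^{u\xi})$. Set $A^N_{s,t}=(s-\frac t2)\sum_{X\in\beta_N}\partial_X^2+\frac t2\sum_{X\in\beta_N}\partial_{iX}^2$ on $C^\infty(\mathbb{GL}_N)$. For $s,t>0$, $s>t/2$, the heat kernel measure $\mu^N_{s,t}$ is the unique probability measure on $\mathbb{GL}_N$ with $\int f\,d\mu^N_{s,t}=(e^{\frac12A^N_{s,t}}f)(I_N)$ for $f\in C_c(\mathbb{GL}_N)$. $\mathrm{Var}(F)=\mathbb{E}|F-\mathbb{E}F|^2$. $\mathbb{C}\langle A,A^{-1},A^*,A^{-*}\rangle$ is the algebra of noncommutative Laurent polynomials in $A,A^*$, i.e. the complex group algebra of the free group on two generators $A,A^*$, with $A^{-*}=(A^* )^{-1}$. A noncommutative probability space $(\mathscr{A},\tau)$ is a unital complex $*$-algebra $\mathscr{A}$ with a linear functional $\tau$ that is unital ($\tau(1)=1$), tracial ($\tau(ab)=\tau(ba)$) and positive semidefinite ($\tau(aa^* )\ge0$). The noncommutative distribution of an invertible $a\in\mathscr{A}$ is the linear functional $\varphi_a(f)=\tau[f(a,a^*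 )]$ on $\mathbb{C}\langle A,A^{-1},A^*,A^{-*}\rangle$; a linear functional is called a noncommutative distribution if it is of the form $\varphi_a$ for some such $(\mathscr{A},\tau)$ and $a$. *)

theory Defs
  imports
    "HOL-Probability.Probability"
    "HOL-Library.Poly_Mapping"
    "HOL-Algebra.Module"
    "Jordan_Normal_Form.Schur_Decomposition"
begin

section \<open>Noncommutative Laurent polynomials\<close>

text \<open>A word is a list of letters; the letter \<open>(x, True)\<close> stands for the generator \<open>x\<close> and
  \<open>(x, False)\<close> for its inverse.  The group is written additively because the convolution
  product of \<^theory>\<open>HOL-Library.Poly_Mapping\<close> is taken over an additive (here noncommutative)
  monoid.\<close>

inductive word_equiv :: "('a \<times> bool) list \<Rightarrow> ('a \<times> bool) list \<Rightarrow> bool" where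
  word_refl: "word_equiv u u"
| word_sym: "word_equiv u v \<Longrightarrow> word_equiv v u"
| word_trans: "word_equiv u v \<Longrightarrow> word_equiv v w \<Longrightarrow> word_equiv u w"
| word_cancel: "word_equiv (u @ [(x, b), (x, \<not> b)] @ v) (u @ v)"

lemma equivp_word_equiv: "equivp word_equiv"
  by (intro equivpI reflpI sympI transpI) (blast intro: word_equiv.intros)+

quotient_type 'a free_group = "('a \<times> bool) list" / word_equiv
  by (rule equivp_word_equiv)

definition word_inverse :: "('a \<times> bool) list \<Rightarrow> ('a \<times> bool) list" where
  "word_inverse w = rev (map (\<lambda>(x, b). (x, \<not> b)) w)"

lemma word_equiv_appendL: "word_equiv u v \<Longrightarrow> word_equiv (w @ u) (w @ v)"
proof (induction rule: word_equiv.induct)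
  case (word_cancel u x b v)
  show ?case using word_equiv.word_cancel[of "w @ u" x b v] by simp
qed (blast intro: word_equiv.intros)+

lemma word_equiv_appendR: "word_equiv u v \<Longrightarrow> word_equiv (u @ w) (v @ w)"
proof (induction rule: word_equiv.induct)
  case (word_cancel u x b v)
  show ?case using word_equiv.word_cancel[of u x b "v @ w"] by simp
qed (blast intro: word_equiv.intros)+

lemma word_equiv_append:
  "word_equiv u u' \<Longrightarrow> word_equiv v v' \<Longrightarrow> word_equiv (u @ v) (u' @ v')"
  by (blast intro: word_equiv_appendL word_equiv_appendR word_trans)

lemma word_equiv_inverse: "word_equiv u v \<Longrightarrow> word_equiv (word_inverse u) (word_inverse v)"
proof (induction rule: word_equiv.induct)
  case (word_cancel u x b v)
  show ?case
    using word_equiv.word_cancel[of "word_inverse v" x b "word_inverse u"]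
    by (simp add: word_inverse_def)
qed (blast intro: word_equiv.intros)+

lemma word_equiv_left_inverse: "word_equiv (word_inverse w @ w) []"
proof (induction w)
  case Nil
  show ?case by (simp add: word_inverse_def word_refl)
next
  case (Cons l w)
  obtain x b where l: "l = (x, b)" by (cases l)
  have "word_equiv (word_inverse w @ [(x, \<not> b), (x, \<not> \<not> b)] @ w) (word_inverse w @ w)"
    by (rule word_cancel)
  then show ?case
    using Cons.IH word_trans by (force simp: word_inverse_def l)
qed

instantiation free_group :: (type) group_add
begin

lift_definition zero_free_group :: "'a free_group" is "[]" .

lift_definition plus_free_group :: "'a free_group \<Rightarrow> 'a free_group \<Rightarrow> 'a free_group" is "(@)"
  by (rule word_equiv_append)

lift_definition uminus_free_group :: "'a free_group \<Rightarrow> 'a free_group" is word_inverse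
  by (rule word_equiv_inverse)

definition minus_free_group :: "'a free_group \<Rightarrow> 'a free_group \<Rightarrow> 'a free_group" where
  "minus_free_group v w = v + - w"

instance
proof
  fix a b c :: "'a free_group"
  show "a + b + c = a + (b + c)" by transfer (simp add: word_refl)
  show "0 + a = a" by transfer (simp add: word_refl)
  show "a + 0 = a" by transfer (simp add: word_refl)
  show "- a + a = 0" by transfer (rule word_equiv_left_inverse)
  show "a + - b = a - b" by (simp add: minus_free_group_def)
qed

end

datatype generator = Gen | Gen_star

type_synonym laurent = "generator free_group \<Rightarrow>\<^sub>0 complex"


section \<open>Noncommutative probability spaces and distributions\<close>

record 'b star_algebra = "(complex, 'b) module" +
  adj :: "'b \<Rightarrow> 'b"

locale star_algebra = ring \<A> for \<A> :: "('b, 'c) star_algebra_scheme" (structure) +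
  assumes smult_closed [simp, intro]: "x \<in> carrier \<A> \<Longrightarrow> c \<odot> x \<in> carrier \<A>"
    and smult_add_right:
      "x \<in> carrier \<A> \<Longrightarrow> y \<in> carrier \<A> \<Longrightarrow> c \<odot> (x \<oplus> y) = c \<odot> x \<oplus> c \<odot> y"
    and smult_add_left: "x \<in> carrier \<A> \<Longrightarrow> (c + d) \<odot> x = c \<odot> x \<oplus> d \<odot> x"
    and smult_smult: "x \<in> carrier \<A> \<Longrightarrow> c \<odot> (d \<odot> x) = (c * d) \<odot> x"
    and smult_one [simp]: "x \<in> carrier \<A> \<Longrightarrow> 1 \<odot> x = x"
    and mult_smult_left:
      "x \<in> carrier \<A> \<Longrightarrow> y \<in> carrier \<A> \<Longrightarrow> (c \<odot> x) \<otimes> y = c \<odot> (x \<otimes> y)"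
    and mult_smult_right:
      "x \<in> carrier \<A> \<Longrightarrow> y \<in> carrier \<A> \<Longrightarrow> x \<otimes> (c \<odot> y) = c \<odot> (x \<otimes> y)"
    and adj_closed [simp, intro]: "x \<in> carrier \<A> \<Longrightarrow> adj \<A> x \<in> carrier \<A>"
    and adj_adj [simp]: "x \<in> carrier \<A> \<Longrightarrow> adj \<A> (adj \<A> x) = x"
    and adj_add:
      "x \<in> carrier \<A> \<Longrightarrow> y \<in> carrier \<A> \<Longrightarrow> adj \<A> (x \<oplus> y) = adj \<A> x \<oplus> adj \<A> y"
    and adj_smult: "x \<in> carrier \<A> \<Longrightarrow> adj \<A> (c \<odot> x) = cnj c \<odot> adj \<A> x"
    and adj_mult:
      "x \<in> carrier \<A> \<Longrightarrow> y \<in> carrier \<A> \<Longrightarrow> adj \<A> (x \<otimes> y) = adj \<A> y \<otimes> adj \<A> x"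

locale nc_prob_space = star_algebra \<A> for \<A> :: "('b, 'c) star_algebra_scheme" (structure) +
  fixes \<tau> :: "'b \<Rightarrow> complex"
  assumes state_add: "x \<in> carrier \<A> \<Longrightarrow> y \<in> carrier \<A> \<Longrightarrow> \<tau> (x \<oplus> y) = \<tau> x + \<tau> y"
    and state_smult: "x \<in> carrier \<A> \<Longrightarrow> \<tau> (c \<odot> x) = c * \<tau> x"
    and state_unital: "\<tau> \<one> = 1"
    and state_tracial: "x \<in> carrier \<A> \<Longrightarrow> y \<in> carrier \<A> \<Longrightarrow> \<tau> (x \<otimes> y) = \<tau> (y \<otimes> x)"
    and state_pos: "x \<in> carrier \<A> \<Longrightarrow> \<tau> (x \<otimes> adj \<A> x) \<in> \<real>\<^sub>\<ge>\<^sub>0"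

fun letter_eval :: "('b, 'c) star_algebra_scheme \<Rightarrow> 'b \<Rightarrow> generator \<times> bool \<Rightarrow> 'b" where
  "letter_eval \<A> a (Gen, True) = a"
| "letter_eval \<A> a (Gen, False) = inv\<^bsub>\<A>\<^esub> a"
| "letter_eval \<A> a (Gen_star, True) = adj \<A> a"
| "letter_eval \<A> a (Gen_star, False) = inv\<^bsub>\<A>\<^esub> (adj \<A> a)"

definition word_eval :: "('b, 'c) star_algebra_scheme \<Rightarrow> 'b \<Rightarrow> (generator \<times> bool) list \<Rightarrow> 'b" where
  "word_eval \<A> a w = foldr (\<lambda>l x. letter_eval \<A> a l \<otimes>\<^bsub>\<A>\<^esub> x) w \<one>\<^bsub>\<A>\<^esub>"

text \<open>The element \<open>f(a, a\<^sup>*)\<close>.  For invertible \<open>a\<close> the value of a word does not depend on the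
  representative, see \<open>word_eval_equiv\<close> below.\<close>

definition laurent_eval :: "('b, 'c) star_algebra_scheme \<Rightarrow> 'b \<Rightarrow> laurent \<Rightarrow> 'b" where
  "laurent_eval \<A> a f =
     (\<Oplus>\<^bsub>\<A>\<^esub>w\<in>Poly_Mapping.keys f. Poly_Mapping.lookup f w \<odot>\<^bsub>\<A>\<^esub> word_eval \<A> a (rep_free_group w))"

definition nc_distribution_of ::
    "('b, 'c) star_algebra_scheme \<Rightarrow> ('b \<Rightarrow> complex) \<Rightarrow> 'b \<Rightarrow> laurent \<Rightarrow> complex" where
  "nc_distribution_of \<A> \<tau> a f = \<tau> (laurent_eval \<A> a f)"

text \<open>HOL cannot quantify over the carrier type of \<open>\<A>\<close> inside a formula.  Fixing it to be
  \<^typ>\<open>laurent\<close> is no restriction: the distribution of an invertible element of a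
  noncommutative probability space over any type satisfies this predicate
  (\<open>nc_distribution_any_type\<close> below).\<close>

definition is_nc_distribution :: "(laurent \<Rightarrow> complex) \<Rightarrow> bool" where
  "is_nc_distribution \<phi> \<longleftrightarrow>
     (\<exists>(\<A> :: laurent star_algebra) \<tau> a.
        nc_prob_space \<A> \<tau> \<and> a \<in> Units \<A> \<and> \<phi> = nc_distribution_of \<A> \<tau> a)"

subsection \<open>Independence of the choice of the carrier type\<close>

context star_algebra
begin

lemma adj_one [simp]: "adj \<A> \<one> = \<one>"
proof -
  have "adj \<A> (adj \<A> \<one> \<otimes> \<one>) = adj \<A> \<one> \<otimes> adj \<A> (adj \<A> \<one>)"
    by (intro adj_mult) auto
  then show ?thesis by simp
qed

lemma smult_zero_left: "x \<in> carrier \<A> \<Longrightarrow> 0 \<odot> x = \<zero>"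
  using smult_add_left[of x 0 0] by (metis add.l_cancel_one' add.m_closed add_0 smult_closed)

lemma smult_zero_right: "c \<odot> \<zero> = \<zero>"
  using smult_smult[of \<zero> c 0] smult_zero_left by simp

lemma adj_zero: "adj \<A> \<zero> = \<zero>"
  using adj_smult[of \<zero> 0] smult_zero_left by simp

lemma adj_Units:
  assumes a: "a \<in> Units \<A>"
  shows "adj \<A> a \<in> Units \<A>" "inv (adj \<A> a) = adj \<A> (inv a)"
proof -
  have "adj \<A> (inv a) \<otimes> adj \<A> a = adj \<A> (a \<otimes> inv a)"
    and "adj \<A> a \<otimes> adj \<A> (inv a) = adj \<A> (inv a \<otimes> a)"
    using a by (simp_all only: adj_mult Units_closed Units_inv_closed)
  then have 1: "adj \<A> (inv a) \<otimes> adj \<A> a = \<one>" "adj \<A> a \<otimes> adj \<A> (inv a) = \<one>"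
    using a by simp_all
  show "adj \<A> a \<in> Units \<A>"
    using a 1 unfolding Units_def[of \<A>]
    by (auto intro!: bexI[of _ "adj \<A> (inv a)"] simp: Units_closed[OF a] Units_inv_closed[OF a])
  show "inv (adj \<A> a) = adj \<A> (inv a)"
    using a 1 by (intro inv_char) auto
qed

lemma letter_eval_cancel:
  assumes a: "a \<in> Units \<A>"
  shows "letter_eval \<A> a l \<in> carrier \<A>"
    and "letter_eval \<A> a (x, b) \<otimes> letter_eval \<A> a (x, \<not> b) = \<one>"
proof -
  show "letter_eval \<A> a l \<in> carrier \<A>"
    using a adj_Units[OF a] by (cases "(\<A>, a, l)" rule: letter_eval.cases) auto
  show "letter_eval \<A> a (x, b) \<otimes> letter_eval \<A> a (x, \<not> b) = \<one>"
    using a adj_Units(1)[OF a] by (cases x; cases b) auto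
qed

lemma word_eval_closed:
  assumes "a \<in> Units \<A>"
  shows "word_eval \<A> a w \<in> carrier \<A>"
  by (induction w) (auto simp: word_eval_def letter_eval_cancel[OF assms])

lemma word_eval_append:
  assumes a: "a \<in> Units \<A>"
  shows "word_eval \<A> a (u @ v) = word_eval \<A> a u \<otimes> word_eval \<A> a v"
proof (induction u)
  case Nil
  show ?case using word_eval_closed[OF a, of v] by (simp add: word_eval_def)
next
  case (Cons l u)
  then show ?case
    using word_eval_closed[OF a, of u] word_eval_closed[OF a, of v] letter_eval_cancel(1)[OF a, of l]
    by (simp add: word_eval_def m_assoc)
qed

lemma word_eval_equiv:
  assumes a: "a \<in> Units \<A>"
  shows "word_equiv u v \<Longrightarrow> word_eval \<A> a u = word_eval \<A> a v"
proof (induction rule: word_equiv.induct)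
  case (word_cancel u x b v)
  have "word_eval \<A> a [(x, b), (x, \<not> b)] = \<one>"
    using letter_eval_cancel[OF a] by (simp add: word_eval_def)
  then show ?case
    using word_eval_closed[OF a] by (simp only: word_eval_append[OF a] l_one)
qed auto

end

lemma abs_rep_free_group: "abs_free_group (rep_free_group w) = w"
  by (meson Quotient3_abs_rep Quotient3_free_group)

lemma word_equiv_rep_abs: "word_equiv (rep_free_group (abs_free_group w)) w"
  using Quotient3_rep_abs[OF Quotient3_free_group] word_refl by blast

lemma word_equiv_rep_plus:
  "word_equiv (rep_free_group (v + w)) (rep_free_group v @ rep_free_group w)"
  by (metis abs_rep_free_group plus_free_group.abs_eq word_equiv_rep_abs)

fun generator_swap :: "generator \<Rightarrow> generator" where
  "generator_swap Gen = Gen_star"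
| "generator_swap Gen_star = Gen"

lemma generator_swap_swap [simp]: "generator_swap (generator_swap x) = x"
  by (cases x) auto

definition word_star :: "(generator \<times> bool) list \<Rightarrow> (generator \<times> bool) list" where
  "word_star w = rev (map (\<lambda>(x, b). (generator_swap x, b)) w)"

lemma word_star_star: "word_star (word_star w) = w"
  by (induction w) (auto simp: word_star_def)

lemma word_star_append: "word_star (u @ v) = word_star v @ word_star u"
  by (simp add: word_star_def)

lift_definition group_star :: "generator free_group \<Rightarrow> generator free_group" is word_star
proof -
  show "word_equiv (word_star u) (word_star v)" if "word_equiv u v" for u v
    using that
  proof (induction rule: word_equiv.induct)
    case (word_cancel u x b v)
    show ?case
      using word_equiv.word_cancel[of "word_star v" "generator_swap x" "\<not> b" "word_star u"]
      by (simp add: word_star_def)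
  qed (blast intro: word_equiv.intros)+
qed

lemma group_star_star [simp]: "group_star (group_star w) = w"
  by transfer (simp add: word_star_star word_refl)

lemma group_star_plus: "group_star (v + w) = group_star w + group_star v"
  by transfer (simp add: word_star_append word_refl)

lemma group_star_zero [simp]: "group_star 0 = 0"
  by transfer (simp add: word_star_def word_refl)

lemma inj_group_star: "inj group_star"
  by (metis group_star_star injI)

definition laurent_star :: "laurent \<Rightarrow> laurent" where
  "laurent_star f = Poly_Mapping.map cnj (Poly_Mapping.map_key group_star f)"

lemma lookup_laurent_star:
  "Poly_Mapping.lookup (laurent_star f) w = cnj (Poly_Mapping.lookup f (group_star w))"
  by (simp add: laurent_star_def Poly_Mapping.map.rep_eq map_key.rep_eq[OF inj_group_star] when_def)

lemma laurent_star_add: "laurent_star (f + g) = laurent_star f + laurent_star g"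
  by (rule poly_mapping_eqI) (simp add: lookup_laurent_star lookup_add)

lemma laurent_star_single:
  "laurent_star (Poly_Mapping.single w c) = Poly_Mapping.single (group_star w) (cnj c)"
  by (rule poly_mapping_eqI) (auto simp: lookup_laurent_star lookup_single when_def)

lemma laurent_star_star: "laurent_star (laurent_star f) = f"
  by (rule poly_mapping_eqI) (simp add: lookup_laurent_star)

lemma laurent_induct [case_names single add]:
  fixes P :: "laurent \<Rightarrow> bool"
  assumes s: "\<And>w c. P (Poly_Mapping.single w c)"
    and a: "\<And>f g. P f \<Longrightarrow> P g \<Longrightarrow> P (f + g)"
  shows "P f"
proof (induction f rule: update_induct)
  case const
  show ?case using s[of 0 0] by simp
next
  case (update f w c)
  have "Poly_Mapping.update w c f = f + Poly_Mapping.single w c"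
    using update by (intro poly_mapping_eqI)
      (auto simp: lookup_update lookup_add lookup_single in_keys_iff)
  then show ?case using update a s by simp
qed

lemma laurent_star_mult: "laurent_star (f * g) = laurent_star g * laurent_star f"
proof (induction f rule: laurent_induct)
  case (single v c)
  show ?case
    by (induction g rule: laurent_induct)
      (simp_all add: laurent_star_single mult_single group_star_plus laurent_star_add
        distrib_left distrib_right mult.commute)
qed (simp add: laurent_star_add distrib_left distrib_right)

definition laurent_algebra :: "laurent star_algebra" where
  "laurent_algebra =
     \<lparr>carrier = UNIV, mult = (*), one = 1, zero = 0, add = (+),
      smult = (\<lambda>c. Poly_Mapping.map ((*) c)), adj = laurent_star\<rparr>"

lemma laurent_algebra_simps [simp]:
  "carrier laurent_algebra = UNIV" "mult laurent_algebra = (*)" "one laurent_algebra = 1"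
  "zero laurent_algebra = 0" "add laurent_algebra = (+)"
  "smult laurent_algebra c f = Poly_Mapping.single 0 c * f"
  "adj laurent_algebra = laurent_star"
  by (simp_all add: laurent_algebra_def mult_map_scale_conv_mult)

lemma single_zero_commute:
  fixes f :: laurent
  shows "f * Poly_Mapping.single 0 c = Poly_Mapping.single 0 c * f"
  by (induction f rule: laurent_induct)
    (simp_all add: mult_single mult.commute distrib_left distrib_right)

lemma star_algebra_laurent: "star_algebra laurent_algebra"
proof -
  have "ring laurent_algebra"
  proof (intro ringI abelian_groupI monoidI)
    fix x :: laurent
    show "\<exists>y\<in>carrier laurent_algebra. y \<oplus>\<^bsub>laurent_algebra\<^esub> x = \<zero>\<^bsub>laurent_algebra\<^esub>"
      by (auto intro: exI[of _ "- x"])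
  qed (auto simp: algebra_simps)
  then interpret ring laurent_algebra .
  show ?thesis
  proof
    fix x y :: laurent and c d :: complex
    show "x \<otimes>\<^bsub>laurent_algebra\<^esub> (c \<odot>\<^bsub>laurent_algebra\<^esub> y) =
        c \<odot>\<^bsub>laurent_algebra\<^esub> (x \<otimes>\<^bsub>laurent_algebra\<^esub> y)"
      by simp (metis mult.assoc single_zero_commute)
    show "adj laurent_algebra (c \<odot>\<^bsub>laurent_algebra\<^esub> x) =
        cnj c \<odot>\<^bsub>laurent_algebra\<^esub> adj laurent_algebra x"
      by (simp add: laurent_star_mult laurent_star_single) (rule single_zero_commute)
    show "c \<odot>\<^bsub>laurent_algebra\<^esub> (d \<odot>\<^bsub>laurent_algebra\<^esub> x) = (c * d) \<odot>\<^bsub>laurent_algebra\<^esub> x"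
      by (simp add: mult_single flip: mult.assoc)
  qed (simp_all add: laurent_star_add laurent_star_star laurent_star_mult distrib_left
      distrib_right single_add mult.assoc)
qed

context star_algebra
begin

context
  fixes a assumes a: "a \<in> Units \<A>"
begin

lemma term_closed: "c \<odot> word_eval \<A> a w \<in> carrier \<A>"
  using word_eval_closed[OF a] by auto

lemma laurent_eval_superset:
  assumes "finite S" "Poly_Mapping.keys f \<subseteq> S"
  shows "laurent_eval \<A> a f =
    (\<Oplus>w\<in>S. Poly_Mapping.lookup f w \<odot> word_eval \<A> a (rep_free_group w))"
  unfolding laurent_eval_def
  using assms smult_zero_left[OF word_eval_closed[OF a]] term_closed
  by (intro add.finprod_mono_neutral_cong_left) (auto simp: in_keys_iff)

lemma laurent_eval_closed [simp, intro]: "laurent_eval \<A> a f \<in> carrier \<A>"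
  unfolding laurent_eval_def using term_closed by (intro finsum_closed) auto

lemma laurent_eval_add: "laurent_eval \<A> a (f + g) = laurent_eval \<A> a f \<oplus> laurent_eval \<A> a g"
proof -
  let ?S = "Poly_Mapping.keys f \<union> Poly_Mapping.keys g"
  have "Poly_Mapping.keys (f + g) \<subseteq> ?S"
    by (auto simp: in_keys_iff lookup_add)
  then have "laurent_eval \<A> a (f + g) =
      (\<Oplus>w\<in>?S. Poly_Mapping.lookup f w \<odot> word_eval \<A> a (rep_free_group w) \<oplus>
        Poly_Mapping.lookup g w \<odot> word_eval \<A> a (rep_free_group w))"
    by (subst laurent_eval_superset[of ?S])
      (auto simp: lookup_add smult_add_left[OF word_eval_closed[OF a]])
  also have "\<dots> = laurent_eval \<A> a f \<oplus> laurent_eval \<A> a g"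
    using term_closed
    by (subst finsum_addf) (auto simp: laurent_eval_superset[of ?S])
  finally show ?thesis .
qed

lemma laurent_eval_single:
  "laurent_eval \<A> a (Poly_Mapping.single w c) = c \<odot> word_eval \<A> a (rep_free_group w)"
  using term_closed
  by (subst laurent_eval_superset[of "{w}"]) auto

lemma word_eval_rep_plus:
  "word_eval \<A> a (rep_free_group (v + w)) =
     word_eval \<A> a (rep_free_group v) \<otimes> word_eval \<A> a (rep_free_group w)"
  using word_eval_equiv[OF a word_equiv_rep_plus] word_eval_append[OF a] by simp

lemma word_eval_rep_zero: "word_eval \<A> a (rep_free_group 0) = \<one>"
  using word_eval_equiv[OF a word_equiv_rep_abs[of "[]"]]
  by (simp add: zero_free_group_def word_eval_def)

lemma laurent_eval_mult:
  "laurent_eval \<A> a (f * g) = laurent_eval \<A> a f \<otimes> laurent_eval \<A> a g"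
proof (induction f rule: laurent_induct)
  case (single v c)
  show ?case
  proof (induction g rule: laurent_induct)
    case (single w d)
    show ?case
      using word_eval_closed[OF a]
      by (simp add: mult_single laurent_eval_single word_eval_rep_plus mult_smult_left
          mult_smult_right smult_smult mult.commute[of d c])
  qed (simp add: distrib_left laurent_eval_add r_distr)
qed (simp add: distrib_right laurent_eval_add l_distr)

lemma word_eval_star: "word_eval \<A> a (word_star w) = adj \<A> (word_eval \<A> a w)"
proof (induction w)
  case Nil
  show ?case by (simp add: word_eval_def word_star_def)
next
  case (Cons l w)
  obtain x b where l: "l = (x, b)" by (cases l)
  have l': "word_star (l # w) = word_star w @ [(generator_swap x, b)]"
    by (simp add: word_star_def l)
  have "letter_eval \<A> a (generator_swap x, b) = adj \<A> (letter_eval \<A> a l)"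
    using a adj_Units[OF a] unfolding l by (cases x; cases b) auto
  moreover have "word_eval \<A> a [k] = letter_eval \<A> a k" for k
    using letter_eval_cancel(1)[OF a] by (simp add: word_eval_def)
  moreover have "word_eval \<A> a (l # w) = letter_eval \<A> a l \<otimes> word_eval \<A> a w"
    by (simp add: word_eval_def)
  ultimately show ?case
    using Cons.IH letter_eval_cancel(1)[OF a] word_eval_closed[OF a]
    by (simp add: l' word_eval_append[OF a] adj_mult)
qed

lemma laurent_eval_star: "laurent_eval \<A> a (laurent_star f) = adj \<A> (laurent_eval \<A> a f)"
proof (induction f rule: laurent_induct)
  case (single w c)
  have "word_equiv (rep_free_group (group_star w)) (word_star (rep_free_group w))"
    by (metis abs_rep_free_group group_star.abs_eq word_equiv_rep_abs)
  then have "word_eval \<A> a (rep_free_group (group_star w)) =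
      adj \<A> (word_eval \<A> a (rep_free_group w))"
    using word_eval_equiv[OF a] word_eval_star by metis
  then show ?case
    using word_eval_closed[OF a]
    by (simp add: laurent_star_single laurent_eval_single adj_smult)
qed (simp add: laurent_star_add laurent_eval_add adj_add)

lemma laurent_eval_one: "laurent_eval \<A> a 1 = \<one>"
  using laurent_eval_single[of 0 1] by (simp add: word_eval_rep_zero)

end

end

lemma nc_distribution_any_type:
  fixes \<A> :: "('b, 'c) star_algebra_scheme"
  assumes sp: "nc_prob_space \<A> \<tau>" and a: "a \<in> Units \<A>"
  shows "is_nc_distribution (nc_distribution_of \<A> \<tau> a)"
proof -
  interpret nc_prob_space \<A> \<tau> by fact
  interpret L: star_algebra laurent_algebra by (rule star_algebra_laurent)
  let ?\<phi> = "nc_distribution_of \<A> \<tau> a"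
  have L: "nc_prob_space laurent_algebra ?\<phi>"
  proof
    fix x y c
    show "?\<phi> (x \<oplus>\<^bsub>laurent_algebra\<^esub> y) = ?\<phi> x + ?\<phi> y"
      using laurent_eval_closed[OF a]
      by (simp add: nc_distribution_of_def laurent_eval_add[OF a] state_add)
    show "?\<phi> (c \<odot>\<^bsub>laurent_algebra\<^esub> x) = c * ?\<phi> x"
      using laurent_eval_closed[OF a]
      by (simp add: nc_distribution_of_def laurent_eval_mult[OF a] laurent_eval_single[OF a]
          word_eval_rep_zero[OF a] mult_smult_left state_smult)
    show "?\<phi> \<one>\<^bsub>laurent_algebra\<^esub> = 1"
      by (simp add: nc_distribution_of_def laurent_eval_one[OF a] state_unital)
    show "?\<phi> (x \<otimes>\<^bsub>laurent_algebra\<^esub> y) = ?\<phi> (y \<otimes>\<^bsub>laurent_algebra\<^esub> x)"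
      using laurent_eval_closed[OF a]
      by (simp add: nc_distribution_of_def laurent_eval_mult[OF a] state_tracial)
    show "?\<phi> (x \<otimes>\<^bsub>laurent_algebra\<^esub> adj laurent_algebra x) \<in> \<real>\<^sub>\<ge>\<^sub>0"
      using laurent_eval_closed[OF a]
      by (simp add: nc_distribution_of_def laurent_eval_mult[OF a] laurent_eval_star[OF a]
          state_pos)
  qed
  define A :: laurent where "A = Poly_Mapping.single (abs_free_group [(Gen, True)]) 1"
  define A' :: laurent where "A' = Poly_Mapping.single (abs_free_group [(Gen, False)]) 1"
  have inv: "word_equiv [(x, b), (x, \<not> b)] []" for x :: generator and b
    using word_cancel[of "[]" x b "[]"] by simp
  have AA': "A * A' = 1" "A' * A = 1"
    using inv[of Gen True] inv[of Gen False]
    by (auto simp: A_def A'_def mult_single plus_free_group.abs_eq zero_free_group_def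
        free_group.abs_eq_iff simp flip: single_one intro: arg_cong2[of _ _ _ _ Poly_Mapping.single])
  have U: "A \<in> Units laurent_algebra"
    using AA' by (auto simp: Units_def)
  have letter: "letter_eval laurent_algebra A l =
      Poly_Mapping.single (abs_free_group [l]) 1" for l
  proof -
    have iA: "inv\<^bsub>laurent_algebra\<^esub> A = A'"
      using AA' by (intro L.inv_char) auto
    have sA: "laurent_star A = Poly_Mapping.single (abs_free_group [(Gen_star, True)]) 1"
      and sA': "laurent_star A' = Poly_Mapping.single (abs_free_group [(Gen_star, False)]) 1"
      by (simp_all add: A_def A'_def laurent_star_single group_star.abs_eq word_star_def)
    have "inv\<^bsub>laurent_algebra\<^esub> (laurent_star A) = laurent_star A'"
      using L.adj_Units(2)[OF U] iA by simp
    then show ?thesis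
      using iA sA sA'
      by (cases "(laurent_algebra, A, l)" rule: letter_eval.cases) (auto simp: A_def A'_def)
  qed
  have word: "word_eval laurent_algebra A w = Poly_Mapping.single (abs_free_group w) 1" for w
  proof (induction w)
    case Nil
    show ?case by (simp add: word_eval_def zero_free_group_def flip: single_one)
  next
    case (Cons l w)
    then show ?case
      by (simp add: word_eval_def letter mult_single plus_free_group.abs_eq)
  qed
  have "laurent_eval laurent_algebra A f = f" for f
  proof (induction f rule: laurent_induct)
    case (single w c)
    show ?case
      by (simp add: L.laurent_eval_single[OF U] word abs_rep_free_group mult_single)
  next
    case (add f g)
    then show ?case by (simp add: L.laurent_eval_add[OF U])
  qed
  then have "?\<phi> = nc_distribution_of laurent_algebra ?\<phi> A"
    by (simp add: fun_eq_iff nc_distribution_of_def[of laurent_algebra])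
  with L U show ?thesis
    unfolding is_nc_distribution_def by blast
qed


section \<open>The group of invertible matrices\<close>

definition matrix_algebra :: "nat \<Rightarrow> complex mat star_algebra" where
  "matrix_algebra N =
     \<lparr>carrier = carrier_mat N N, mult = (*), one = 1\<^sub>m N, zero = 0\<^sub>m N N, add = (+),
      smult = (\<cdot>\<^sub>m), adj = mat_adjoint\<rparr>"

definition mat_trace :: "complex mat \<Rightarrow> complex" where
  "mat_trace A = (\<Sum>i<dim_row A. A $$ (i, i))"

definition normalized_trace :: "nat \<Rightarrow> complex mat \<Rightarrow> complex" where
  "normalized_trace N A = mat_trace A / of_nat N"

definition empirical_distribution :: "nat \<Rightarrow> complex mat \<Rightarrow> laurent \<Rightarrow> complex" where
  "empirical_distribution N = nc_distribution_of (matrix_algebra N) (normalized_trace N)"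

definition GL :: "nat \<Rightarrow> complex mat set" where
  "GL N = {g \<in> carrier_mat N N. invertible_mat g}"

definition entries :: "complex mat \<Rightarrow> nat \<times> nat \<Rightarrow> complex" where
  "entries A = (\<lambda>(i, j). if i < dim_row A \<and> j < dim_col A then A $$ (i, j) else 0)"

text \<open>The topology of entrywise convergence.\<close>

definition GL_topology :: "nat \<Rightarrow> complex mat topology" where
  "GL_topology N = pullback_topology (GL N) entries euclidean"

definition GL_borel :: "nat \<Rightarrow> complex mat measure" where
  "GL_borel N = sigma (GL N) {U. openin (GL_topology N) U}"

definition mat_exp :: "complex mat \<Rightarrow> complex mat" where
  "mat_exp A = Matrix.mat (dim_row A) (dim_row A)
     (\<lambda>(i, j). suminf (\<lambda>k. (A ^\<^sub>m k) $$ (i, j) / fact k))"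


section \<open>The heat kernel measure\<close>

definition flow :: "complex mat \<Rightarrow> complex mat \<Rightarrow> real \<Rightarrow> complex mat" where
  "flow \<xi> g u = g * mat_exp (complex_of_real u \<cdot>\<^sub>m \<xi>)"

definition left_inv_deriv ::
    "complex mat \<Rightarrow> (complex mat \<Rightarrow> complex) \<Rightarrow> complex mat \<Rightarrow> complex" where
  "left_inv_deriv \<xi> f g = vector_derivative (\<lambda>u. f (flow \<xi> g u)) (at 0)"

text \<open>Smoothness on the Lie group: all iterated left-invariant derivatives exist and are
  continuous.\<close>

definition smooth_GL :: "nat \<Rightarrow> (complex mat \<Rightarrow> complex) \<Rightarrow> bool" where
  "smooth_GL N f \<longleftrightarrow>
     (\<forall>\<xi>s. set \<xi>s \<subseteq> carrier_mat N N \<longrightarrow>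
        continuous_map (GL_topology N) euclidean (foldr left_inv_deriv \<xi>s f) \<and>
        (\<forall>\<xi>\<in>carrier_mat N N. \<forall>g\<in>GL N.
           (\<lambda>u. foldr left_inv_deriv \<xi>s f (flow \<xi> g u)) differentiable (at 0)))"

definition Cc_GL :: "nat \<Rightarrow> (complex mat \<Rightarrow> complex) set" where
  "Cc_GL N =
     {f. continuous_map (GL_topology N) euclidean f \<and>
         (\<exists>K. compactin (GL_topology N) K \<and> (\<forall>g\<in>GL N - K. f g = 0))}"

definition u_algebra :: "nat \<Rightarrow> complex mat set" where
  "u_algebra N = {X \<in> carrier_mat N N. mat_adjoint X = - X}"

text \<open>The inner product of \<open>u_algebra N\<close>; its values there are real.\<close>

definition u_inner :: "nat \<Rightarrow> complex mat \<Rightarrow> complex mat \<Rightarrow> complex" where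
  "u_inner N X Y = - of_nat N * mat_trace (X * Y)"

definition orthonormal_basis_u :: "nat \<Rightarrow> complex mat set \<Rightarrow> bool" where
  "orthonormal_basis_u N \<beta> \<longleftrightarrow>
     finite \<beta> \<and> \<beta> \<subseteq> u_algebra N \<and>
     (\<forall>X\<in>\<beta>. \<forall>Y\<in>\<beta>. u_inner N X Y = (if X = Y then 1 else 0)) \<and>
     (\<forall>Y\<in>u_algebra N. \<exists>c :: complex mat \<Rightarrow> real. \<forall>i<N. \<forall>j<N.
        Y $$ (i, j) = (\<Sum>X\<in>\<beta>. complex_of_real (c X) * X $$ (i, j)))"

definition A_op ::
    "complex mat set \<Rightarrow> real \<Rightarrow> real \<Rightarrow> (complex mat \<Rightarrow> complex) \<Rightarrow> complex mat \<Rightarrow> complex" where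
  "A_op \<beta> s t f g =
     complex_of_real (s - t / 2) * (\<Sum>X\<in>\<beta>. left_inv_deriv X (left_inv_deriv X f) g) +
     complex_of_real (t / 2) *
       (\<Sum>X\<in>\<beta>. left_inv_deriv (\<i> \<cdot>\<^sub>m X) (left_inv_deriv (\<i> \<cdot>\<^sub>m X) f) g)"

text \<open>\<open>u r = e\<^bsup>rA/2\<^esup> f\<close> for all \<open>r \<ge> 0\<close>: the bounded classical solution of the heat equation
  with initial value \<open>f\<close>.  For \<open>t > 0\<close>, \<open>s > t/2\<close> and \<open>f \<in> C\<^sub>c\<close> it exists and is unique on
  \<open>GL N\<close> (the operator is elliptic and left invariant), and it is the orbit of \<open>f\<close> under the
  heat semigroup; values off \<open>GL N\<close> are irrelevant.\<close>

definition heat_flow ::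
    "nat \<Rightarrow> complex mat set \<Rightarrow> real \<Rightarrow> real \<Rightarrow> (complex mat \<Rightarrow> complex) \<Rightarrow>
       (real \<Rightarrow> complex mat \<Rightarrow> complex) \<Rightarrow> bool" where
  "heat_flow N \<beta> s t f u \<longleftrightarrow>
     (\<exists>K. \<forall>r\<ge>0. \<forall>g\<in>GL N. cmod (u r g) \<le> K) \<and>
     continuous_map (prod_topology (top_of_set {0..}) (GL_topology N)) euclidean
       (\<lambda>(r, g). u r g) \<and>
     (\<forall>g\<in>GL N. u 0 g = f g) \<and>
     (\<forall>r>0. smooth_GL N (u r)) \<and>
     (\<forall>r>0. \<forall>g\<in>GL N. ((\<lambda>r. u r g) has_vector_derivative (1 / 2) * A_op \<beta> s t (u r) g) (at r))"

definition heat_kernel_measure ::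
    "nat \<Rightarrow> complex mat set \<Rightarrow> real \<Rightarrow> real \<Rightarrow> complex mat measure \<Rightarrow> bool" where
  "heat_kernel_measure N \<beta> s t \<mu> \<longleftrightarrow>
     prob_space \<mu> \<and> sets \<mu> = sets (GL_borel N) \<and>
     (\<forall>f\<in>Cc_GL N. \<exists>u. heat_flow N \<beta> s t f u \<and> (\<integral>g. f g \<partial>\<mu>) = u 1 (1\<^sub>m N))"

definition has_heat_kernel_law ::
    "nat \<Rightarrow> complex mat set \<Rightarrow> real \<Rightarrow> real \<Rightarrow> 'w measure \<Rightarrow> ('w \<Rightarrow> complex mat) \<Rightarrow> bool" where
  "has_heat_kernel_law N \<beta> s t M Z \<longleftrightarrow>
     prob_space M \<and> Z \<in> M \<rightarrow>\<^sub>M GL_borel N \<and>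
     heat_kernel_measure N \<beta> s t (distr M (GL_borel N) Z)"

definition complex_variance :: "'w measure \<Rightarrow> ('w \<Rightarrow> complex) \<Rightarrow> real" where
  "complex_variance M F = (\<integral>\<omega>. (cmod (F \<omega> - (\<integral>\<omega>'. F \<omega>' \<partial>M)))\<^sup>2 \<partial>M)"

definition admissible :: "(real \<times> real) set" where
  "admissible = {(s, t). 0 < s \<and> 0 < t \<and> t / 2 < s}"

end

theory Submission
  imports Defs
begin

text \<open>Encode the function \<open>g \<mapsto> tr(w\<^sub>1(g)) \<cdots> tr(w\<^sub>k(g))\<close> by the list of words \<open>[w\<^sub>1, \<dots>, w\<^sub>k]\<close>.
  The operator \<open>A\<close> maps such a function to a finite combination of functions of the same total
  word length, whose coefficients depend on \<open>N\<close> only through a term proportional to \<open>1/N\<^sup>2\<close>.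
  Since every such function is \<open>1\<close> at the identity, its integral against the heat kernel
  measure is the exponential series of this combinatorial generator applied to the constant
  \<open>1\<close>. The bound on the mean follows by comparing this series with the one
  without the \<open>1/N\<^sup>2\<close> term. The latter generator is a derivation with respect to concatenation,
  so the limiting moments are multiplicative, which bounds the variance.

  The heat kernel measure is only known through bounded solutions with data in \<open>C\<^sub>c\<close>.
  Such a solution is compared, by the parabolic maximum principle, with Taylor polynomials of the
  formal solution plus a small multiple of the barrier \<open>1 + tr(gg\<^sup>*)\<^sup>m + tr(g\<^sup>-\<^sup>1g\<^sup>-\<^sup>*)\<^sup>m\<close>.
  The barrier is itself a combination of products of traces and hence satisfies \<open>A b \<le> C b\<close>.\<close>

section \<open>The generator on trace states\<close>

text \<open>Both powers of \<open>N\<close> are decided by the completeness relation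
  \<open>basis_contraction\<close>: contracting two insertions inside one trace splits it in two and
  the normalisations cancel, while contracting insertions in two traces merges them and leaves
  \<open>1 / N^2\<close>. With \<open>1 / N^2\<close> replaced by a free parameter
  \<open>\<kappa>\<close> in [0, 1] the generator no longer mentions matrices, and
  \<open>\<kappa> = 0\<close> is the limit. On states of total length \<open>n\<close> it is bounded
  by \<open>2 s n^2\<close>, uniformly in \<open>\<kappa>\<close>, because the weights
  \<open>s - t/2\<close> and \<open>t/2\<close> are nonnegative with sum \<open>s\<close>. So for
  fixed \<open>f\<close> the final constants are explicit continuous functions of \<open>s\<close>.
  The analytic obstacle is that traces of words are unbounded, whereas the heat flow is given for
  compactly supported data. A state of length at most \<open>2 m\<close> is therefore compared with
  a barrier of degree \<open>m + 1\<close>: the surplus power makes the comparison function tend to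
  infinity, and it also pays for cutting the state off. One-sided estimates suffice, since the state
  may be multiplied by any of the phases 1, -1, i, -i.\<close>

type_synonym word = "(generator \<times> bool) list"

text \<open>The derivative of a letter in the direction \<open>z X\<close>, with \<open>X\<close> skew-Hermitian, is a coefficient
  times the letter with \<open>X\<close> inserted on one of its sides. An entry \<open>(c, u, v)\<close> of \<open>splits z w\<close> is
  the summand \<open>c u X v\<close> of the derivative of the word \<open>w\<close>.\<close>

fun letter_coeff :: "complex \<Rightarrow> generator \<times> bool \<Rightarrow> complex" where
  "letter_coeff z (Gen, True) = z"
| "letter_coeff z (Gen, False) = - z"
| "letter_coeff z (Gen_star, True) = - cnj z"
| "letter_coeff z (Gen_star, False) = cnj z"

text \<open>Differentiating \<open>g e^(u z X)\<close> puts \<open>X\<close> to the right of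
  \<open>A\<close>, hence to the left of its inverse; taking adjoints swaps the sides. The letter
  therefore precedes the cut exactly for \<open>(Gen, True)\<close> and
  \<open>(Gen_star, False)\<close>.\<close>

fun cut_letter :: "generator \<times> bool \<Rightarrow> word \<times> word" where
  "cut_letter (x, b) = (if (x = Gen) = b then ([(x, b)], []) else ([], [(x, b)]))"

primrec splits :: "complex \<Rightarrow> word \<Rightarrow> (complex \<times> word \<times> word) list" where
  "splits z [] = []"
| "splits z (l # w) = (letter_coeff z l, fst (cut_letter l), snd (cut_letter l) @ w) #
     map (\<lambda>(c, u, v). (c, l # u, v)) (splits z w)"

primrec state_splits :: "complex \<Rightarrow> word list \<Rightarrow> (complex \<times> word \<times> word \<times> word list) list" where
  "state_splits z [] = []"
| "state_splits z (w # ws) = map (\<lambda>(c, u, v). (c, u, v, ws)) (splits z w) @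
     map (\<lambda>(c, u, v, r). (c, u, v, w # r)) (state_splits z ws)"

text \<open>The sum over an orthonormal basis of the second derivatives along \<open>z X\<close> of a product of
  traces is \<open>free_part + cross_part / N\<^sup>2\<close>: two insertions in the same word contract by
  \<open>\<Sum> X B X = - tr(B)\<close>, insertions in different words by \<open>\<Sum> tr(X B) tr(X C) = - tr(B C) / N\<^sup>2\<close>.\<close>

primrec free_part :: "complex \<Rightarrow> word list \<Rightarrow> (word list \<Rightarrow> complex) \<Rightarrow> complex" where
  "free_part z [] F = 0"
| "free_part z (w # ws) F =
     - (\<Sum>(c, u, v)\<leftarrow>splits z w. c *
         ((\<Sum>(d, a, b)\<leftarrow>splits z u. d * F (b # (a @ v) # ws)) +
          (\<Sum>(d, a, b)\<leftarrow>splits z v. d * F (a # (u @ b) # ws)))) +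
     free_part z ws (\<lambda>x. F (w # x))"

text \<open>Each pair of distinct words is visited once, with \<open>w\<close> the earlier one, and
  the mixed term of a second derivative occurs twice: hence the 2. The merged word
  \<open>v @ u @ b @ a\<close> arises by rotating both traces until the inserted \<open>X\<close>
  comes first.\<close>

primrec cross_part :: "complex \<Rightarrow> word list \<Rightarrow> (word list \<Rightarrow> complex) \<Rightarrow> complex" where
  "cross_part z [] F = 0"
| "cross_part z (w # ws) F =
     - 2 * (\<Sum>(c, u, v)\<leftarrow>splits z w. \<Sum>(d, a, b, r)\<leftarrow>state_splits z ws.
         c * d * F ((v @ u @ b @ a) # r)) +
     cross_part z ws (\<lambda>x. F (w # x))"

text \<open>\<open>z = 1\<close> gives the directions \<open>X\<close> and \<open>z = \<i>\<close>
  the directions \<open>\<i> X\<close>. The parameter \<open>\<kappa>\<close> stands for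
  \<open>1 / N^2\<close> but is left free, so that the generators for finite \<open>N\<close> and
  for the limit can be subtracted.\<close>

definition heat_gen :: "real \<Rightarrow> real \<Rightarrow> real \<Rightarrow> (word list \<Rightarrow> complex) \<Rightarrow> word list \<Rightarrow> complex" where
  "heat_gen s t \<kappa> F ws =
     of_real (s - t / 2) * (free_part 1 ws F + of_real \<kappa> * cross_part 1 ws F) +
     of_real (t / 2) * (free_part \<i> ws F + of_real \<kappa> * cross_part \<i> ws F)"

text \<open>The quantity conserved by both parts: a contraction removes the inserted matrices and
  only regroups the letters. Estimates are made on states of one fixed total length.\<close>

definition total_length :: "word list \<Rightarrow> nat" where
  "total_length ws = sum_list (map length ws)"

lemma total_length_simps [simp]:
  "total_length [] = 0" "total_length (w # ws) = length w + total_length ws"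
  "total_length (ws @ vs) = total_length ws + total_length vs"
  by (simp_all add: total_length_def)

section \<open>Bounds for the generator on states of fixed total length\<close>

lemma cmod_sum_list_le:
  assumes "\<And>x. x \<in> set xs \<Longrightarrow> cmod (f x) \<le> M"
  shows "cmod (\<Sum>x\<leftarrow>xs. f x) \<le> real (length xs) * M"
  using assms
proof (induction xs)
  case (Cons x xs)
  have "cmod (f x + (\<Sum>x\<leftarrow>xs. f x)) \<le> M + real (length xs) * M"
    using Cons by (intro norm_triangle_mono) auto
  then show ?case by (simp add: algebra_simps)
qed simp

lemma cmod_letter_coeff: "cmod (letter_coeff z l) = cmod z"
  by (cases "(z, l)" rule: letter_coeff.cases) auto

lemma cut_letter_append: "fst (cut_letter l) @ snd (cut_letter l) = [l]"
  by (cases l) auto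

lemma length_splits [simp]: "length (splits z w) = length w"
  by (induction w) auto

lemma splitsD:
  assumes "(c, u, v) \<in> set (splits z w)"
  shows "u @ v = w \<and> cmod c = cmod z"
  using assms
proof (induction w arbitrary: u)
  case (Cons l w)
  then show ?case
    using cut_letter_append[of l] cmod_letter_coeff[of z l]
    by (auto simp flip: append_assoc)
qed simp

lemma length_state_splits [simp]: "length (state_splits z ws) = total_length ws"
  by (induction ws) auto

lemma state_splitsD:
  assumes "(c, u, v, r) \<in> set (state_splits z ws)"
  shows "length u + length v + total_length r = total_length ws \<and> cmod c = cmod z"
  using assms
proof (induction ws arbitrary: r)
  case (Cons w ws)
  then show ?case by (force dest: splitsD)
qed simp

text \<open>A cut in a word of length \<open>m\<close> and a second cut in one of its two pieces can
  be chosen in \<open>m * m\<close> ways, each with coefficients of modulus 1. The squares of the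
  word lengths add up to at most the square of the total length.\<close>

lemma free_part_bound:
  assumes z: "cmod z = 1" and F: "\<And>x. total_length x = total_length ws \<Longrightarrow> cmod (F x) \<le> M"
  shows "cmod (free_part z ws F) \<le> (real (total_length ws))\<^sup>2 * M"
  using F
proof (induction ws arbitrary: F)
  case (Cons w ws)
  let ?m = "real (length w)" and ?n = "real (total_length ws)"
  have M: "0 \<le> M" using Cons.prems[of "w # ws"] norm_ge_zero[of "F (w # ws)"] by linarith
  have 1: "cmod (case p of (c, u, v) \<Rightarrow> c *
         ((\<Sum>(d, a, b)\<leftarrow>splits z u. d * F (b # (a @ v) # ws)) +
          (\<Sum>(d, a, b)\<leftarrow>splits z v. d * F (a # (u @ b) # ws)))) \<le> ?m * M"
    if p: "p \<in> set (splits z w)" for p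
  proof -
    obtain c u v where p': "p = (c, u, v)" by (cases p)
    note c = splitsD[OF p[unfolded p']]
    have "cmod (\<Sum>(d, a, b)\<leftarrow>splits z u. d * F (b # (a @ v) # ws)) \<le> real (length (splits z u)) * M"
      by (intro cmod_sum_list_le) (use c z in \<open>auto dest!: splitsD simp: norm_mult intro!: Cons.prems\<close>)
    moreover have "cmod (\<Sum>(d, a, b)\<leftarrow>splits z v. d * F (a # (u @ b) # ws)) \<le> real (length (splits z v)) * M"
      by (intro cmod_sum_list_le) (use c z in \<open>auto dest!: splitsD simp: norm_mult intro!: Cons.prems\<close>)
    ultimately have "cmod ((\<Sum>(d, a, b)\<leftarrow>splits z u. d * F (b # (a @ v) # ws)) +
          (\<Sum>(d, a, b)\<leftarrow>splits z v. d * F (a # (u @ b) # ws))) \<le> real (length u) * M + real (length v) * M"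
      by (intro norm_triangle_mono) auto
    also have "\<dots> = ?m * M" using c by (auto simp: algebra_simps)
    finally show ?thesis using c z p' by (simp add: norm_mult)
  qed
  have "cmod (free_part z (w # ws) F) \<le> real (length (splits z w)) * (?m * M) + ?n\<^sup>2 * M"
    unfolding free_part.simps
  proof (intro norm_triangle_mono)
    show "cmod (free_part z ws (\<lambda>x. F (w # x))) \<le> ?n\<^sup>2 * M"
      by (intro Cons.IH Cons.prems) simp
  qed (unfold norm_minus_cancel, intro cmod_sum_list_le 1)
  also have "\<dots> = (?m\<^sup>2 + ?n\<^sup>2) * M" by (simp add: power2_eq_square algebra_simps)
  also have "\<dots> \<le> (?m + ?n)\<^sup>2 * M"
    using M by (intro mult_right_mono) (auto simp: power2_sum)
  finally show ?case by simp
qed simp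

text \<open>There are \<open>m n\<close> pairs of a cut in \<open>w\<close> and a cut in the
  remaining words; doubled, they are the mixed term of \<open>(m + n)^2\<close>.\<close>

lemma cross_part_bound:
  assumes z: "cmod z = 1" and F: "\<And>x. total_length x = total_length ws \<Longrightarrow> cmod (F x) \<le> M"
  shows "cmod (cross_part z ws F) \<le> (real (total_length ws))\<^sup>2 * M"
  using F
proof (induction ws arbitrary: F)
  case (Cons w ws)
  let ?m = "real (length w)" and ?n = "real (total_length ws)"
  have M: "0 \<le> M" using Cons.prems[of "w # ws"] norm_ge_zero[of "F (w # ws)"] by linarith
  have 1: "cmod (case p of (c, u, v) \<Rightarrow> \<Sum>(d, a, b, r)\<leftarrow>state_splits z ws.
         c * d * F ((v @ u @ b @ a) # r)) \<le> ?n * M"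
    if p: "p \<in> set (splits z w)" for p
  proof -
    obtain c u v where p': "p = (c, u, v)" by (cases p)
    note c = splitsD[OF p[unfolded p']]
    have "cmod (\<Sum>(d, a, b, r)\<leftarrow>state_splits z ws. c * d * F ((v @ u @ b @ a) # r))
        \<le> real (length (state_splits z ws)) * M"
      by (intro cmod_sum_list_le)
        (use c z in \<open>auto dest!: state_splitsD simp: norm_mult intro!: Cons.prems\<close>)
    then show ?thesis using p' by simp
  qed
  have "cmod (cross_part z (w # ws) F) \<le> 2 * (real (length (splits z w)) * (?n * M)) + ?n\<^sup>2 * M"
    unfolding cross_part.simps
  proof (intro norm_triangle_mono)
    show "cmod (cross_part z ws (\<lambda>x. F (w # x))) \<le> ?n\<^sup>2 * M"
      by (intro Cons.IH Cons.prems) simp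
    have "cmod (\<Sum>(c, u, v)\<leftarrow>splits z w. \<Sum>(d, a, b, r)\<leftarrow>state_splits z ws.
         c * d * F ((v @ u @ b @ a) # r)) \<le> real (length (splits z w)) * (?n * M)"
      by (intro cmod_sum_list_le 1)
    then show "cmod (- 2 * (\<Sum>(c, u, v)\<leftarrow>splits z w. \<Sum>(d, a, b, r)\<leftarrow>state_splits z ws.
         c * d * F ((v @ u @ b @ a) # r))) \<le> 2 * (real (length (splits z w)) * (?n * M))"
      by (simp add: norm_mult)
  qed
  also have "\<dots> = (2 * ?m * ?n + ?n\<^sup>2) * M" by (simp add: algebra_simps)
  also have "\<dots> \<le> (?m + ?n)\<^sup>2 * M"
    using M by (intro mult_right_mono) (auto simp: power2_sum)
  finally show ?case by simp
qed simp

text \<open>Two cuts in the same word never touch the other words, so this part obeys a Leibniz rule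
  for concatenation. Covariances of traces come from \<open>cross_part\<close>, which does
  not.\<close>

lemma free_part_append:
  "free_part z (ws @ vs) F = free_part z ws (\<lambda>x. F (x @ vs)) + free_part z vs (\<lambda>x. F (ws @ x))"
  by (induction ws arbitrary: F) (auto simp: algebra_simps)

text \<open>Evaluations of iterated generators are finite combinations of point evaluations. This
  gives linearity at once, and later continuity and differentiability under the functional; the
  common total length keeps the class stable under composition with \<open>heat_gen\<close>.\<close>

definition finite_functional :: "nat \<Rightarrow> ((word list \<Rightarrow> complex) \<Rightarrow> complex) \<Rightarrow> bool" where
  "finite_functional n \<Lambda> \<longleftrightarrow>
     (\<exists>L. (\<forall>(c, x)\<in>set L. total_length x = n) \<and> (\<forall>F. \<Lambda> F = (\<Sum>(c, x)\<leftarrow>L. c * F x)))"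

lemma finite_functional_eval: "finite_functional (total_length x) (\<lambda>F. F x)"
  unfolding finite_functional_def by (rule exI[of _ "[(1, x)]"]) auto

lemma finite_functional_zero: "finite_functional n (\<lambda>F. 0)"
  unfolding finite_functional_def by (rule exI[of _ "[]"]) auto

lemma finite_functional_add:
  assumes "finite_functional n \<Lambda>" "finite_functional n \<Lambda>'"
  shows "finite_functional n (\<lambda>F. \<Lambda> F + \<Lambda>' F)"
proof -
  obtain L L' where
    "(\<forall>(c, x)\<in>set L. total_length x = n) \<and> (\<forall>F. \<Lambda> F = (\<Sum>(c, x)\<leftarrow>L. c * F x))"
    "(\<forall>(c, x)\<in>set L'. total_length x = n) \<and> (\<forall>F. \<Lambda>' F = (\<Sum>(c, x)\<leftarrow>L'. c * F x))"
    using assms unfolding finite_functional_def by blast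
  then show ?thesis
    unfolding finite_functional_def by (intro exI[of _ "L @ L'"]) auto
qed

lemma finite_functional_scale:
  assumes "finite_functional n \<Lambda>"
  shows "finite_functional n (\<lambda>F. a * \<Lambda> F)"
proof -
  obtain L where L:
    "(\<forall>(c, x)\<in>set L. total_length x = n) \<and> (\<forall>F. \<Lambda> F = (\<Sum>(c, x)\<leftarrow>L. c * F x))"
    using assms unfolding finite_functional_def by blast
  have "a * (\<Sum>(c, x)\<leftarrow>L. c * F x) = (\<Sum>(c, x)\<leftarrow>map (\<lambda>(c, x). (a * c, x)) L. c * F x)" for F
    by (induction L) (auto simp: algebra_simps)
  with L show ?thesis
    unfolding finite_functional_def by (intro exI[of _ "map (\<lambda>(c, x). (a * c, x)) L"]) auto
qed

lemma finite_functional_sum_list: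
  assumes "\<And>p. p \<in> set ps \<Longrightarrow> finite_functional n (\<Lambda> p)"
  shows "finite_functional n (\<lambda>F. \<Sum>p\<leftarrow>ps. \<Lambda> p F)"
  using assms
  by (induction ps) (auto intro: finite_functional_zero finite_functional_add)

lemma finite_functional_Cons:
  assumes "finite_functional n \<Lambda>"
  shows "finite_functional (length w + n) (\<lambda>F. \<Lambda> (\<lambda>x. F (w # x)))"
proof -
  obtain L where L:
    "(\<forall>(c, x)\<in>set L. total_length x = n) \<and> (\<forall>F. \<Lambda> F = (\<Sum>(c, x)\<leftarrow>L. c * F x))"
    using assms unfolding finite_functional_def by blast
  have "(\<Sum>(c, x)\<leftarrow>L. c * F (w # x)) = (\<Sum>(c, x)\<leftarrow>map (\<lambda>(c, x). (c, w # x)) L. c * F x)" for F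
    by (induction L) (auto simp: algebra_simps)
  with L show ?thesis
    unfolding finite_functional_def by (intro exI[of _ "map (\<lambda>(c, x). (c, w # x)) L"]) auto
qed

lemma finite_functional_evalI: "total_length x = n \<Longrightarrow> finite_functional n (\<lambda>F. F x)"
  using finite_functional_eval by blast

lemma finite_functional_free_part: "finite_functional (total_length ws) (free_part z ws)"
proof (induction ws)
  case Nil
  show ?case using finite_functional_zero by simp
next
  case (Cons w ws)
  have 1: "finite_functional (total_length (w # ws)) (\<lambda>F. case p of (c, u, v) \<Rightarrow> c *
         ((\<Sum>(d, a, b)\<leftarrow>splits z u. d * F (b # (a @ v) # ws)) +
          (\<Sum>(d, a, b)\<leftarrow>splits z v. d * F (a # (u @ b) # ws))))"
    if p: "p \<in> set (splits z w)" for p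
  proof -
    obtain c u v where p': "p = (c, u, v)" by (cases p)
    note c = splitsD[OF p[unfolded p']]
    show ?thesis unfolding p' prod.case
      by (intro finite_functional_scale finite_functional_add finite_functional_sum_list)
        (use c in \<open>auto split: prod.splits dest!: splitsD
          intro!: finite_functional_scale finite_functional_evalI\<close>)
  qed
  have "finite_functional (total_length (w # ws)) (\<lambda>F. (- 1) * (\<Sum>p\<leftarrow>splits z w. case p of (c, u, v) \<Rightarrow> c *
         ((\<Sum>(d, a, b)\<leftarrow>splits z u. d * F (b # (a @ v) # ws)) +
          (\<Sum>(d, a, b)\<leftarrow>splits z v. d * F (a # (u @ b) # ws)))) +
     free_part z ws (\<lambda>x. F (w # x)))"
    using finite_functional_Cons[OF Cons.IH]
    by (intro finite_functional_add finite_functional_scale finite_functional_sum_list 1) simp_all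
  then show ?case by simp
qed

lemma finite_functional_cross_part: "finite_functional (total_length ws) (cross_part z ws)"
proof (induction ws)
  case Nil
  show ?case using finite_functional_zero by simp
next
  case (Cons w ws)
  have 1: "finite_functional (total_length (w # ws)) (\<lambda>F. case p of (c, u, v) \<Rightarrow>
      \<Sum>(d, a, b, r)\<leftarrow>state_splits z ws. c * d * F ((v @ u @ b @ a) # r))"
    if p: "p \<in> set (splits z w)" for p
  proof -
    obtain c u v where p': "p = (c, u, v)" by (cases p)
    note c = splitsD[OF p[unfolded p']]
    show ?thesis unfolding p' prod.case
      by (intro finite_functional_sum_list)
        (use c in \<open>auto split: prod.splits dest!: state_splitsD
          intro!: finite_functional_scale finite_functional_evalI\<close>)
  qed
  have "finite_functional (total_length (w # ws)) (\<lambda>F. (- 2) * (\<Sum>p\<leftarrow>splits z w. case p of (c, u, v) \<Rightarrow>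
      \<Sum>(d, a, b, r)\<leftarrow>state_splits z ws. c * d * F ((v @ u @ b @ a) # r)) +
     cross_part z ws (\<lambda>x. F (w # x)))"
    using finite_functional_Cons[OF Cons.IH]
    by (intro finite_functional_add finite_functional_scale finite_functional_sum_list 1) simp_all
  then show ?case by simp
qed

lemma finite_functional_heat_gen: "finite_functional (total_length ws) (\<lambda>F. heat_gen s t \<kappa> F ws)"
  unfolding heat_gen_def
  by (intro finite_functional_add finite_functional_scale
      finite_functional_free_part finite_functional_cross_part)

lemma finite_functional_linear:
  assumes "finite_functional n \<Lambda>"
  shows "\<Lambda> (\<lambda>x. a * F x + b * F' x) = a * \<Lambda> F + b * \<Lambda> F'"
proof -
  obtain L where L: "\<And>F. \<Lambda> F = (\<Sum>(c, x)\<leftarrow>L. c * F x)"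
    using assms unfolding finite_functional_def by blast
  show ?thesis unfolding L by (induction L) (auto simp: algebra_simps)
qed

lemma finite_functional_compose_heat_gen:
  assumes "finite_functional n \<Lambda>"
  shows "finite_functional n (\<lambda>F. \<Lambda> (heat_gen s t \<kappa> F))"
proof -
  obtain L where L: "\<forall>p\<in>set L. total_length (snd p) = n"
    and \<Lambda>: "\<And>F. \<Lambda> F = (\<Sum>p\<leftarrow>L. fst p * F (snd p))"
    using assms unfolding finite_functional_def case_prod_beta by blast
  show ?thesis unfolding \<Lambda>
  proof (intro finite_functional_sum_list finite_functional_scale)
    fix p assume "p \<in> set L"
    then have "total_length (snd p) = n" using L by auto
    then show "finite_functional n (\<lambda>F. heat_gen s t \<kappa> F (snd p))"
      using finite_functional_heat_gen by blast
  qed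
qed

lemma finite_functional_iterate:
  "finite_functional (total_length ws) (\<lambda>F. (heat_gen s t \<kappa> ^^ k) F ws)"
proof (induction k)
  case 0
  show ?case by (simp add: finite_functional_eval)
next
  case (Suc k)
  \<comment> \<open>The innermost application is split off,
    \<open>(G ^^ Suc k) F = (G ^^ k) (G F)\<close>, so the functional for \<open>k\<close> is the
    one composed with \<open>G\<close>.\<close>
  show ?case
    using finite_functional_compose_heat_gen[OF Suc, of s t \<kappa>] by (simp add: funpow_Suc_right del: funpow.simps)
qed

text \<open>Each bracket in \<open>heat_gen\<close> is at most \<open>2 n^2 M\<close> because
  \<open>\<kappa> \<le> 1\<close>, and the nonnegative weights \<open>s - t / 2\<close> and
  \<open>t / 2\<close> add up to \<open>s\<close>. This is why \<open>t\<close> disappears from all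
  constants.\<close>

lemma heat_gen_bound:
  assumes st: "0 \<le> t" "t / 2 \<le> s" and \<kappa>: "0 \<le> \<kappa>" "\<kappa> \<le> 1"
    and F: "\<And>x. total_length x = total_length ws \<Longrightarrow> cmod (F x) \<le> M"
  shows "cmod (heat_gen s t \<kappa> F ws) \<le> 2 * s * (real (total_length ws))\<^sup>2 * M"
proof -
  let ?n = "(real (total_length ws))\<^sup>2 * M"
  have 1: "cmod (free_part z ws F + of_real \<kappa> * cross_part z ws F) \<le> ?n + ?n" if z: "cmod z = 1" for z
  proof (intro norm_triangle_mono)
    have "\<kappa> * cmod (cross_part z ws F) \<le> 1 * ?n"
      using cross_part_bound[where F = F, OF z F] \<kappa> by (intro mult_mono) auto
    then show "cmod (of_real \<kappa> * cross_part z ws F) \<le> ?n"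
      using \<kappa> by (simp add: norm_mult)
  qed (rule free_part_bound[where F = F, OF z F])
  have "cmod (heat_gen s t \<kappa> F ws) \<le> (s - t / 2) * (?n + ?n) + (t / 2) * (?n + ?n)"
    unfolding heat_gen_def
  proof (intro norm_triangle_mono)
    show "cmod (of_real (s - t / 2) * (free_part 1 ws F + of_real \<kappa> * cross_part 1 ws F))
        \<le> (s - t / 2) * (?n + ?n)"
      unfolding norm_mult norm_of_real using st 1[of 1] by (intro mult_mono) auto
    show "cmod (of_real (t / 2) * (free_part \<i> ws F + of_real \<kappa> * cross_part \<i> ws F))
        \<le> (t / 2) * (?n + ?n)"
      unfolding norm_mult norm_of_real using st 1[of \<i>] by (intro mult_mono) auto
  qed
  then show ?thesis by (simp add: algebra_simps)
qed

text \<open>The free parts cancel and \<open>\<kappa>\<close> factors out of the cross parts; this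
  factor becomes the \<open>1 / N^2\<close> of the theorem.\<close>

lemma heat_gen_diff_bound:
  assumes st: "0 \<le> t" "t / 2 \<le> s" and \<kappa>: "0 \<le> \<kappa>"
    and F: "\<And>x. total_length x = total_length ws \<Longrightarrow> cmod (F x) \<le> M"
  shows "cmod (heat_gen s t \<kappa> F ws - heat_gen s t 0 F ws) \<le> \<kappa> * (s * (real (total_length ws))\<^sup>2 * M)"
proof -
  let ?n = "(real (total_length ws))\<^sup>2 * M"
  have 1: "cmod (cross_part z ws F) \<le> ?n" if z: "cmod z = 1" for z
    by (rule cross_part_bound[where F = F, OF z F])
  have "heat_gen s t \<kappa> F ws - heat_gen s t 0 F ws =
      of_real \<kappa> * (of_real (s - t / 2) * cross_part 1 ws F + of_real (t / 2) * cross_part \<i> ws F)"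
    by (simp add: heat_gen_def algebra_simps)
  also have "cmod \<dots> \<le> \<kappa> * ((s - t / 2) * ?n + (t / 2) * ?n)"
  proof -
    have "cmod (of_real (s - t / 2) * cross_part 1 ws F + of_real (t / 2) * cross_part \<i> ws F)
        \<le> (s - t / 2) * ?n + (t / 2) * ?n"
    proof (intro norm_triangle_mono)
      show "cmod (of_real (s - t / 2) * cross_part 1 ws F) \<le> (s - t / 2) * ?n"
        unfolding norm_mult norm_of_real using st 1[of 1] by (intro mult_mono) auto
      show "cmod (of_real (t / 2) * cross_part \<i> ws F) \<le> (t / 2) * ?n"
        unfolding norm_mult norm_of_real using st 1[of \<i>] by (intro mult_mono) auto
    qed
    then show ?thesis
      unfolding norm_mult norm_of_real using \<kappa> by (intro mult_mono) auto
  qed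
  finally show ?thesis by (simp add: algebra_simps)
qed

lemma heat_gen_iterate_bound:
  assumes st: "0 \<le> t" "t / 2 \<le> s" and \<kappa>: "0 \<le> \<kappa>" "\<kappa> \<le> 1"
    and F: "\<And>x. total_length x = total_length ws \<Longrightarrow> cmod (F x) \<le> M"
  shows "cmod ((heat_gen s t \<kappa> ^^ k) F ws) \<le> (2 * s * (real (total_length ws))\<^sup>2) ^ k * M"
  using F
proof (induction k arbitrary: ws)
  case (Suc k)
  have "cmod (heat_gen s t \<kappa> ((heat_gen s t \<kappa> ^^ k) F) ws) \<le> 2 * s * (real (total_length ws))\<^sup>2 *
      ((2 * s * (real (total_length ws))\<^sup>2) ^ k * M)"
  proof (rule heat_gen_bound[OF st \<kappa>])
    fix x assume "total_length x = total_length ws"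
    then show "cmod ((heat_gen s t \<kappa> ^^ k) F x) \<le> (2 * s * (real (total_length ws))\<^sup>2) ^ k * M"
      using Suc.IH[of x] Suc.prems by simp
  qed
  then show ?case by (simp add: mult.assoc)
qed simp

text \<open>Telescoping: the difference of the powers \<open>Suc k\<close> is the generator at
  \<open>\<kappa>\<close> applied to the difference of the powers \<open>k\<close>, plus the
  difference of the generators applied to the power \<open>k\<close> at 0. The \<open>k\<close>
  replacements contribute one summand each, hence the factor \<open>k\<close>.\<close>

lemma heat_gen_iterate_diff:
  assumes st: "0 \<le> t" "t / 2 \<le> s" and \<kappa>: "0 \<le> \<kappa>" "\<kappa> \<le> 1"
  shows "cmod ((heat_gen s t \<kappa> ^^ k) (\<lambda>_. 1) ws - (heat_gen s t 0 ^^ k) (\<lambda>_. 1) ws)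
    \<le> \<kappa> * (real k * (2 * s * (real (total_length ws))\<^sup>2) ^ k)"
proof (induction k arbitrary: ws)
  case (Suc k)
  let ?B = "2 * s * (real (total_length ws))\<^sup>2"
  let ?F = "(heat_gen s t \<kappa> ^^ k) (\<lambda>_. 1)" and ?H = "(heat_gen s t 0 ^^ k) (\<lambda>_. 1)"
  have s: "0 \<le> s" using st by linarith
  have "heat_gen s t \<kappa> (\<lambda>x. 1 * ?F x + (- 1) * ?H x) ws = 1 * heat_gen s t \<kappa> ?F ws + (- 1) * heat_gen s t \<kappa> ?H ws"
    by (rule finite_functional_linear[OF finite_functional_heat_gen])
  then have "heat_gen s t \<kappa> ?F ws - heat_gen s t 0 ?H ws =
      heat_gen s t \<kappa> (\<lambda>x. ?F x - ?H x) ws + (heat_gen s t \<kappa> ?H ws - heat_gen s t 0 ?H ws)"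
    by simp
  also have "cmod \<dots> \<le> ?B * (\<kappa> * (real k * ?B ^ k)) + \<kappa> * (s * (real (total_length ws))\<^sup>2 * (?B ^ k * 1))"
  proof (intro norm_triangle_mono heat_gen_bound[OF st \<kappa>] heat_gen_diff_bound[OF st \<kappa>(1)])
    fix x assume x: "total_length x = total_length ws"
    show "cmod (?F x - ?H x) \<le> \<kappa> * (real k * ?B ^ k)" using Suc[of x] x by simp
    show "cmod (?H x) \<le> ?B ^ k * 1" using heat_gen_iterate_bound[OF st, of 0 x "\<lambda>_. 1" 1 k] x by simp
  qed
  \<comment> \<open>The cross parts alone cost \<open>s n^2\<close>; this is rounded up to
    \<open>2 s n^2\<close> so that both summands are multiples of the same power.\<close>
  also have "\<kappa> * (s * (real (total_length ws))\<^sup>2 * (?B ^ k * 1)) \<le> \<kappa> * (?B * (?B ^ k * 1))"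
    using \<kappa> s by (intro mult_left_mono mult_right_mono) auto
  finally show ?case by (simp add: algebra_simps)
qed simp

section \<open>The exponential series of the generator\<close>

definition heat_moment :: "real \<Rightarrow> real \<Rightarrow> real \<Rightarrow> word list \<Rightarrow> complex" where
  "heat_moment s t \<kappa> ws = (suminf (\<lambda>k. (heat_gen s t \<kappa> ^^ k) (\<lambda>_. 1) ws / (2 ^ k * fact k)))"

text \<open>The \<open>2 ^ k\<close> in the series halves the bound \<open>2 s n^2\<close> of the
  generator, so the exponential series of \<open>s n^2\<close> dominates.\<close>

lemma summable_norm_heat_moment:
  assumes st: "0 \<le> t" "t / 2 \<le> s" and \<kappa>: "0 \<le> \<kappa>" "\<kappa> \<le> 1"
  shows "summable (\<lambda>k. cmod ((heat_gen s t \<kappa> ^^ k) (\<lambda>_. 1) ws / (2 ^ k * fact k)))"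
    and "cmod (heat_moment s t \<kappa> ws) \<le> exp (s * (real (total_length ws))\<^sup>2)"
proof -
  let ?b = "s * (real (total_length ws))\<^sup>2"
  let ?f = "\<lambda>k. (heat_gen s t \<kappa> ^^ k) (\<lambda>_. 1) ws / (2 ^ k * fact k)"
  have le: "cmod (?f k) \<le> ?b ^ k /\<^sub>R fact k" for k
  proof -
    have "cmod (?f k) = cmod ((heat_gen s t \<kappa> ^^ k) (\<lambda>_. 1) ws) / (2 ^ k * fact k)"
      by (simp add: norm_divide norm_mult norm_power)
    also have "\<dots> \<le> ((2 * ?b) ^ k * 1) / (2 ^ k * fact k)"
      using heat_gen_iterate_bound[OF st \<kappa>, of ws "\<lambda>_. 1" 1 k]
      by (intro divide_right_mono) (auto simp: mult.assoc)
    also have "\<dots> = ?b ^ k /\<^sub>R fact k" by (simp add: power_mult_distrib field_simps)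
    finally show ?thesis .
  qed
  have e: "(\<lambda>k. ?b ^ k /\<^sub>R fact k) sums exp ?b" by (rule exp_converges)
  show s: "summable (\<lambda>k. cmod (?f k))"
    by (rule summable_comparison_test'[OF sums_summable[OF e]]) (use le in auto)
  have "cmod (suminf ?f) \<le> (suminf (\<lambda>k. cmod (?f k)))" by (rule summable_norm[OF s])
  also have "\<dots> \<le> (suminf (\<lambda>k. ?b ^ k /\<^sub>R fact k))" by (intro suminf_le le s sums_summable[OF e])
  also have "\<dots> = exp ?b" by (rule sums_unique[OF e, symmetric])
  finally show "cmod (heat_moment s t \<kappa> ws) \<le> exp ?b" by (simp add: heat_moment_def)
qed

text \<open>With \<open>b = s n^2\<close> this is \<open>b e^b\<close>, the sum of
  \<open>k b^k / k!\<close>; the factor \<open>k\<close> is the one in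
  \<open>heat_gen_iterate_diff\<close>.\<close>

definition moment_error :: "real \<Rightarrow> nat \<Rightarrow> real" where
  "moment_error s n = s * (real n)\<^sup>2 * exp (s * (real n)\<^sup>2)"

lemma heat_moment_diff:
  assumes st: "0 \<le> t" "t / 2 \<le> s" and \<kappa>: "0 \<le> \<kappa>" "\<kappa> \<le> 1"
  shows "cmod (heat_moment s t \<kappa> ws - heat_moment s t 0 ws) \<le> \<kappa> * moment_error s (total_length ws)"
proof -
  let ?b = "s * (real (total_length ws))\<^sup>2"
  let ?f = "\<lambda>\<kappa> k. (heat_gen s t \<kappa> ^^ k) (\<lambda>_. 1) ws / (2 ^ k * fact k)"
  let ?e = "\<lambda>k. \<kappa> * (real k * ?b ^ k / fact k)"
  have le: "cmod (?f \<kappa> k - ?f 0 k) \<le> ?e k" for k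
  proof -
    have "cmod (?f \<kappa> k - ?f 0 k) =
       cmod ((heat_gen s t \<kappa> ^^ k) (\<lambda>_. 1) ws - (heat_gen s t 0 ^^ k) (\<lambda>_. 1) ws) / (2 ^ k * fact k)"
      by (simp add: norm_divide norm_mult norm_power flip: diff_divide_distrib)
    also have "\<dots> \<le> (\<kappa> * (real k * (2 * ?b) ^ k)) / (2 ^ k * fact k)"
      using heat_gen_iterate_diff[OF st \<kappa>, of k ws]
      by (intro divide_right_mono) (auto simp: mult.assoc)
    also have "\<dots> = ?e k" by (simp add: power_mult_distrib field_simps)
    finally show ?thesis .
  qed
  \<comment> \<open>Term \<open>k\<close> of \<open>b e^b\<close> is term \<open>Suc k\<close> of
    the dominating series, whose term 0 vanishes.\<close>
  have eq: "?b * (?b ^ k /\<^sub>R fact k) = real (Suc k) * ?b ^ Suc k / fact (Suc k)" for k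
    by (simp add: divide_inverse_commute del: of_nat_Suc)
  have "(\<lambda>k. ?b * (?b ^ k /\<^sub>R fact k)) sums (?b * exp ?b)"
    by (intro sums_mult exp_converges)
  then have "(\<lambda>k. real (Suc k) * ?b ^ Suc k / fact (Suc k)) sums (?b * exp ?b)"
    unfolding eq .
  then have "(\<lambda>k. real k * ?b ^ k / fact k) sums (?b * exp ?b)"
    by (subst (asm) sums_Suc_iff) simp
  then have e: "?e sums (\<kappa> * (?b * exp ?b))"
    by (rule sums_mult)
  have f: "summable (?f \<kappa>)" "summable (?f 0)"
    by (rule summable_norm_cancel, rule summable_norm_heat_moment(1)[OF st]; use \<kappa> in simp)+
  have s: "summable (\<lambda>k. cmod (?f \<kappa> k - ?f 0 k))"
    by (rule summable_comparison_test'[OF sums_summable[OF e]]) (use le in auto)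
  have "cmod (heat_moment s t \<kappa> ws - heat_moment s t 0 ws) = cmod (suminf (\<lambda>k. ?f \<kappa> k - ?f 0 k))"
    unfolding heat_moment_def by (subst suminf_diff[OF f]) (rule refl)
  also have "\<dots> \<le> (suminf (\<lambda>k. cmod (?f \<kappa> k - ?f 0 k)))" by (rule summable_norm[OF s])
  also have "\<dots> \<le> (suminf (\<lambda>k. ?e k))" by (intro suminf_le le s sums_summable[OF e])
  also have "\<dots> = \<kappa> * (?b * exp ?b)" by (rule sums_unique[OF e, symmetric])
  finally show ?thesis by (simp add: moment_error_def)
qed

section \<open>Multiplicativity of the limiting moments\<close>

lemma heat_gen_zero_append:
  "heat_gen s t 0 F (ws @ vs) = heat_gen s t 0 (\<lambda>x. F (x @ vs)) ws + heat_gen s t 0 (\<lambda>x. F (ws @ x)) vs"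
  by (simp add: heat_gen_def free_part_append algebra_simps)

lemma heat_gen_sum:
  assumes "finite S"
  shows "heat_gen s t \<kappa> (\<lambda>x. \<Sum>j\<in>S. c j * F j x) ws = (\<Sum>j\<in>S. c j * heat_gen s t \<kappa> (F j) ws)"
proof -
  obtain L where L: "\<And>F. heat_gen s t \<kappa> F ws = (\<Sum>(c, x)\<leftarrow>L. c * F x)"
    using finite_functional_heat_gen[of ws s t \<kappa>] unfolding finite_functional_def by blast
  show ?thesis unfolding L
    by (induction L) (auto simp: algebra_simps sum.distrib sum_distrib_left)
qed

text \<open>Leibniz rule for powers of a derivation. It starts because the constant 1 is a product
  of a function of \<open>ws\<close> and one of \<open>vs\<close>, and sums of such products are
  preserved.\<close>

lemma heat_gen_zero_iterate_append:
  "(heat_gen s t 0 ^^ k) (\<lambda>_. 1) (ws @ vs) = (\<Sum>j\<le>k. of_nat (k choose j) *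
     ((heat_gen s t 0 ^^ j) (\<lambda>_. 1) ws * (heat_gen s t 0 ^^ (k - j)) (\<lambda>_. 1) vs))"
proof (induction k arbitrary: ws vs)
  case (Suc k)
  let ?h = "\<lambda>k. (heat_gen s t 0 ^^ k) (\<lambda>_. 1)"
  let ?a = "\<lambda>i j. ?h i ws * ?h j vs"
  have 1: "heat_gen s t 0 (\<lambda>x. ?h k (x @ vs)) ws = (\<Sum>j\<le>k. of_nat (k choose j) * ?a (Suc j) (k - j))"
    unfolding Suc
    using heat_gen_sum[of "{..k}" s t 0 "\<lambda>j. of_nat (k choose j) * ?h (k - j) vs" "\<lambda>j x. ?h j x" ws]
    by (simp add: mult_ac)
  have 2: "heat_gen s t 0 (\<lambda>x. ?h k (ws @ x)) vs = (\<Sum>j\<le>k. of_nat (k choose j) * ?a j (Suc (k - j)))"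
    unfolding Suc
    using heat_gen_sum[of "{..k}" s t 0 "\<lambda>j. of_nat (k choose j) * ?h j ws" "\<lambda>j x. ?h (k - j) x" vs]
    by (simp add: mult_ac)
  \<comment> \<open>Preparation for Pascal's rule: the sum is extended to \<open>j = Suc k\<close>,
    where the binomial coefficient is 0, before its first term is split off.\<close>
  have 3: "(\<Sum>j\<le>k. of_nat (k choose j) * ?a j (Suc (k - j))) =
      ?a 0 (Suc k) + (\<Sum>j\<le>k. of_nat (k choose Suc j) * ?a (Suc j) (k - j))"
  proof -
    have "(\<Sum>j\<le>k. of_nat (k choose j) * ?a j (Suc (k - j))) =
        (\<Sum>j\<le>Suc k. of_nat (k choose j) * ?a j (Suc k - j))"
      by (simp add: Suc_diff_le)
    also have "\<dots> = ?a 0 (Suc k) + (\<Sum>j\<le>k. of_nat (k choose Suc j) * ?a (Suc j) (k - j))"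
      by (subst sum.atMost_Suc_shift) simp
    finally show ?thesis .
  qed
  have "?h (Suc k) (ws @ vs) = ?a 0 (Suc k) +
      (\<Sum>j\<le>k. of_nat (Suc k choose Suc j) * ?a (Suc j) (k - j))"
    by (simp add: heat_gen_zero_append 1 2[unfolded 3] distrib_right sum.distrib)
  also have "\<dots> = (\<Sum>j\<le>Suc k. of_nat (Suc k choose j) * ?a j (Suc k - j))"
    by (subst sum.atMost_Suc_shift) simp
  finally show ?case .
qed simp

text \<open>The exponential of a derivation is multiplicative: the binomial coefficients of the
  iterates are those in the Cauchy product of two exponential series.\<close>

lemma heat_moment_zero_append:
  assumes st: "0 \<le> t" "t / 2 \<le> s"
  shows "heat_moment s t 0 (ws @ vs) = heat_moment s t 0 ws * heat_moment s t 0 vs"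
proof -
  let ?h = "\<lambda>k. (heat_gen s t 0 ^^ k) (\<lambda>_. 1)"
  have "heat_moment s t 0 ws * heat_moment s t 0 vs =
      (suminf (\<lambda>k. \<Sum>j\<le>k. (?h j ws / (2 ^ j * fact j)) * (?h (k - j) vs / (2 ^ (k - j) * fact (k - j)))))"
    unfolding heat_moment_def
    by (intro Cauchy_product summable_norm_heat_moment[OF st]) auto
  moreover have "(\<Sum>j\<le>k. (?h j ws / (2 ^ j * fact j)) * (?h (k - j) vs / (2 ^ (k - j) * fact (k - j)))) =
      ?h k (ws @ vs) / (2 ^ k * fact k)" for k
    unfolding heat_gen_zero_iterate_append sum_divide_distrib
  proof (intro sum.cong refl)
    fix j assume "j \<in> {..k}"
    then have j: "j \<le> k" by simp
    then have "(2::complex) ^ k = 2 ^ j * 2 ^ (k - j)" by (simp flip: power_add)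
    moreover have "of_nat (k choose j) = (fact k / (fact j * fact (k - j)) :: complex)"
      by (rule binomial_fact[OF j])
    ultimately show "?h j ws / (2 ^ j * fact j) * (?h (k - j) vs / (2 ^ (k - j) * fact (k - j))) =
        of_nat (k choose j) * (?h j ws * ?h (k - j) vs) / (2 ^ k * fact k)"
      by simp
  qed
  ultimately show ?thesis by (simp add: heat_moment_def)
qed

section \<open>Matrices and the contraction over an orthonormal basis\<close>

lemma matrix_algebra_simps [simp]:
  "carrier (matrix_algebra N) = carrier_mat N N" "mult (matrix_algebra N) = (*)"
  "one (matrix_algebra N) = 1\<^sub>m N" "zero (matrix_algebra N) = 0\<^sub>m N N"
  "add (matrix_algebra N) = (+)" "smult (matrix_algebra N) = (\<cdot>\<^sub>m)"
  "adj (matrix_algebra N) = mat_adjoint"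
  by (simp_all add: matrix_algebra_def)

lemma mat_adjoint_dim [simp]: "dim_row (mat_adjoint A) = dim_col A" "dim_col (mat_adjoint A) = dim_row A"
  by (simp_all add: mat_adjoint_def)

lemma mat_adjoint_carrier [simp]: "A \<in> carrier_mat n m \<Longrightarrow> mat_adjoint A \<in> carrier_mat m n"
  by (rule carrier_matI) auto

lemma mat_adjoint_index [simp]:
  "i < dim_col A \<Longrightarrow> j < dim_row A \<Longrightarrow> mat_adjoint A $$ (i, j) = cnj (A $$ (j, i))"
  by (simp add: mat_adjoint_def mat_of_rows_def)

lemma mat_mult_index:
  assumes "A \<in> carrier_mat n m" "B \<in> carrier_mat m k" "i < n" "j < k"
  shows "(A * B) $$ (i, j) = (\<Sum>l<m. A $$ (i, l) * B $$ (l, j))"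
  using assms by (auto simp: scalar_prod_def lessThan_atLeast0)

lemma mat_trace_mult:
  assumes "A \<in> carrier_mat n m" "B \<in> carrier_mat m n"
  shows "mat_trace (A * B) = (\<Sum>i<n. \<Sum>j<m. A $$ (i, j) * B $$ (j, i))"
  using assms(1) by (auto simp: mat_trace_def mat_mult_index[OF assms] simp del: index_mult_mat(1) intro!: sum.cong)

lemma mat_trace_commute:
  assumes "A \<in> carrier_mat n m" "B \<in> carrier_mat m n"
  shows "mat_trace (A * B) = mat_trace (B * A)"
  unfolding mat_trace_mult[OF assms] mat_trace_mult[OF assms(2,1)]
  by (subst sum.swap) (simp add: mult.commute)

lemma mat_trace_add:
  "A \<in> carrier_mat n n \<Longrightarrow> B \<in> carrier_mat n n \<Longrightarrow> mat_trace (A + B) = mat_trace A + mat_trace B"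
  by (auto simp: mat_trace_def sum.distrib)

lemma mat_trace_smult: "A \<in> carrier_mat n n \<Longrightarrow> mat_trace (c \<cdot>\<^sub>m A) = c * mat_trace A"
  by (auto simp: mat_trace_def sum_distrib_left)

lemma ring_matrix_algebra: "ring (matrix_algebra N)"
proof (intro ringI abelian_groupI monoidI)
  fix x assume x: "x \<in> carrier (matrix_algebra N)"
  show "\<exists>y\<in>carrier (matrix_algebra N). y \<oplus>\<^bsub>matrix_algebra N\<^esub> x = \<zero>\<^bsub>matrix_algebra N\<^esub>"
    using x by (intro bexI[of _ "- x"]) (auto intro!: eq_matI)
qed (auto simp: assoc_mult_mat add_mult_distrib_mat mult_add_distrib_mat intro: comm_add_mat)

lemma mat_adjoint_mult:
  fixes A B :: "complex mat"
  assumes "A \<in> carrier_mat n m" "B \<in> carrier_mat m k"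
  shows "mat_adjoint (A * B) = mat_adjoint B * mat_adjoint A"
proof (rule eq_matI)
  fix i j assume "i < dim_row (mat_adjoint B * mat_adjoint A)" "j < dim_col (mat_adjoint B * mat_adjoint A)"
  then have ij: "i < k" "j < n" using assms by auto
  have d: "dim_row A = n" "dim_col A = m" "dim_row B = m" "dim_col B = k" using assms by auto
  have "mat_adjoint (A * B) $$ (i, j) = (\<Sum>l<m. cnj (A $$ (j, l) * B $$ (l, i)))"
    using ij by (simp add: d mat_mult_index[OF assms] del: index_mult_mat(1))
  also have "\<dots> = (mat_adjoint B * mat_adjoint A) $$ (i, j)"
    using assms ij by (subst mat_mult_index[of _ k m _ n]) (auto simp: d mult.commute intro!: sum.cong)
  finally show "mat_adjoint (A * B) $$ (i, j) = (mat_adjoint B * mat_adjoint A) $$ (i, j)" .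
qed (use assms in auto)

lemma star_algebra_matrix: "star_algebra (matrix_algebra N)"
proof -
  interpret ring "matrix_algebra N" by (rule ring_matrix_algebra)
  show ?thesis
  proof
    fix x y c d assume xy: "x \<in> carrier (matrix_algebra N)" "y \<in> carrier (matrix_algebra N)"
    show "(c \<odot>\<^bsub>matrix_algebra N\<^esub> x) \<otimes>\<^bsub>matrix_algebra N\<^esub> y = c \<odot>\<^bsub>matrix_algebra N\<^esub> (x \<otimes>\<^bsub>matrix_algebra N\<^esub> y)"
      using xy by (simp add: mult_smult_assoc_mat[of _ N N _ N])
    show "x \<otimes>\<^bsub>matrix_algebra N\<^esub> (c \<odot>\<^bsub>matrix_algebra N\<^esub> y) = c \<odot>\<^bsub>matrix_algebra N\<^esub> (x \<otimes>\<^bsub>matrix_algebra N\<^esub> y)"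
      using xy by (simp add: mult_smult_distrib[of _ N N _ N])
    show "adj (matrix_algebra N) (x \<otimes>\<^bsub>matrix_algebra N\<^esub> y) =
        adj (matrix_algebra N) y \<otimes>\<^bsub>matrix_algebra N\<^esub> adj (matrix_algebra N) x"
      using xy by (simp add: mat_adjoint_mult[of _ N N _ N])
    show "(c + d) \<odot>\<^bsub>matrix_algebra N\<^esub> x =
        c \<odot>\<^bsub>matrix_algebra N\<^esub> x \<oplus>\<^bsub>matrix_algebra N\<^esub> d \<odot>\<^bsub>matrix_algebra N\<^esub> x"
      using xy by (auto intro!: eq_matI simp: algebra_simps)
  qed (auto intro!: eq_matI simp: algebra_simps)
qed

text \<open>The normalised trace of \<open>A\<close> times its adjoint
  (\<open>trace_adjoint_mult\<close>), written by entries so that it is a real number.\<close>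

definition sq_norm :: "nat \<Rightarrow> complex mat \<Rightarrow> real" where
  "sq_norm N A = (\<Sum>i<N. \<Sum>j<N. (cmod (A $$ (i, j)))\<^sup>2) / real N"

lemma sq_norm_nonneg: "0 \<le> sq_norm N A"
  by (auto simp: sq_norm_def intro!: divide_nonneg_nonneg sum_nonneg)

lemma trace_adjoint_mult:
  assumes "A \<in> carrier_mat N N"
  shows "normalized_trace N (A * mat_adjoint A) = of_real (sq_norm N A)"
proof -
  have "mat_trace (A * mat_adjoint A) = of_real (\<Sum>i<N. \<Sum>j<N. (cmod (A $$ (i, j)))\<^sup>2)"
    using assms by (subst mat_trace_mult[of _ N N])
      (auto simp: complex_norm_square simp del: of_real_power intro!: sum.cong)
  then show ?thesis by (simp add: normalized_trace_def sq_norm_def)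
qed

lemma nc_prob_space_matrix:
  assumes "N \<ge> 1"
  shows "nc_prob_space (matrix_algebra N) (normalized_trace N)"
proof -
  interpret star_algebra "matrix_algebra N" by (rule star_algebra_matrix)
  show ?thesis
  proof
    fix x y c assume x: "x \<in> carrier (matrix_algebra N)"
    show "normalized_trace N (c \<odot>\<^bsub>matrix_algebra N\<^esub> x) = c * normalized_trace N x"
      using x by (simp add: normalized_trace_def mat_trace_smult)
    show "normalized_trace N (x \<otimes>\<^bsub>matrix_algebra N\<^esub> adj (matrix_algebra N) x) \<in> \<real>\<^sub>\<ge>\<^sub>0"
      using x by (simp add: trace_adjoint_mult sq_norm_nonneg)
    assume y: "y \<in> carrier (matrix_algebra N)"
    show "normalized_trace N (x \<oplus>\<^bsub>matrix_algebra N\<^esub> y) = normalized_trace N x + normalized_trace N y"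
      using x y by (simp add: normalized_trace_def mat_trace_add[of _ N] add_divide_distrib)
    show "normalized_trace N (x \<otimes>\<^bsub>matrix_algebra N\<^esub> y) = normalized_trace N (y \<otimes>\<^bsub>matrix_algebra N\<^esub> x)"
      using x y by (simp add: normalized_trace_def mat_trace_commute[of _ N N])
  next
    show "normalized_trace N \<one>\<^bsub>matrix_algebra N\<^esub> = 1"
      using assms by (simp add: normalized_trace_def mat_trace_def)
  qed
qed

lemma GL_I:
  assumes "g \<in> carrier_mat N N" "h \<in> carrier_mat N N" "g * h = 1\<^sub>m N" "h * g = 1\<^sub>m N"
  shows "g \<in> GL N"
  using assms unfolding GL_def invertible_mat_def inverts_mat_def by auto

lemma Units_matrix_algebra: "Units (matrix_algebra N) = GL N"
proof (intro equalityI subsetI)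
  fix g assume "g \<in> GL N"
  then obtain h where g: "g \<in> carrier_mat N N" and h: "g * h = 1\<^sub>m N" "h * g = 1\<^sub>m (dim_row h)"
    by (auto simp: GL_def invertible_mat_def inverts_mat_def)
  have "dim_col h = N" using arg_cong[OF h(1), of dim_col] by simp
  moreover have "dim_row h = N" using arg_cong[OF h(2), of dim_col] g by simp
  ultimately have "h \<in> carrier_mat N N" by auto
  then show "g \<in> Units (matrix_algebra N)" using g h by (auto simp: Units_def)
qed (auto simp: Units_def intro: GL_I)

definition GL_inv :: "nat \<Rightarrow> complex mat \<Rightarrow> complex mat" where
  "GL_inv N g = inv\<^bsub>matrix_algebra N\<^esub> g"

lemma GL_inv:
  assumes "g \<in> GL N"
  shows "g \<in> carrier_mat N N" "GL_inv N g \<in> carrier_mat N N"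
    "g * GL_inv N g = 1\<^sub>m N" "GL_inv N g * g = 1\<^sub>m N"
proof -
  interpret star_algebra "matrix_algebra N" by (rule star_algebra_matrix)
  have "g \<in> Units (matrix_algebra N)" using assms by (simp add: Units_matrix_algebra)
  from Units_r_inv[OF this] Units_l_inv[OF this] Units_inv_closed[OF this] Units_closed[OF this]
  show "g \<in> carrier_mat N N" "GL_inv N g \<in> carrier_mat N N"
    "g * GL_inv N g = 1\<^sub>m N" "GL_inv N g * g = 1\<^sub>m N" by (simp_all add: GL_inv_def)
qed

lemma GL_inv_unique:
  assumes "g \<in> carrier_mat N N" "h \<in> carrier_mat N N" "g * h = 1\<^sub>m N" "h * g = 1\<^sub>m N"
  shows "GL_inv N g = h"
proof -
  interpret star_algebra "matrix_algebra N" by (rule star_algebra_matrix)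
  show ?thesis unfolding GL_inv_def by (rule inv_char) (use assms in auto)
qed

lemma GL_mult:
  assumes g: "g \<in> GL N" and h: "h \<in> GL N"
  shows "g * h \<in> GL N" "GL_inv N (g * h) = GL_inv N h * GL_inv N g"
proof -
  note g = GL_inv[OF g] and h = GL_inv[OF h]
  note assoc = assoc_mult_mat[of _ N N _ N _ N]
  have "(g * h) * (GL_inv N h * GL_inv N g) = g * ((h * GL_inv N h) * GL_inv N g)"
    using g(1,2) h(1,2) by (simp add: assoc mult_carrier_mat[of _ N N])
  then have 1: "(g * h) * (GL_inv N h * GL_inv N g) = 1\<^sub>m N" using g h by simp
  have "(GL_inv N h * GL_inv N g) * (g * h) = GL_inv N h * ((GL_inv N g * g) * h)"
    using g(1,2) h(1,2) by (simp add: assoc mult_carrier_mat[of _ N N])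
  then have 2: "(GL_inv N h * GL_inv N g) * (g * h) = 1\<^sub>m N" using g h by simp
  have c: "g * h \<in> carrier_mat N N" "GL_inv N h * GL_inv N g \<in> carrier_mat N N" using g h by auto
  show "g * h \<in> GL N" "GL_inv N (g * h) = GL_inv N h * GL_inv N g"
    by (rule GL_I[OF c 1 2], rule GL_inv_unique[OF c 1 2])
qed

lemma one_in_GL: "1\<^sub>m N \<in> GL N"
  by (rule GL_I[of _ _ "1\<^sub>m N"]) auto

section \<open>Completeness relation of an orthonormal basis\<close>

locale u_basis =
  fixes N :: nat and \<beta> :: "complex mat set"
  assumes N: "N \<ge> 1" and basis: "orthonormal_basis_u N \<beta>"
begin

lemma finite_basis: "finite \<beta>"
  and basis_carrier: "X \<in> \<beta> \<Longrightarrow> X \<in> carrier_mat N N"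
  and basis_adjoint: "X \<in> \<beta> \<Longrightarrow> mat_adjoint X = - X"
  using basis by (auto simp: orthonormal_basis_u_def u_algebra_def)

text \<open>Orthonormality forces the real coefficients to be inner products. The expansion thus
  becomes linear in \<open>Y\<close> and extends to complex combinations of skew-Hermitian
  matrices.\<close>

lemma basis_expansion:
  assumes Y: "Y \<in> u_algebra N" and ij: "i < N" "j < N"
  shows "Y $$ (i, j) = (\<Sum>X\<in>\<beta>. u_inner N X Y * X $$ (i, j))"
proof -
  obtain c :: "complex mat \<Rightarrow> real" where
    c: "\<And>i j. i < N \<Longrightarrow> j < N \<Longrightarrow> Y $$ (i, j) = (\<Sum>X\<in>\<beta>. of_real (c X) * X $$ (i, j))"
    using basis Y unfolding orthonormal_basis_u_def by metis
  have Yc: "Y \<in> carrier_mat N N" using Y by (simp add: u_algebra_def)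
  have "u_inner N X Y = of_real (c X)" if X: "X \<in> \<beta>" for X
  proof -
    have "u_inner N X Y = - of_nat N * (\<Sum>i<N. \<Sum>j<N. X $$ (i, j) * (\<Sum>Z\<in>\<beta>. of_real (c Z) * Z $$ (j, i)))"
      unfolding u_inner_def using X Yc by (simp add: mat_trace_mult[OF basis_carrier[OF X] Yc] c)
    also have "\<dots> = - of_nat N * (\<Sum>i<N. \<Sum>j<N. \<Sum>Z\<in>\<beta>. of_real (c Z) * (X $$ (i, j) * Z $$ (j, i)))"
      by (simp add: sum_distrib_left mult_ac)
    also have "\<dots> = (\<Sum>Z\<in>\<beta>. of_real (c Z) * (- of_nat N * (\<Sum>i<N. \<Sum>j<N. X $$ (i, j) * Z $$ (j, i))))"
      by (subst sum.swap[of _ \<beta>], subst sum.swap[of _ \<beta>]) (simp add: sum_distrib_left mult_ac)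
    also have "\<dots> = (\<Sum>Z\<in>\<beta>. of_real (c Z) * u_inner N X Z)"
      by (intro sum.cong refl) (simp add: u_inner_def mat_trace_mult[OF basis_carrier[OF X] basis_carrier])
    also have "\<dots> = (\<Sum>Z\<in>\<beta>. if X = Z then of_real (c Z) else 0)"
      using basis X by (intro sum.cong refl) (auto simp: orthonormal_basis_u_def)
    finally show ?thesis using X finite_basis by simp
  qed
  then show ?thesis using c[OF ij] by simp
qed

text \<open>Every matrix is a complex combination of skew-Hermitian ones. For the matrix unit with
  entry 1 at \<open>(d, c)\<close> the coefficient along \<open>X\<close> is
  \<open>- N * X $$ (c, d)\<close>; its expansion, read at the entry \<open>(a, b)\<close>, is the
  claim.\<close>

lemma basis_contraction:
  assumes "a < N" "b < N" "c < N" "d < N"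
  shows "(\<Sum>X\<in>\<beta>. X $$ (a, b) * X $$ (c, d)) = (if a = d \<and> b = c then - 1 / of_nat N else 0)"
proof -
  define e :: "nat \<Rightarrow> nat \<Rightarrow> complex" where "e = (\<lambda>i j. if i = d \<and> j = c then 1 else 0)"
  have e_cnj [simp]: "cnj (e i j) = e i j" for i j by (simp add: e_def)
  \<comment> \<open>\<open>Y1 + \<i> Y2\<close> is the matrix unit \<open>e\<close>, split into its
    skew-Hermitian part and \<open>\<i>\<close> times a second skew-Hermitian matrix.\<close>
  define Y1 where "Y1 = Matrix.mat N N (\<lambda>(i, j). (e i j - e j i) / 2)"
  define Y2 where "Y2 = Matrix.mat N N (\<lambda>(i, j). (e i j + e j i) / (2 * \<i>))"
  have Y1: "Y1 \<in> u_algebra N" and Y2: "Y2 \<in> u_algebra N"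
    unfolding u_algebra_def Y1_def Y2_def
    by (auto intro!: eq_matI simp: field_simps)
  have E: "(\<Sum>i<N. \<Sum>j<N. X $$ (i, j) * e j i) = X $$ (c, d)"
      "(\<Sum>i<N. \<Sum>j<N. X $$ (i, j) * e i j) = X $$ (d, c)" for X :: "complex mat"
  proof -
    have "(\<Sum>i<N. \<Sum>j<N. X $$ (i, j) * e j i) = (\<Sum>i<N. \<Sum>j<N. if j = d then (if i = c then X $$ (i, j) else 0) else 0)"
      by (intro sum.cong refl) (auto simp: e_def)
    then show "(\<Sum>i<N. \<Sum>j<N. X $$ (i, j) * e j i) = X $$ (c, d)" using assms by simp
    have "(\<Sum>i<N. \<Sum>j<N. X $$ (i, j) * e i j) = (\<Sum>i<N. \<Sum>j<N. if j = c then (if i = d then X $$ (i, j) else 0) else 0)"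
      by (intro sum.cong refl) (auto simp: e_def)
    then show "(\<Sum>i<N. \<Sum>j<N. X $$ (i, j) * e i j) = X $$ (d, c)" using assms by simp
  qed
  have inner: "u_inner N X Y1 + \<i> * u_inner N X Y2 = - of_nat N * X $$ (c, d)" if X: "X \<in> \<beta>" for X
  proof -
    have "mat_trace (X * Y1) = (\<Sum>i<N. \<Sum>j<N. X $$ (i, j) * ((e j i - e i j) / 2))"
      by (subst mat_trace_mult[OF basis_carrier[OF X]]) (auto simp: Y1_def)
    also have "\<dots> = ((\<Sum>i<N. \<Sum>j<N. X $$ (i, j) * e j i) - (\<Sum>i<N. \<Sum>j<N. X $$ (i, j) * e i j)) / 2"
      by (simp only: right_diff_distrib times_divide_eq_right diff_divide_distrib sum_divide_distrib sum_subtractf)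
    finally have 1: "mat_trace (X * Y1) = (X $$ (c, d) - X $$ (d, c)) / 2" unfolding E .
    have "mat_trace (X * Y2) = (\<Sum>i<N. \<Sum>j<N. X $$ (i, j) * ((e j i + e i j) / (2 * \<i>)))"
      by (subst mat_trace_mult[OF basis_carrier[OF X]]) (auto simp: Y2_def)
    also have "\<dots> = ((\<Sum>i<N. \<Sum>j<N. X $$ (i, j) * e j i) + (\<Sum>i<N. \<Sum>j<N. X $$ (i, j) * e i j)) / (2 * \<i>)"
      by (simp only: distrib_left times_divide_eq_right add_divide_distrib sum_divide_distrib sum.distrib)
    finally have 2: "mat_trace (X * Y2) = (X $$ (c, d) + X $$ (d, c)) / (2 * \<i>)" unfolding E .
    show ?thesis by (simp add: u_inner_def 1 2 field_simps)
  qed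
  have "e a b = Y1 $$ (a, b) + \<i> * Y2 $$ (a, b)"
    using assms by (simp add: Y1_def Y2_def field_simps)
  also have "\<dots> = (\<Sum>X\<in>\<beta>. (u_inner N X Y1 + \<i> * u_inner N X Y2) * X $$ (a, b))"
    using assms
    by (simp add: basis_expansion[OF Y1] basis_expansion[OF Y2] sum_distrib_left sum.distrib distrib_right mult.assoc)
  also have "\<dots> = - of_nat N * (\<Sum>X\<in>\<beta>. X $$ (a, b) * X $$ (c, d))"
    unfolding sum_distrib_left by (intro sum.cong refl) (simp add: inner)
  finally have "(\<Sum>X\<in>\<beta>. X $$ (a, b) * X $$ (c, d)) = - e a b / of_nat N" using N by (simp add: field_simps)
  then show ?thesis by (simp add: e_def)
qed

lemma basis_contraction_sum:
  "(\<Sum>X\<in>\<beta>. \<Sum>a<N. \<Sum>b<N. \<Sum>c<N. \<Sum>d<N. X $$ (a, b) * X $$ (c, d) * f a b c d) =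
     - (\<Sum>a<N. \<Sum>b<N. f a b b a) / of_nat N"
proof -
  have "(\<Sum>X\<in>\<beta>. \<Sum>a<N. \<Sum>b<N. \<Sum>c<N. \<Sum>d<N. X $$ (a, b) * X $$ (c, d) * f a b c d) =
      (\<Sum>a<N. \<Sum>b<N. \<Sum>c<N. \<Sum>d<N. (\<Sum>X\<in>\<beta>. X $$ (a, b) * X $$ (c, d)) * f a b c d)"
    by (subst sum.swap[of _ _ \<beta>], (subst sum.swap[of _ _ \<beta>])+) (simp add: sum_distrib_right)
  also have "\<dots> = (\<Sum>a<N. \<Sum>b<N. \<Sum>c<N. \<Sum>d<N. if d = a then (if c = b then - f a b b a / of_nat N else 0) else 0)"
    by (intro sum.cong refl) (auto simp: basis_contraction)
  also have "\<dots> = (\<Sum>a<N. \<Sum>b<N. - f a b b a / of_nat N)" by simp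
  finally show ?thesis by (simp add: sum_divide_distrib sum_negf)
qed

text \<open>After rotating the trace, the indices of the two copies of \<open>X\<close> are joined
  through \<open>P\<close> and through \<open>V * U\<close>; the contraction closes two loops. Its
  factor \<open>1 / N\<close> and the one normalisation are exactly what the two new traces
  need.\<close>

lemma sum_basis_trace_same:
  assumes U: "U \<in> carrier_mat N N" "P \<in> carrier_mat N N" "V \<in> carrier_mat N N"
  shows "(\<Sum>X\<in>\<beta>. normalized_trace N (U * X * P * X * V)) =
    - normalized_trace N P * normalized_trace N (U * V)"
proof -
  have VU: "V * U \<in> carrier_mat N N" using U by simp
  have "mat_trace (U * X * P * X * V) =
      (\<Sum>a<N. \<Sum>b<N. \<Sum>c<N. \<Sum>d<N. X $$ (a, b) * X $$ (c, d) * (P $$ (b, c) * (V * U) $$ (d, a)))"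
    if X: "X \<in> \<beta>" for X
  proof -
    note X = basis_carrier[OF X]
    have PX: "P * (X * (V * U)) \<in> carrier_mat N N" "X * (V * U) \<in> carrier_mat N N" using U X by auto
    have "mat_trace (U * X * P * X * V) = mat_trace (V * (U * X * P * X))"
      using U X by (intro mat_trace_commute[of _ N N]) auto
    also have "V * (U * X * P * X) = (V * U) * (X * P * X)"
      using U X by (simp add: assoc_mult_mat[of _ N N _ N _ N] mult_carrier_mat[of _ N N])
    also have "mat_trace \<dots> = mat_trace ((X * P * X) * (V * U))"
      using U X by (intro mat_trace_commute[of _ N N]) auto
    also have "(X * P * X) * (V * U) = X * (P * (X * (V * U)))"
      using U X by (simp add: assoc_mult_mat[of _ N N _ N _ N] mult_carrier_mat[of _ N N])
    finally show ?thesis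
      unfolding mat_trace_mult[OF X PX(1)]
      by (simp add: mat_mult_index[OF U(2) PX(2)] mat_mult_index[OF X VU] sum_distrib_left mult_ac
          del: index_mult_mat)
  qed
  then have "(\<Sum>X\<in>\<beta>. mat_trace (U * X * P * X * V)) =
      - (\<Sum>a<N. \<Sum>b<N. P $$ (b, b) * (V * U) $$ (a, a)) / of_nat N"
    unfolding basis_contraction_sum[of "\<lambda>a b c d. P $$ (b, c) * (V * U) $$ (d, a)", symmetric]
    by (intro sum.cong refl)
  then have "(\<Sum>X\<in>\<beta>. normalized_trace N (U * X * P * X * V)) =
      - (\<Sum>a<N. \<Sum>b<N. P $$ (b, b) * (V * U) $$ (a, a)) / of_nat N / of_nat N"
    by (simp only: normalized_trace_def flip: sum_divide_distrib)
  also have "(\<Sum>a<N. \<Sum>b<N. P $$ (b, b) * (V * U) $$ (a, a)) = mat_trace P * mat_trace (V * U)"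
    using U by (simp add: mat_trace_def sum_distrib_right sum_distrib_left del: index_mult_mat(1))
  also have "mat_trace (V * U) = mat_trace (U * V)" using U by (intro mat_trace_commute) auto
  finally show ?thesis by (simp add: normalized_trace_def)
qed

text \<open>The contraction joins two loops into one. Two normalisations and the contraction give
  \<open>1 / N^3\<close>, of which the single new trace absorbs one factor.\<close>

lemma sum_basis_trace_cross:
  assumes U: "U \<in> carrier_mat N N" "V \<in> carrier_mat N N" "U' \<in> carrier_mat N N" "V' \<in> carrier_mat N N"
  shows "(\<Sum>X\<in>\<beta>. normalized_trace N (U * X * V) * normalized_trace N (U' * X * V')) =
    - normalized_trace N (V * U * V' * U') / (of_nat N)\<^sup>2"
proof -
  have t: "mat_trace (U * X * V) = (\<Sum>a<N. \<Sum>b<N. X $$ (a, b) * (V * U) $$ (b, a))"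
    if "X \<in> \<beta>" "U \<in> carrier_mat N N" "V \<in> carrier_mat N N" for X U V
  proof -
    have X: "X \<in> carrier_mat N N" using basis_carrier that by simp
    have "mat_trace (U * X * V) = mat_trace (U * (X * V))" using that X by (simp add: assoc_mult_mat[of _ N N _ N _ N])
    also have "\<dots> = mat_trace (X * V * U)" using that X by (intro mat_trace_commute) auto
    also have "\<dots> = mat_trace (X * (V * U))" using that X by (simp add: assoc_mult_mat[of _ N N _ N _ N])
    finally show ?thesis using that X by (simp add: mat_trace_mult[of _ N N] del: index_mult_mat)
  qed
  have VU: "V * U \<in> carrier_mat N N" "V' * U' \<in> carrier_mat N N" using U by auto
  have "mat_trace (U * X * V) * mat_trace (U' * X * V') =
      (\<Sum>a<N. \<Sum>b<N. \<Sum>c<N. \<Sum>d<N. X $$ (a, b) * X $$ (c, d) * ((V * U) $$ (b, a) * (V' * U') $$ (d, c)))"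
    if X: "X \<in> \<beta>" for X
  proof -
    have "mat_trace (U * X * V) * mat_trace (U' * X * V') =
      (\<Sum>a<N. \<Sum>b<N. X $$ (a, b) * (V * U) $$ (b, a) * (\<Sum>c<N. \<Sum>d<N. X $$ (c, d) * (V' * U') $$ (d, c)))"
      by (simp only: t[OF X U(1,2)] t[OF X U(3,4)] sum_distrib_right)
    then show ?thesis by (simp only: sum_distrib_left mult_ac)
  qed
  then have *: "(\<Sum>X\<in>\<beta>. mat_trace (U * X * V) * mat_trace (U' * X * V')) =
      - (\<Sum>a<N. \<Sum>b<N. (V * U) $$ (b, a) * (V' * U') $$ (a, b)) / of_nat N"
    unfolding basis_contraction_sum[of "\<lambda>a b c d. (V * U) $$ (b, a) * (V' * U') $$ (d, c)", symmetric]
    by (intro sum.cong refl)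
  have "(\<Sum>X\<in>\<beta>. normalized_trace N (U * X * V) * normalized_trace N (U' * X * V')) =
      - (\<Sum>a<N. \<Sum>b<N. (V * U) $$ (b, a) * (V' * U') $$ (a, b)) / of_nat N / (of_nat N)\<^sup>2"
    by (simp add: * normalized_trace_def power2_eq_square flip: sum_divide_distrib del: index_mult_mat(1))
  also have "(\<Sum>a<N. \<Sum>b<N. (V * U) $$ (b, a) * (V' * U') $$ (a, b)) = mat_trace ((V * U) * (V' * U'))"
    unfolding mat_trace_mult[OF VU] by (rule sum.swap)
  also have "(V * U) * (V' * U') = V * U * V' * U'"
    using U by (simp add: assoc_mult_mat[of _ N N _ N _ N] mult_carrier_mat[of _ N N])
  finally show ?thesis by (simp add: normalized_trace_def)
qed

end

section \<open>One-parameter subgroups\<close>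

lemma cmod_pow_mat_le:
  fixes A :: "complex mat"
  assumes A: "A \<in> carrier_mat N N" and m: "\<And>i j. i < N \<Longrightarrow> j < N \<Longrightarrow> cmod (A $$ (i, j)) \<le> m"
    and ij: "i < N" "j < N"
  shows "cmod ((A ^\<^sub>m k) $$ (i, j)) \<le> (real N * m) ^ k"
  using ij
proof (induction k arbitrary: j)
  case 0
  then show ?case using A by simp
next
  case (Suc k)
  have Ak: "A ^\<^sub>m k \<in> carrier_mat N N" using A by simp
  have m0: "0 \<le> m" using m[OF Suc.prems] norm_ge_zero order_trans by blast
  have "cmod ((A ^\<^sub>m Suc k) $$ (i, j)) \<le> (\<Sum>l<N. cmod ((A ^\<^sub>m k) $$ (i, l) * A $$ (l, j)))"
    unfolding pow_mat.simps mat_mult_index[OF Ak A Suc.prems] by (rule norm_sum)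
  also have "\<dots> \<le> (\<Sum>l<N. (real N * m) ^ k * m)"
    unfolding norm_mult
    by (intro sum_mono mult_mono Suc.IH m) (use Suc.prems m0 in auto)
  finally show ?case by (simp add: mult_ac)
qed

lemma pow_mat_commute:
  assumes A: "A \<in> carrier_mat N N"
  shows "A * A ^\<^sub>m k = A ^\<^sub>m k * (A :: complex mat)"
proof (induction k)
  case (Suc k)
  have Ak: "A ^\<^sub>m k \<in> carrier_mat N N" using A by simp
  have "A * A ^\<^sub>m Suc k = (A * A ^\<^sub>m k) * A" using A Ak by (simp add: assoc_mult_mat[of _ N N _ N _ N])
  then show ?case by (simp add: Suc)
qed (use A in simp)

lemma pow_mat_smult:
  assumes A: "A \<in> carrier_mat N N"
  shows "(c \<cdot>\<^sub>m A) ^\<^sub>m k = c ^ k \<cdot>\<^sub>m (A :: complex mat) ^\<^sub>m k"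
proof (induction k)
  case (Suc k)
  have Ak: "A ^\<^sub>m k \<in> carrier_mat N N" using A by simp
  show ?case
    using A Ak by (simp add: Suc mult_smult_assoc_mat[of _ N N _ N] mult_smult_distrib[of _ N N _ N])
      (auto intro!: eq_matI simp: mult_ac)
qed (use A in \<open>auto intro!: eq_matI\<close>)

lemma mat_exp_carrier [simp]: "A \<in> carrier_mat N N \<Longrightarrow> mat_exp A \<in> carrier_mat N N"
  by (auto simp: mat_exp_def)

lemma mat_exp_index:
  assumes A: "A \<in> carrier_mat N N" and ij: "i < N" "j < N"
  shows "mat_exp (c \<cdot>\<^sub>m A) $$ (i, j) = (suminf (\<lambda>k. (A ^\<^sub>m k) $$ (i, j) / fact k * c ^ k))"
  using A ij by (simp add: mat_exp_def pow_mat_smult[OF A] mult_ac)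

lemma summable_mat_exp:
  fixes A :: "complex mat"
  assumes A: "A \<in> carrier_mat N N" and ij: "i < N" "j < N"
  shows "summable (\<lambda>k. (A ^\<^sub>m k) $$ (i, j) / fact k * c ^ k)"
proof -
  define m where "m = (\<Sum>i<N. \<Sum>j<N. cmod (A $$ (i, j)))"
  have m: "cmod (A $$ (i, j)) \<le> m" if "i < N" "j < N" for i j
  proof -
    have "cmod (A $$ (i, j)) \<le> (\<Sum>j<N. cmod (A $$ (i, j)))"
      using that by (intro member_le_sum) auto
    also have "\<dots> \<le> m"
      unfolding m_def using that by (intro member_le_sum[of i "{..<N}" "\<lambda>i. \<Sum>j<N. cmod (A $$ (i, j))"]) (auto intro: sum_nonneg)
    finally show ?thesis .
  qed
  have "summable (\<lambda>k. (real N * m * cmod c) ^ k /\<^sub>R fact k)" by (rule summable_exp_generic)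
  then show ?thesis
  proof (rule summable_comparison_test')
    fix k
    have "cmod ((A ^\<^sub>m k) $$ (i, j) / fact k * c ^ k) \<le> (real N * m) ^ k / fact k * cmod c ^ k"
      unfolding norm_mult norm_divide norm_power norm_fact
      by (intro mult_right_mono divide_right_mono cmod_pow_mat_le[OF A m ij]) auto
    also have "\<dots> = (real N * m * cmod c) ^ k /\<^sub>R fact k"
      by (simp add: power_mult_distrib field_simps)
    finally show "norm ((A ^\<^sub>m k) $$ (i, j) / fact k * c ^ k) \<le> (real N * m * cmod c) ^ k /\<^sub>R fact k" .
  qed
qed

text \<open>Termwise differentiation of a power series in a complex parameter: the shift of
  coefficients turns \<open>A^(k+1) / (k+1)!\<close> into \<open>A^k / k!\<close> times
  \<open>A\<close>. The restriction to real parameters comes last.\<close>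

lemma mat_exp_deriv:
  assumes A: "A \<in> carrier_mat N N" and ij: "i < N" "j < N"
  shows "((\<lambda>u. mat_exp (complex_of_real u \<cdot>\<^sub>m A) $$ (i, j)) has_vector_derivative
      (mat_exp (complex_of_real u \<cdot>\<^sub>m A) * A) $$ (i, j)) (at u)"
proof -
  let ?c = "\<lambda>i j k. (A ^\<^sub>m k) $$ (i, j) / fact k"
  have E: "mat_exp (complex_of_real u \<cdot>\<^sub>m A) \<in> carrier_mat N N" using A by simp
  have "((\<lambda>x. suminf (\<lambda>k. ?c i j k * x ^ k)) has_field_derivative
      (suminf (\<lambda>k. diffs (?c i j) k * of_real u ^ k))) (at (of_real u))"
    by (rule termdiffs_strong_converges_everywhere) (rule summable_mat_exp[OF A ij])
  moreover have "diffs (?c i j) k * of_real u ^ k = (\<Sum>l<N. ?c i l k * of_real u ^ k * A $$ (l, j))" for k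
  proof -
    have "diffs (?c i j) k = (A ^\<^sub>m Suc k) $$ (i, j) / fact k"
      by (simp add: diffs_def divide_inverse_commute del: of_nat_Suc pow_mat.simps)
    also have "\<dots> = (\<Sum>l<N. (A ^\<^sub>m k) $$ (i, l) * A $$ (l, j)) / fact k"
      unfolding pow_mat.simps by (subst mat_mult_index[of _ N N _ N]) (use A ij in auto)
    finally show ?thesis
      by (simp only: sum_divide_distrib sum_distrib_right) (simp add: mult_ac)
  qed
  moreover have "(suminf (\<lambda>k. \<Sum>l<N. ?c i l k * of_real u ^ k * A $$ (l, j))) =
      (mat_exp (complex_of_real u \<cdot>\<^sub>m A) * A) $$ (i, j)"
  proof -
    have "(suminf (\<lambda>k. \<Sum>l<N. ?c i l k * of_real u ^ k * A $$ (l, j))) =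
       (\<Sum>l<N. suminf (\<lambda>k. ?c i l k * of_real u ^ k * A $$ (l, j)))"
      by (rule suminf_sum) (use summable_mat_exp[OF A ij(1)] in \<open>auto intro!: summable_mult2 simp del: times_divide_eq_left times_divide_eq_right\<close>)
    also have "\<dots> = (\<Sum>l<N. mat_exp (complex_of_real u \<cdot>\<^sub>m A) $$ (i, l) * A $$ (l, j))"
    proof (intro sum.cong refl)
      fix l assume "l \<in> {..<N}"
      then have l: "l < N" by simp
      show "(suminf (\<lambda>k. ?c i l k * of_real u ^ k * A $$ (l, j))) = mat_exp (complex_of_real u \<cdot>\<^sub>m A) $$ (i, l) * A $$ (l, j)"
        unfolding mat_exp_index[OF A ij(1) l]
        by (rule suminf_mult2[OF summable_mat_exp[OF A ij(1) l], symmetric])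
    qed
    finally show ?thesis by (simp only: mat_mult_index[OF E A ij])
  qed
  ultimately have "((\<lambda>x. suminf (\<lambda>k. ?c i j k * x ^ k)) has_field_derivative
      (mat_exp (complex_of_real u \<cdot>\<^sub>m A) * A) $$ (i, j)) (at (of_real u))"
    by simp
  from has_vector_derivative_real_field[OF this]
  show ?thesis by (simp add: mat_exp_index[OF A ij])
qed

lemma mat_exp_commute:
  assumes A: "A \<in> carrier_mat N N"
  shows "A * mat_exp (c \<cdot>\<^sub>m A) = mat_exp (c \<cdot>\<^sub>m A) * A"
proof (rule eq_matI)
  fix i j assume "i < dim_row (mat_exp (c \<cdot>\<^sub>m A) * A)" "j < dim_col (mat_exp (c \<cdot>\<^sub>m A) * A)"
  then have ij: "i < N" "j < N" using A by (auto simp: mat_exp_def)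
  have E: "mat_exp (c \<cdot>\<^sub>m A) \<in> carrier_mat N N" using A by simp
  let ?c = "\<lambda>i j k. (A ^\<^sub>m k) $$ (i, j) / fact k * c ^ k"
  have "(A * mat_exp (c \<cdot>\<^sub>m A)) $$ (i, j) = (suminf (\<lambda>k. \<Sum>l<N. A $$ (i, l) * ?c l j k))"
  proof -
    have "A $$ (i, l) * mat_exp (c \<cdot>\<^sub>m A) $$ (l, j) = suminf (\<lambda>k. A $$ (i, l) * ?c l j k)" if "l < N" for l
      unfolding mat_exp_index[OF A that ij(2)]
      by (rule suminf_mult[OF summable_mat_exp[OF A that ij(2)], symmetric])
    then have "(A * mat_exp (c \<cdot>\<^sub>m A)) $$ (i, j) = (\<Sum>l<N. suminf (\<lambda>k. A $$ (i, l) * ?c l j k))"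
      unfolding mat_mult_index[OF A E ij] by (intro sum.cong refl) simp
    also have "\<dots> = (suminf (\<lambda>k. \<Sum>l<N. A $$ (i, l) * ?c l j k))"
      by (rule suminf_sum[symmetric]) (use summable_mat_exp[OF A _ ij(2)] in \<open>auto intro!: summable_mult simp del: times_divide_eq_left times_divide_eq_right\<close>)
    finally show ?thesis .
  qed
  also have "(\<lambda>k. \<Sum>l<N. A $$ (i, l) * ?c l j k) = (\<lambda>k. \<Sum>l<N. ?c i l k * A $$ (l, j))"
  proof
    fix k
    have Ak: "A ^\<^sub>m k \<in> carrier_mat N N" using A by simp
    have "(\<Sum>l<N. A $$ (i, l) * ?c l j k) = (A * A ^\<^sub>m k) $$ (i, j) / fact k * c ^ k"
      unfolding mat_mult_index[OF A Ak ij]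
      by (simp only: sum_divide_distrib sum_distrib_right) (simp add: mult_ac)
    also have "\<dots> = (\<Sum>l<N. ?c i l k * A $$ (l, j))"
      unfolding pow_mat_commute[OF A] mat_mult_index[OF Ak A ij]
      by (simp only: sum_divide_distrib sum_distrib_right) (simp add: mult_ac)
    finally show "(\<Sum>l<N. A $$ (i, l) * ?c l j k) = (\<Sum>l<N. ?c i l k * A $$ (l, j))" .
  qed
  also have "(suminf (\<lambda>k. \<Sum>l<N. ?c i l k * A $$ (l, j))) = (mat_exp (c \<cdot>\<^sub>m A) * A) $$ (i, j)"
  proof -
    have "mat_exp (c \<cdot>\<^sub>m A) $$ (i, l) * A $$ (l, j) = suminf (\<lambda>k. ?c i l k * A $$ (l, j))" if "l < N" for l
      unfolding mat_exp_index[OF A ij(1) that]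
      by (rule suminf_mult2[OF summable_mat_exp[OF A ij(1) that]])
    then have "(mat_exp (c \<cdot>\<^sub>m A) * A) $$ (i, j) = (\<Sum>l<N. suminf (\<lambda>k. ?c i l k * A $$ (l, j)))"
      unfolding mat_mult_index[OF E A ij] by (intro sum.cong refl) simp
    also have "\<dots> = (suminf (\<lambda>k. \<Sum>l<N. ?c i l k * A $$ (l, j)))"
      by (rule suminf_sum[symmetric]) (use summable_mat_exp[OF A ij(1)] in \<open>auto intro!: summable_mult2 simp del: times_divide_eq_left times_divide_eq_right\<close>)
    finally show ?thesis by simp
  qed
  finally show "(A * mat_exp (c \<cdot>\<^sub>m A)) $$ (i, j) = (mat_exp (c \<cdot>\<^sub>m A) * A) $$ (i, j)" .
qed (use A in \<open>auto simp: mat_exp_def\<close>)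

lemma mat_exp_zero:
  assumes A: "A \<in> carrier_mat N N"
  shows "mat_exp (0 \<cdot>\<^sub>m A) = 1\<^sub>m N"
proof (rule eq_matI)
  fix i j assume "i < dim_row (1\<^sub>m N :: complex mat)" "j < dim_col (1\<^sub>m N :: complex mat)"
  then have ij: "i < N" "j < N" by auto
  show "mat_exp (0 \<cdot>\<^sub>m A) $$ (i, j) = 1\<^sub>m N $$ (i, j)"
    unfolding mat_exp_index[OF A ij] using A ij by (subst powser_zero) simp
qed (use A in \<open>auto simp: mat_exp_def\<close>)

text \<open>The product of the exponentials at \<open>u + v - x\<close> and at \<open>x\<close> has
  derivative 0 in \<open>x\<close>, since \<open>A\<close> commutes with its exponential. Comparing
  \<open>x = v\<close> with \<open>x = 0\<close> avoids multiplying two series.\<close>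

lemma mat_exp_add:
  assumes A: "A \<in> carrier_mat N N"
  shows "mat_exp (complex_of_real u \<cdot>\<^sub>m A) * mat_exp (complex_of_real v \<cdot>\<^sub>m A) =
    mat_exp (complex_of_real (u + v) \<cdot>\<^sub>m A)"
proof (rule eq_matI)
  let ?E = "\<lambda>u. mat_exp (complex_of_real u \<cdot>\<^sub>m A)"
  have E: "?E u \<in> carrier_mat N N" for u using A by simp
  fix i j assume "i < dim_row (?E (u + v))" "j < dim_col (?E (u + v))"
  then have ij: "i < N" "j < N" using A by (auto simp: mat_exp_def)
  let ?c = "u + v"
  let ?h = "\<lambda>x. \<Sum>l<N. ?E (?c - x) $$ (i, l) * ?E x $$ (l, j)"
  have "(?h has_vector_derivative 0) (at x)" for x
  proof -
    have 0: "((\<lambda>x. ?c - x) has_vector_derivative - 1) (at x)"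
      using has_vector_derivative_diff[OF has_vector_derivative_const[of ?c "at x"] has_vector_derivative_id[of "at x"]] by simp
    have 1: "((\<lambda>x. ?E (?c - x) $$ (i, l)) has_vector_derivative - (?E (?c - x) * A) $$ (i, l)) (at x)"
      if "l < N" for l
      using vector_diff_chain_at[OF 0 mat_exp_deriv[OF A ij(1) that]] by (simp add: o_def)
    have 2: "((\<lambda>x. ?E x $$ (l, j)) has_vector_derivative (A * ?E x) $$ (l, j)) (at x)"
      if "l < N" for l
      unfolding mat_exp_commute[OF A] by (rule mat_exp_deriv[OF A that ij(2)])
    have "(?h has_vector_derivative (\<Sum>l<N. ?E (?c - x) $$ (i, l) * (A * ?E x) $$ (l, j) +
        - (?E (?c - x) * A) $$ (i, l) * ?E x $$ (l, j))) (at x)"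
      by (intro has_vector_derivative_sum has_vector_derivative_mult 1 2) auto
    moreover have "(\<Sum>l<N. ?E (?c - x) $$ (i, l) * (A * ?E x) $$ (l, j)) =
        (\<Sum>l<N. (?E (?c - x) * A) $$ (i, l) * ?E x $$ (l, j))"
    proof -
      have EA: "?E u * A \<in> carrier_mat N N" and AE: "A * ?E u \<in> carrier_mat N N" for u
        using A by (simp_all add: mult_carrier_mat[of _ N N])
      have "?E (?c - x) * (A * ?E x) = (?E (?c - x) * A) * ?E x"
        by (rule assoc_mult_mat[OF E A E, symmetric])
      then have "(?E (?c - x) * (A * ?E x)) $$ (i, j) = ((?E (?c - x) * A) * ?E x) $$ (i, j)"
        by (rule arg_cong)
      then show ?thesis
        unfolding mat_mult_index[OF E AE ij] mat_mult_index[OF EA E ij] .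
    qed
    ultimately show ?thesis by (simp add: sum_subtractf)
  qed
  then obtain c where h: "\<And>x. ?h x = c"
    using has_vector_derivative_zero_constant[of UNIV ?h] by auto
  have "?h v = ?h 0" by (rule trans[OF h h[symmetric]])
  then have "(?E u * ?E v) $$ (i, j) = (?E ?c * ?E 0) $$ (i, j)"
    by (simp only: mat_mult_index[OF E E ij]) simp
  then show "(?E u * ?E v) $$ (i, j) = ?E ?c $$ (i, j)"
    using E[of ?c] by (simp add: mat_exp_zero[OF A])
qed (use A in \<open>auto simp: mat_exp_def\<close>)

lemma flow_add:
  assumes g: "g \<in> carrier_mat N N" and \<xi>: "\<xi> \<in> carrier_mat N N"
  shows "flow \<xi> (flow \<xi> g u) v = flow \<xi> g (u + v)"
proof -
  have E: "mat_exp (complex_of_real u \<cdot>\<^sub>m \<xi>) \<in> carrier_mat N N" for u using \<xi> by simp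
  show ?thesis unfolding flow_def assoc_mult_mat[OF g E E] mat_exp_add[OF \<xi>] ..
qed

lemma flow_zero [simp]: "g \<in> carrier_mat N N \<Longrightarrow> \<xi> \<in> carrier_mat N N \<Longrightarrow> flow \<xi> g 0 = g"
  by (simp add: flow_def mat_exp_zero)

lemma flow_GL:
  assumes g: "g \<in> GL N" and \<xi>: "\<xi> \<in> carrier_mat N N"
  shows "flow \<xi> g u \<in> GL N"
    and "GL_inv N (flow \<xi> g u) = mat_exp (complex_of_real (- u) \<cdot>\<^sub>m \<xi>) * GL_inv N g"
proof -
  let ?E = "\<lambda>u. mat_exp (complex_of_real u \<cdot>\<^sub>m \<xi>)"
  have E: "?E u \<in> carrier_mat N N" for u using \<xi> by simp
  have 1: "?E u * ?E (- u) = 1\<^sub>m N" for u using mat_exp_add[OF \<xi>, of u "- u"] \<xi> by (simp add: mat_exp_zero)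
  have 2: "?E (- u) * ?E u = 1\<^sub>m N" using 1[of "- u"] by simp
  have "?E u \<in> GL N" by (rule GL_I[OF E E 1 2])
  then show "flow \<xi> g u \<in> GL N" "GL_inv N (flow \<xi> g u) = ?E (- u) * GL_inv N g"
    unfolding flow_def using GL_mult[OF g] GL_inv_unique[OF E E 1 2] by auto
qed

text \<open>Entrywise derivative at parameter 0 only; other parameters are reached through the group
  property (\<open>flow_has_vector_derivative\<close>).\<close>

definition mat_deriv :: "nat \<Rightarrow> (real \<Rightarrow> complex mat) \<Rightarrow> complex mat \<Rightarrow> bool" where
  "mat_deriv N M M' \<longleftrightarrow> (\<forall>u. M u \<in> carrier_mat N N) \<and> M' \<in> carrier_mat N N \<and>
     (\<forall>i<N. \<forall>j<N. ((\<lambda>u. M u $$ (i, j)) has_vector_derivative M' $$ (i, j)) (at 0))"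

lemma mat_deriv_const: "A \<in> carrier_mat N N \<Longrightarrow> mat_deriv N (\<lambda>_. A) (0\<^sub>m N N)"
  by (simp add: mat_deriv_def)

lemma mat_deriv_mult:
  assumes "mat_deriv N M M'" "mat_deriv N P P'"
  shows "mat_deriv N (\<lambda>u. M u * P u) (M 0 * P' + M' * P 0)"
  unfolding mat_deriv_def
proof (intro conjI allI impI)
  have c: "M u \<in> carrier_mat N N" "P u \<in> carrier_mat N N" "M' \<in> carrier_mat N N" "P' \<in> carrier_mat N N" for u
    using assms by (auto simp: mat_deriv_def)
  show "M u * P u \<in> carrier_mat N N" "M 0 * P' + M' * P 0 \<in> carrier_mat N N" for u
    using c by (auto intro!: mult_carrier_mat[of _ N N] add_carrier_mat)
  fix i j assume ij: "i < N" "j < N"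
  have "((\<lambda>u. \<Sum>l<N. M u $$ (i, l) * P u $$ (l, j)) has_vector_derivative
      (\<Sum>l<N. M 0 $$ (i, l) * P' $$ (l, j) + M' $$ (i, l) * P 0 $$ (l, j))) (at 0)"
    using assms ij by (intro has_vector_derivative_sum has_vector_derivative_mult) (auto simp: mat_deriv_def)
  moreover have "(M 0 * P' + M' * P 0) $$ (i, j) = (\<Sum>l<N. M 0 $$ (i, l) * P' $$ (l, j) + M' $$ (i, l) * P 0 $$ (l, j))"
  proof -
    have "(M 0 * P' + M' * P 0) $$ (i, j) = (M 0 * P') $$ (i, j) + (M' * P 0) $$ (i, j)"
      using c(3) ij carrier_matD[OF c(2)] by (intro index_add_mat) auto
    then show ?thesis
      by (simp only: mat_mult_index[OF c(1) c(4) ij] mat_mult_index[OF c(3) c(2) ij] sum.distrib)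
  qed
  ultimately show "((\<lambda>u. (M u * P u) $$ (i, j)) has_vector_derivative (M 0 * P' + M' * P 0) $$ (i, j)) (at 0)"
    by (simp only: mat_mult_index[OF c(1,2) ij])
qed

lemma mat_deriv_adjoint:
  assumes "mat_deriv N M M'"
  shows "mat_deriv N (\<lambda>u. mat_adjoint (M u)) (mat_adjoint M')"
proof -
  have c: "M u \<in> carrier_mat N N" "M' \<in> carrier_mat N N" for u
    using assms by (auto simp: mat_deriv_def)
  have d: "dim_row (M u) = N" "dim_col (M u) = N" "dim_row M' = N" "dim_col M' = N" for u
    using c by auto
  show ?thesis unfolding mat_deriv_def
    using assms c by (auto simp: mat_deriv_def d intro!: has_vector_derivative_cnj)
qed

lemma mat_deriv_trace:
  assumes "mat_deriv N M M'"
  shows "((\<lambda>u. normalized_trace N (M u)) has_vector_derivative normalized_trace N M') (at 0)"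
proof -
  have d: "dim_row (M u) = N" "dim_row M' = N" for u
    using assms by (auto simp: mat_deriv_def)
  show ?thesis
    unfolding normalized_trace_def mat_trace_def d
    using assms by (intro has_vector_derivative_divide has_vector_derivative_sum) (auto simp: mat_deriv_def)
qed

text \<open>By \<open>flow_GL\<close> the inverse along the flow is again an exponential times a
  constant, so inversion itself is never differentiated.\<close>

lemma mat_deriv_flow:
  assumes g: "g \<in> GL N" and \<xi>: "\<xi> \<in> carrier_mat N N"
  shows "mat_deriv N (flow \<xi> g) (g * \<xi>)"
    and "mat_deriv N (\<lambda>u. GL_inv N (flow \<xi> g u)) (- (\<xi> * GL_inv N g))"
proof -
  let ?E = "\<lambda>u. mat_exp (complex_of_real u \<cdot>\<^sub>m \<xi>)"
  note gc = GL_inv(1,2)[OF g]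
  have "mat_deriv N ?E \<xi>"
    using mat_exp_deriv[OF \<xi>, of _ _ 0] \<xi> by (auto simp: mat_deriv_def mat_exp_zero)
  from mat_deriv_mult[OF mat_deriv_const[OF gc(1)] this]
  show "mat_deriv N (flow \<xi> g) (g * \<xi>)"
    using gc \<xi> by (simp add: flow_def[abs_def] left_mult_zero_mat[of _ N N] mat_exp_zero)
  have "((\<lambda>u. ?E (- u) $$ (i, j)) has_vector_derivative (- \<xi>) $$ (i, j)) (at 0)" if ij: "i < N" "j < N" for i j
  proof -
    have 1: "((\<lambda>u. ?E u $$ (i, j)) has_vector_derivative \<xi> $$ (i, j)) (at (- 0))"
      using mat_exp_deriv[OF \<xi> ij, of 0] \<xi> by (simp add: mat_exp_zero)
    have 2: "(uminus has_vector_derivative (- 1 :: real)) (at 0)"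
      using has_vector_derivative_minus[OF has_vector_derivative_id] by simp
    show ?thesis using vector_diff_chain_at[OF 2 1] \<xi> ij by (simp add: o_def)
  qed
  then have "mat_deriv N (\<lambda>u. ?E (- u)) (- \<xi>)"
    using \<xi> by (auto simp: mat_deriv_def simp del: of_real_minus)
  from mat_deriv_mult[OF this mat_deriv_const[OF gc(2)]]
  show "mat_deriv N (\<lambda>u. GL_inv N (flow \<xi> g u)) (- (\<xi> * GL_inv N g))"
    using gc \<xi> by (simp add: flow_GL(2)[OF g \<xi>] right_mult_zero_mat[of _ N N] mat_exp_zero left_add_zero_mat[of _ N N])
qed

section \<open>The Laplacian on products of traces of words\<close>

abbreviation word_mat :: "nat \<Rightarrow> complex mat \<Rightarrow> word \<Rightarrow> complex mat" where
  "word_mat N \<equiv> word_eval (matrix_algebra N)"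

definition trace_state :: "nat \<Rightarrow> complex mat \<Rightarrow> word list \<Rightarrow> complex" where
  "trace_state N g ws = (\<Prod>w\<leftarrow>ws. normalized_trace N (word_mat N g w))"

lemma trace_state_simps [simp]:
  "trace_state N g [] = 1"
  "trace_state N g (w # ws) = normalized_trace N (word_mat N g w) * trace_state N g ws"
  by (simp_all add: trace_state_def)

lemma word_mat_Nil [simp]: "word_mat N g [] = 1\<^sub>m N"
  by (simp add: word_eval_def)

lemma word_mat_Cons [simp]:
  "word_mat N g (l # w) = letter_eval (matrix_algebra N) g l * word_mat N g w"
  by (simp add: word_eval_def)

lemma word_mat_carrier [simp]: "g \<in> GL N \<Longrightarrow> word_mat N g w \<in> carrier_mat N N"
  using star_algebra.word_eval_closed[OF star_algebra_matrix, of g N w]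
  by (simp add: Units_matrix_algebra)

lemma letter_eval_carrier [simp]: "g \<in> GL N \<Longrightarrow> letter_eval (matrix_algebra N) g l \<in> carrier_mat N N"
  using star_algebra.letter_eval_cancel(1)[OF star_algebra_matrix, of g N l]
  by (simp add: Units_matrix_algebra)

lemma word_mat_append: "g \<in> GL N \<Longrightarrow> word_mat N g (u @ v) = word_mat N g u * word_mat N g v"
  using star_algebra.word_eval_append[OF star_algebra_matrix, of g N u v]
  by (simp add: Units_matrix_algebra)

lemma letter_eval_matrix:
  assumes "g \<in> GL N"
  shows "letter_eval (matrix_algebra N) g (Gen, True) = g"
    "letter_eval (matrix_algebra N) g (Gen, False) = GL_inv N g"
    "letter_eval (matrix_algebra N) g (Gen_star, True) = mat_adjoint g"
    "letter_eval (matrix_algebra N) g (Gen_star, False) = mat_adjoint (GL_inv N g)"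
  using star_algebra.adj_Units(2)[OF star_algebra_matrix, of g N] assms
  by (simp_all add: Units_matrix_algebra GL_inv_def)

text \<open>A list sum whose empty case fixes the size \<open>N\<close> of the result.\<close>

primrec mat_sum :: "nat \<Rightarrow> ('a \<Rightarrow> complex mat) \<Rightarrow> 'a list \<Rightarrow> complex mat" where
  "mat_sum N f [] = 0\<^sub>m N N"
| "mat_sum N f (x # xs) = f x + mat_sum N f xs"

lemma mat_sum_carrier [simp]:
  "(\<And>x. x \<in> set xs \<Longrightarrow> f x \<in> carrier_mat N N) \<Longrightarrow> mat_sum N f xs \<in> carrier_mat N N"
  by (induction xs) auto

lemma mult_mat_sum:
  assumes "A \<in> carrier_mat N N" "\<And>x. x \<in> set xs \<Longrightarrow> f x \<in> carrier_mat N N"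
  shows "A * mat_sum N f xs = mat_sum N (\<lambda>x. A * f x) xs"
  using assms(2)
proof (induction xs)
  case (Cons x xs)
  then show ?case using assms(1) by (simp add: mult_add_distrib_mat[of _ N N _ N])
qed (use assms(1) in simp)

lemma mat_sum_mult:
  assumes "A \<in> carrier_mat N N" "\<And>x. x \<in> set xs \<Longrightarrow> f x \<in> carrier_mat N N"
  shows "mat_sum N f xs * A = mat_sum N (\<lambda>x. f x * A) xs"
  using assms(2)
proof (induction xs)
  case (Cons x xs)
  then show ?case using assms(1) by (simp add: add_mult_distrib_mat[of _ N N _ _ N])
qed (use assms(1) in simp)

lemma normalized_trace_mat_sum:
  assumes "\<And>x. x \<in> set xs \<Longrightarrow> f x \<in> carrier_mat N N"
  shows "normalized_trace N (mat_sum N f xs) = (\<Sum>x\<leftarrow>xs. normalized_trace N (f x))"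
  using assms
proof (induction xs)
  case Nil
  show ?case by (simp add: normalized_trace_def mat_trace_def)
next
  case (Cons x xs)
  then show ?case by (simp add: normalized_trace_def mat_trace_add[of _ N] add_divide_distrib)
qed

lemma normalized_trace_smult:
  "A \<in> carrier_mat N N \<Longrightarrow> normalized_trace N (c \<cdot>\<^sub>m A) = c * normalized_trace N A"
  by (simp add: normalized_trace_def mat_trace_smult)

lemma normalized_trace_add:
  "A \<in> carrier_mat N N \<Longrightarrow> B \<in> carrier_mat N N \<Longrightarrow>
    normalized_trace N (A + B) = normalized_trace N A + normalized_trace N B"
  by (simp add: normalized_trace_def mat_trace_add add_divide_distrib)

lemma mat_mult3_carrier:
  "A \<in> carrier_mat N N \<Longrightarrow> B \<in> carrier_mat N N \<Longrightarrow> C \<in> carrier_mat N N \<Longrightarrow> A * B * C \<in> carrier_mat N N"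
  by (intro mult_carrier_mat[of _ N N])

locale skew_direction =
  fixes N :: nat and X :: "complex mat"
  assumes X: "X \<in> carrier_mat N N" and skew: "mat_adjoint X = - X"
begin

text \<open>The flow gives \<open>z g X\<close> and \<open>- z X g^-1\<close>. The other two letters
  follow by taking adjoints, where skewness turns the adjoint of \<open>z X\<close> into
  \<open>- cnj z\<close> times \<open>X\<close>; this produces the signs in
  \<open>letter_coeff\<close>.\<close>

lemma letter_deriv:
  assumes g: "g \<in> GL N"
  shows "mat_deriv N (\<lambda>u. letter_eval (matrix_algebra N) (flow (z \<cdot>\<^sub>m X) g u) l)
    (letter_coeff z l \<cdot>\<^sub>m (word_mat N g (fst (cut_letter l)) * X * word_mat N g (snd (cut_letter l))))"
proof -
  let ?g' = "GL_inv N g"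
  have zX: "z \<cdot>\<^sub>m X \<in> carrier_mat N N" using X by simp
  note gc = GL_inv(1,2)[OF g]
  note d = mat_deriv_flow[OF g zX]
  note G = flow_GL(1)[OF g zX]
  have zX': "mat_adjoint (z \<cdot>\<^sub>m X) = - cnj z \<cdot>\<^sub>m X"
  proof -
    have "mat_adjoint (z \<cdot>\<^sub>m X) = cnj z \<cdot>\<^sub>m mat_adjoint X" using X by (auto intro!: eq_matI)
    then show ?thesis using X unfolding skew by (auto intro!: eq_matI)
  qed
  have e1: "g * (z \<cdot>\<^sub>m X) = z \<cdot>\<^sub>m (g * X)" using gc X by (simp add: mult_smult_distrib[of _ N N _ N])
  have e2: "- (z \<cdot>\<^sub>m X * ?g') = - z \<cdot>\<^sub>m (X * ?g')"
    using gc X by (subst mult_smult_assoc_mat[of _ N N _ N]) (auto intro!: eq_matI)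
  have e3: "mat_adjoint (g * (z \<cdot>\<^sub>m X)) = - cnj z \<cdot>\<^sub>m (X * mat_adjoint g)"
    unfolding mat_adjoint_mult[OF gc(1) zX] zX' using gc X by (simp add: mult_smult_assoc_mat[of _ N N _ N])
  have e4: "mat_adjoint (- (z \<cdot>\<^sub>m X * ?g')) = cnj z \<cdot>\<^sub>m (mat_adjoint ?g' * X)"
  proof -
    have "mat_adjoint (- (z \<cdot>\<^sub>m X * ?g')) = - mat_adjoint (z \<cdot>\<^sub>m X * ?g')"
      using gc X by (auto intro!: eq_matI simp del: index_mult_mat(1))
    also have "\<dots> = - (mat_adjoint ?g' * (- cnj z \<cdot>\<^sub>m X))"
      unfolding mat_adjoint_mult[OF zX gc(2)] zX' ..
    also have "\<dots> = cnj z \<cdot>\<^sub>m (mat_adjoint ?g' * X)"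
      using gc X by (subst mult_smult_distrib[of _ N N _ N]) (auto intro!: eq_matI)
    finally show ?thesis .
  qed
  show ?thesis
  proof (cases "(z, l)" rule: letter_coeff.cases)
    case (1 z')
    then have l: "l = (Gen, True)" by simp
    show ?thesis using d(1) gc X G
      by (simp add: letter_eval_matrix[OF g] letter_eval_matrix[OF G] l e1 mult_carrier_mat[of _ N N] del: letter_eval.simps)
  next
    case (2 z')
    then have l: "l = (Gen, False)" by simp
    show ?thesis using d(2) gc X
      by (simp add: letter_eval_matrix[OF g] letter_eval_matrix[OF G] l e2 del: letter_eval.simps)
  next
    case (3 z')
    then have l: "l = (Gen_star, True)" by simp
    show ?thesis using mat_deriv_adjoint[OF d(1)] gc X
      by (simp add: letter_eval_matrix[OF g] letter_eval_matrix[OF G] l e3 del: letter_eval.simps)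
  next
    case (4 z')
    then have l: "l = (Gen_star, False)" by simp
    show ?thesis using mat_deriv_adjoint[OF d(2)] gc X
      by (simp add: letter_eval_matrix[OF g] letter_eval_matrix[OF G] l e4
          mult_carrier_mat[of _ N N] del: letter_eval.simps)
  qed
qed

definition word_deriv :: "complex \<Rightarrow> complex mat \<Rightarrow> word \<Rightarrow> complex mat" where
  "word_deriv z g w =
     mat_sum N (\<lambda>(c, u, v). c \<cdot>\<^sub>m (word_mat N g u * X * word_mat N g v)) (splits z w)"

lemma term_carrier: "g \<in> GL N \<Longrightarrow> word_mat N g u * X * word_mat N g v \<in> carrier_mat N N"
  using X by (intro mat_mult3_carrier) auto

lemma word_deriv_carrier: "g \<in> GL N \<Longrightarrow> word_deriv z g w \<in> carrier_mat N N"
  unfolding word_deriv_def using term_carrier by (intro mat_sum_carrier) auto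

lemma mat_sum_map: "mat_sum N f (map h xs) = mat_sum N (\<lambda>x. f (h x)) xs"
  by (induction xs) auto

lemma mat_sum_cong: "(\<And>x. x \<in> set xs \<Longrightarrow> f x = f' x) \<Longrightarrow> mat_sum N f xs = mat_sum N f' xs"
  by (induction xs) auto

text \<open>The product rule for \<open>l # w\<close> mirrors the recursion of
  \<open>splits\<close>: either \<open>l\<close> is cut, or the cut lies in \<open>w\<close> and
  \<open>l\<close> joins the left piece.\<close>

lemma word_mat_deriv:
  assumes g: "g \<in> GL N"
  shows "mat_deriv N (\<lambda>u. word_mat N (flow (z \<cdot>\<^sub>m X) g u) w) (word_deriv z g w)"
proof (induction w)
  case Nil
  show ?case by (simp add: word_deriv_def mat_deriv_const)
next
  case (Cons l w)
  let ?L = "letter_eval (matrix_algebra N) g l" and ?W = "word_mat N g"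
  let ?c = "letter_coeff z l" and ?u = "fst (cut_letter l)" and ?v = "snd (cut_letter l)"
  have zX: "z \<cdot>\<^sub>m X \<in> carrier_mat N N" using X by simp
  have f0: "flow (z \<cdot>\<^sub>m X) g 0 = g" using GL_inv(1)[OF g] zX by simp
  have T: "?W u * X * ?W v \<in> carrier_mat N N" for u v by (rule term_carrier[OF g])
  note assoc = assoc_mult_mat[of _ N N _ N _ N]
  have "?L * word_deriv z g w =
      mat_sum N (\<lambda>(c, u, v). c \<cdot>\<^sub>m (?W (l # u) * X * ?W v)) (splits z w)"
    unfolding word_deriv_def
  proof (subst mult_mat_sum)
    show "mat_sum N (\<lambda>x. ?L * (case x of (c, u, v) \<Rightarrow> c \<cdot>\<^sub>m (?W u * X * ?W v))) (splits z w) =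
      mat_sum N (\<lambda>(c, u, v). c \<cdot>\<^sub>m (?W (l # u) * X * ?W v)) (splits z w)"
    proof (rule mat_sum_cong, clarsimp)
      fix c u v
      show "?L * (c \<cdot>\<^sub>m (?W u * X * ?W v)) = c \<cdot>\<^sub>m (?L * ?W u * X * ?W v)"
        using g X T[of u v]
        by (simp add: mult_smult_distrib[of _ N N _ N] assoc mult_carrier_mat[of _ N N])
    qed
  qed (use g T in auto)
  moreover have "(?c \<cdot>\<^sub>m (?W ?u * X * ?W ?v)) * ?W w = ?c \<cdot>\<^sub>m (?W ?u * X * ?W (?v @ w))"
    using g X T[of ?u ?v]
    by (simp add: mult_smult_assoc_mat[of _ N N _ N] word_mat_append assoc mult_carrier_mat[of _ N N])
  moreover have "word_deriv z g (l # w) = ?c \<cdot>\<^sub>m (?W ?u * X * ?W (?v @ w)) +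
      mat_sum N (\<lambda>(c, u, v). c \<cdot>\<^sub>m (?W (l # u) * X * ?W v)) (splits z w)"
    by (simp add: word_deriv_def mat_sum_map case_prod_unfold)
  ultimately have "word_deriv z g (l # w) = (?c \<cdot>\<^sub>m (?W ?u * X * ?W ?v)) * ?W w + ?L * word_deriv z g w"
    by simp
  also have "\<dots> = ?L * word_deriv z g w + (?c \<cdot>\<^sub>m (?W ?u * X * ?W ?v)) * ?W w"
    using g T word_deriv_carrier[OF g, of z w] by (intro comm_add_mat[of _ N N]) (auto intro!: mult_carrier_mat[of _ N N])
  finally show ?case
    using mat_deriv_mult[OF letter_deriv[OF g, of z l] Cons.IH] by (simp add: f0)
qed

definition dtrace :: "complex \<Rightarrow> complex mat \<Rightarrow> word \<Rightarrow> complex" where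
  "dtrace z g w = (\<Sum>(c, u, v)\<leftarrow>splits z w. c * normalized_trace N (word_mat N g u * X * word_mat N g v))"

text \<open>A cut leaves its letter whole on one side, so cutting the pieces \<open>u\<close> and
  \<open>v\<close> again also accounts for two insertions at the same letter.\<close>

definition ddtrace :: "complex \<Rightarrow> complex mat \<Rightarrow> word \<Rightarrow> complex" where
  "ddtrace z g w = (\<Sum>(c, u, v)\<leftarrow>splits z w. c *
     ((\<Sum>(d, a, b)\<leftarrow>splits z u. d *
        normalized_trace N (word_mat N g a * X * word_mat N g b * X * word_mat N g v)) +
      (\<Sum>(d, a, b)\<leftarrow>splits z v. d *
        normalized_trace N (word_mat N g u * X * word_mat N g a * X * word_mat N g b))))"

lemma trace_word_deriv: 
  assumes g: "g \<in> GL N"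
  shows "normalized_trace N (word_deriv z g w) = dtrace z g w"
  unfolding word_deriv_def dtrace_def using term_carrier[OF g]
  by (subst normalized_trace_mat_sum)
    (auto simp: normalized_trace_smult case_prod_unfold)

lemma has_vector_derivative_sum_list:
  fixes f :: "'b \<Rightarrow> real \<Rightarrow> complex"
  assumes "\<And>x. x \<in> set xs \<Longrightarrow> (f x has_vector_derivative f' x) F"
  shows "((\<lambda>u. \<Sum>x\<leftarrow>xs. f x u) has_vector_derivative (\<Sum>x\<leftarrow>xs. f' x)) F"
  using assms by (induction xs) (auto intro!: has_vector_derivative_add)

lemma dtrace_deriv:
  assumes g: "g \<in> GL N"
  shows "((\<lambda>u. normalized_trace N (word_mat N (flow (z \<cdot>\<^sub>m X) g u) w)) has_vector_derivative dtrace z g w) (at 0)"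
  using mat_deriv_trace[OF word_mat_deriv[OF g]] by (simp add: trace_word_deriv[OF g])

lemma ddtrace_deriv:
  assumes g: "g \<in> GL N"
  shows "((\<lambda>u. dtrace z (flow (z \<cdot>\<^sub>m X) g u) w) has_vector_derivative ddtrace z g w) (at 0)"
proof -
  let ?W = "word_mat N g" and ?t = "normalized_trace N"
  have zX: "z \<cdot>\<^sub>m X \<in> carrier_mat N N" using X by simp
  have f0: "flow (z \<cdot>\<^sub>m X) g 0 = g" using GL_inv(1)[OF g] zX by simp
  note assoc = assoc_mult_mat[of _ N N _ N _ N]
  have W: "?W u \<in> carrier_mat N N" for u using g by simp
  have WX: "?W u * X \<in> carrier_mat N N" "X * ?W u \<in> carrier_mat N N" for u
    using W X by (auto intro: mult_carrier_mat[of _ N N])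
  have T: "?W u * X * ?W v \<in> carrier_mat N N" for u v by (rule term_carrier[OF g])
  have 1: "((\<lambda>x. ?t (word_mat N (flow (z \<cdot>\<^sub>m X) g x) u * X * word_mat N (flow (z \<cdot>\<^sub>m X) g x) v))
      has_vector_derivative
        ((\<Sum>(d, a, b)\<leftarrow>splits z u. d * ?t (?W a * X * ?W b * X * ?W v)) +
         (\<Sum>(d, a, b)\<leftarrow>splits z v. d * ?t (?W u * X * ?W a * X * ?W b)))) (at 0)" for u v
  proof -
    have c: "?W u * X * word_deriv z g v \<in> carrier_mat N N"
      "word_deriv z g u * X * ?W v \<in> carrier_mat N N"
      using W X word_deriv_carrier[OF g] by (auto intro!: mat_mult3_carrier)
    have z: "?W u * 0\<^sub>m N N + word_deriv z g u * X = word_deriv z g u * X"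
      using W[of u] word_deriv_carrier[OF g, of z u] X
      by (simp add: right_mult_zero_mat[of _ N N] left_add_zero_mat[of _ N N] mult_carrier_mat[of _ N N])
    have "((\<lambda>x. ?t (word_mat N (flow (z \<cdot>\<^sub>m X) g x) u * X * word_mat N (flow (z \<cdot>\<^sub>m X) g x) v))
      has_vector_derivative ?t (?W u * X * word_deriv z g v + word_deriv z g u * X * ?W v)) (at 0)"
      using mat_deriv_trace[OF mat_deriv_mult[OF mat_deriv_mult[OF word_mat_deriv[OF g] mat_deriv_const[OF X]]
        word_mat_deriv[OF g]], of z u z v] by (simp add: f0 z)
    moreover have "?t (?W u * X * word_deriv z g v) = (\<Sum>(d, a, b)\<leftarrow>splits z v. d * ?t (?W u * X * ?W a * X * ?W b))"
    proof -
      have "?t (?W u * X * word_deriv z g v) = (\<Sum>x\<leftarrow>splits z v. ?t (?W u * X * (case x of (c, a, b) \<Rightarrow> c \<cdot>\<^sub>m (?W a * X * ?W b))))"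
        unfolding word_deriv_def using W X T WX
        by (subst mult_mat_sum, simp, force, subst normalized_trace_mat_sum) (auto intro!: mult_carrier_mat[of _ N N])
      also have "\<dots> = (\<Sum>(d, a, b)\<leftarrow>splits z v. d * ?t (?W u * X * ?W a * X * ?W b))"
      proof (intro arg_cong[where f = sum_list] map_cong refl, clarsimp)
        fix c a b
        have "?W u * X * (c \<cdot>\<^sub>m (?W a * X * ?W b)) = c \<cdot>\<^sub>m (?W u * X * ?W a * X * ?W b)"
          using W X T WX
          by (simp add: mult_smult_distrib[of _ N N _ N] assoc mult_carrier_mat[of _ N N])
        moreover have "?W u * X * ?W a * X * ?W b \<in> carrier_mat N N"
          using W X by (intro mult_carrier_mat[of _ N N])
        ultimately show "?t (?W u * X * (c \<cdot>\<^sub>m (?W a * X * ?W b))) = c * ?t (?W u * X * ?W a * X * ?W b)"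
          by (simp add: normalized_trace_smult)
      qed
      finally show ?thesis .
    qed
    moreover have "?t (word_deriv z g u * X * ?W v) = (\<Sum>(d, a, b)\<leftarrow>splits z u. d * ?t (?W a * X * ?W b * X * ?W v))"
    proof -
      have "?t (word_deriv z g u * X * ?W v) = ?t (word_deriv z g u * (X * ?W v))"
        using W X word_deriv_carrier[OF g] by (simp add: assoc)
      also have "\<dots> = (\<Sum>x\<leftarrow>splits z u. ?t ((case x of (c, a, b) \<Rightarrow> c \<cdot>\<^sub>m (?W a * X * ?W b)) * (X * ?W v)))"
        unfolding word_deriv_def using W X T WX
        by (subst mat_sum_mult, simp, force, subst normalized_trace_mat_sum) (auto intro!: mult_carrier_mat[of _ N N])
      also have "\<dots> = (\<Sum>(d, a, b)\<leftarrow>splits z u. d * ?t (?W a * X * ?W b * X * ?W v))"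
      proof (intro arg_cong[where f = sum_list] map_cong refl, clarsimp)
        fix c a b
        have "(c \<cdot>\<^sub>m (?W a * X * ?W b)) * (X * ?W v) = c \<cdot>\<^sub>m (?W a * X * ?W b * X * ?W v)"
          using W X T WX
          by (simp add: mult_smult_assoc_mat[of _ N N _ N] assoc mult_carrier_mat[of _ N N])
        moreover have "?W a * X * ?W b * X * ?W v \<in> carrier_mat N N"
          using W X by (intro mult_carrier_mat[of _ N N])
        ultimately show "?t ((c \<cdot>\<^sub>m (?W a * X * ?W b)) * (X * ?W v)) = c * ?t (?W a * X * ?W b * X * ?W v)"
          by (simp add: normalized_trace_smult)
      qed
      finally show ?thesis .
    qed
    ultimately show ?thesis by (simp add: normalized_trace_add[OF c] add.commute)
  qed
  show ?thesis
    unfolding dtrace_def ddtrace_def case_prod_unfold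
    by (intro has_vector_derivative_sum_list has_vector_derivative_mult_right 1[unfolded case_prod_unfold])
qed

primrec d_state :: "complex \<Rightarrow> complex mat \<Rightarrow> word list \<Rightarrow> complex" where
  "d_state z g [] = 0"
| "d_state z g (w # ws) = normalized_trace N (word_mat N g w) * d_state z g ws + dtrace z g w * trace_state N g ws"

text \<open>Second-order Leibniz rule; the doubled mixed term is what becomes
  \<open>cross_part\<close> after summation over the basis.\<close>

primrec dd_state :: "complex \<Rightarrow> complex mat \<Rightarrow> word list \<Rightarrow> complex" where
  "dd_state z g [] = 0"
| "dd_state z g (w # ws) = normalized_trace N (word_mat N g w) * dd_state z g ws +
     2 * dtrace z g w * d_state z g ws + ddtrace z g w * trace_state N g ws"

lemma trace_state_deriv:
  assumes g: "g \<in> GL N"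
  shows "((\<lambda>u. trace_state N (flow (z \<cdot>\<^sub>m X) g u) ws) has_vector_derivative d_state z g ws) (at 0)"
proof (induction ws)
  case (Cons w ws)
  have "flow (z \<cdot>\<^sub>m X) g 0 = g" using GL_inv(1)[OF g] X by simp
  then show ?case
    using has_vector_derivative_mult[OF dtrace_deriv[OF g, of z w] Cons.IH] by simp
qed simp

lemma d_state_deriv:
  assumes g: "g \<in> GL N"
  shows "((\<lambda>u. d_state z (flow (z \<cdot>\<^sub>m X) g u) ws) has_vector_derivative dd_state z g ws) (at 0)"
proof (induction ws)
  case (Cons w ws)
  have "flow (z \<cdot>\<^sub>m X) g 0 = g" using GL_inv(1)[OF g] X by simp
  then show ?case
    using has_vector_derivative_add[OF
        has_vector_derivative_mult[OF dtrace_deriv[OF g, of z w] Cons.IH]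
        has_vector_derivative_mult[OF ddtrace_deriv[OF g, of z w] trace_state_deriv[OF g, of z ws]]]
    by (simp add: algebra_simps)
qed simp

text \<open>Flattens the recursion to a sum over all cuts of the state, so that a product with
  \<open>dtrace\<close> can be contracted term by term.\<close>

lemma d_state_splits:
  "d_state z g ws = (\<Sum>(d, a, b, r)\<leftarrow>state_splits z ws.
     d * (normalized_trace N (word_mat N g a * X * word_mat N g b) * trace_state N g r))"
proof (induction ws)
  case (Cons w ws)
  have "dtrace z g w * trace_state N g ws = (\<Sum>(c, u, v)\<leftarrow>splits z w.
      c * (normalized_trace N (word_mat N g u * X * word_mat N g v) * trace_state N g ws))"
    unfolding dtrace_def by (simp add: case_prod_unfold mult.assoc flip: sum_list_mult_const)
  then show ?case
    by (simp add: Cons o_def case_prod_unfold sum_list_const_mult[symmetric] mult_ac)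
qed simp

end

lemma sum_sum_list: "(\<Sum>x\<in>S. \<Sum>y\<leftarrow>ys. f x y) = (\<Sum>y\<leftarrow>ys. \<Sum>x\<in>S. f x y)"
  by (induction ys) (auto simp: sum.distrib)

lemma sum_list_product:
  fixes f :: "'a \<Rightarrow> complex"
  shows "(\<Sum>x\<leftarrow>xs. f x) * (\<Sum>y\<leftarrow>ys. h y) = (\<Sum>x\<leftarrow>xs. \<Sum>y\<leftarrow>ys. f x * h y)"
  by (induction xs) (simp_all add: distrib_right sum_list_const_mult)

lemma sum_list_case_cong:
  "(\<And>x. x \<in> set xs \<Longrightarrow> f x = h x) \<Longrightarrow> sum_list (map f xs) = sum_list (map h xs)"
  by (metis map_eq_conv)

lemma finite_functional_scale_arg:
  assumes "finite_functional n \<Lambda>"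
  shows "\<Lambda> (\<lambda>x. a * F x) = a * \<Lambda> F"
  using finite_functional_linear[OF assms, of a F 0 F] by simp

section \<open>Summation of the second derivatives over the basis\<close>

context u_basis
begin

lemma skew_direction: "X \<in> \<beta> \<Longrightarrow> skew_direction N X"
  by unfold_locales (simp_all add: basis_carrier basis_adjoint)

lemma sum_ddtrace:
  assumes g: "g \<in> GL N"
  shows "(\<Sum>X\<in>\<beta>. skew_direction.ddtrace N X z g w) * trace_state N g ws =
    - (\<Sum>(c, u, v)\<leftarrow>splits z w. c *
         ((\<Sum>(d, a, b)\<leftarrow>splits z u. d * trace_state N g (b # (a @ v) # ws)) +
          (\<Sum>(d, a, b)\<leftarrow>splits z v. d * trace_state N g (a # (u @ b) # ws))))"
proof -
  let ?t = "normalized_trace N" and ?W = "word_mat N g"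
  have W: "?W u \<in> carrier_mat N N" for u using g by simp
  have 1: "(\<Sum>X\<in>\<beta>. skew_direction.ddtrace N X z g w) = (\<Sum>(c, u, v)\<leftarrow>splits z w. c *
     ((\<Sum>(d, a, b)\<leftarrow>splits z u. d * (\<Sum>X\<in>\<beta>. ?t (?W a * X * ?W b * X * ?W v))) +
      (\<Sum>(d, a, b)\<leftarrow>splits z v. d * (\<Sum>X\<in>\<beta>. ?t (?W u * X * ?W a * X * ?W b)))))"
    using skew_direction
    by (simp add: skew_direction.ddtrace_def sum_sum_list case_prod_unfold sum.distrib flip: sum_distrib_left)
  show ?thesis
    unfolding 1 sum_basis_trace_same[OF W W W] word_mat_append[OF g, symmetric]
      sum_list_mult_const[symmetric] uminus_sum_list_map
    by (intro sum_list_case_cong)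
      (simp add: case_prod_unfold o_def uminus_sum_list_map distrib_right distrib_left mult.assoc flip: sum_list_mult_const sum_list_const_mult)
qed

lemma sum_cross:
  assumes g: "g \<in> GL N"
  shows "(\<Sum>X\<in>\<beta>. skew_direction.dtrace N X z g w * skew_direction.d_state N X z g ws) =
    - (\<Sum>(c, u, v)\<leftarrow>splits z w. \<Sum>(d, a, b, r)\<leftarrow>state_splits z ws.
         c * d * trace_state N g ((v @ u @ b @ a) # r)) / (of_nat N)\<^sup>2"
proof -
  let ?t = "normalized_trace N" and ?W = "word_mat N g"
  have W: "?W u \<in> carrier_mat N N" for u using g by simp
  have e: "(\<Sum>X\<in>\<beta>. ?t (?W u * X * ?W v) * ?t (?W a * X * ?W b)) = - ?t (?W (v @ u @ b @ a)) / (of_nat N)\<^sup>2"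
    for u v a b
  proof -
    have "?W v * ?W u * ?W b * ?W a = ?W (v @ u @ b @ a)"
      using W by (simp add: word_mat_append[OF g] assoc_mult_mat[of _ N N _ N _ N] mult_carrier_mat[of _ N N])
    then show ?thesis by (simp add: sum_basis_trace_cross[OF W W W W])
  qed
  have "(\<Sum>X\<in>\<beta>. skew_direction.dtrace N X z g w * skew_direction.d_state N X z g ws) =
     (\<Sum>X\<in>\<beta>. (\<Sum>(c, u, v)\<leftarrow>splits z w. c * ?t (?W u * X * ?W v)) *
       (\<Sum>(d, a, b, r)\<leftarrow>state_splits z ws. d * (?t (?W a * X * ?W b) * trace_state N g r)))"
    by (intro sum.cong refl arg_cong2[of _ _ _ _ "(*)"])
      (simp_all only: skew_direction.dtrace_def[OF skew_direction] skew_direction.d_state_splits[OF skew_direction])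
  also have "\<dots> = (\<Sum>(c, u, v)\<leftarrow>splits z w. \<Sum>(d, a, b, r)\<leftarrow>state_splits z ws.
       c * d * trace_state N g r * (\<Sum>X\<in>\<beta>. ?t (?W u * X * ?W v) * ?t (?W a * X * ?W b)))"
    unfolding sum_list_product sum_sum_list case_prod_unfold sum_distrib_left
    by (intro sum_list_case_cong sum.cong refl) (simp add: mult_ac)
  also have "\<dots> = - (\<Sum>(c, u, v)\<leftarrow>splits z w. \<Sum>(d, a, b, r)\<leftarrow>state_splits z ws.
         c * d * trace_state N g ((v @ u @ b @ a) # r)) / (of_nat N)\<^sup>2"
    unfolding e divide_inverse uminus_sum_list_map sum_list_mult_const[symmetric]
    by (intro sum_list_case_cong)
      (simp add: case_prod_unfold o_def uminus_sum_list_map mult_ac flip: sum_list_const_mult)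
  finally show ?thesis .
qed

lemma sum_dd_state:
  assumes g: "g \<in> GL N"
  shows "(\<Sum>X\<in>\<beta>. skew_direction.dd_state N X z g ws) =
    free_part z ws (trace_state N g) + of_real (1 / (real N)\<^sup>2) * cross_part z ws (trace_state N g)"
proof (induction ws)
  case Nil
  show ?case using skew_direction by (simp add: skew_direction.dd_state.simps)
next
  case (Cons w ws)
  let ?t = "normalized_trace N (word_mat N g w)"
  have "(\<Sum>X\<in>\<beta>. skew_direction.dd_state N X z g (w # ws)) =
      ?t * (\<Sum>X\<in>\<beta>. skew_direction.dd_state N X z g ws) +
      2 * (\<Sum>X\<in>\<beta>. skew_direction.dtrace N X z g w * skew_direction.d_state N X z g ws) +
      (\<Sum>X\<in>\<beta>. skew_direction.ddtrace N X z g w) * trace_state N g ws"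
    using skew_direction
    by (simp add: skew_direction.dd_state.simps sum.distrib sum_distrib_left sum_distrib_right mult.assoc)
  \<comment> \<open>The recursions see the rest of the state through \<open>F (w # x)\<close>. For
    \<open>trace_state\<close> this is the scalar \<open>?t\<close> times \<open>F x\<close>, and
    linearity pulls the scalar out.\<close>
  then show ?case
    unfolding Cons.IH sum_ddtrace[OF g] sum_cross[OF g] free_part.simps cross_part.simps trace_state_simps
      finite_functional_scale_arg[OF finite_functional_free_part]
      finite_functional_scale_arg[OF finite_functional_cross_part]
    by (simp add: algebra_simps)
qed

lemma heat_gen_trace_state:
  assumes g: "g \<in> GL N"
  shows "of_real (s - t / 2) * (\<Sum>X\<in>\<beta>. skew_direction.dd_state N X 1 g ws) +
      of_real (t / 2) * (\<Sum>X\<in>\<beta>. skew_direction.dd_state N X \<i> g ws) =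
    heat_gen s t (1 / (real N)\<^sup>2) (trace_state N g) ws"
  unfolding sum_dd_state[OF g] heat_gen_def ..

end

section \<open>Topology and growth\<close>

lemma topspace_GL [simp]: "topspace (GL_topology N) = GL N"
  by (simp add: GL_topology_def topspace_pullback_topology)

text \<open>Turns continuity into limits along \<open>atin\<close>, to which the
  \<open>tendsto\<close> rules for sums, products and quotients apply.\<close>

lemma continuous_map_euclidean_iff:
  "continuous_map X euclidean f \<longleftrightarrow> (\<forall>x\<in>topspace X. (f \<longlongrightarrow> f x) (atin X x))"
  by (simp add: continuous_map_atin)

lemma continuous_map_det:
  fixes A :: "'a \<Rightarrow> complex mat"
  assumes A: "\<And>x. x \<in> topspace T \<Longrightarrow> A x \<in> carrier_mat n n"
    and c: "\<And>i j. i < n \<Longrightarrow> j < n \<Longrightarrow> continuous_map T euclidean (\<lambda>x. A x $$ (i, j))"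
  shows "continuous_map T euclidean (\<lambda>x. det (A x))"
proof (rule continuous_map_eq)
  show "continuous_map T euclidean (\<lambda>x. \<Sum>p\<in>{p. p permutes {0..<n}}. signof p * (\<Prod>i = 0..<n. A x $$ (i, p i)))"
    unfolding continuous_map_euclidean_iff
  proof (intro ballI tendsto_sum tendsto_mult tendsto_prod tendsto_const)
    fix x p i assume x: "x \<in> topspace T" and p: "p \<in> {p. p permutes {0..<n}}" and i: "i \<in> {0..<n}"
    then have "p i < n" using permutes_in_image[of p "{0..<n}" i] by auto
    then show "((\<lambda>x. A x $$ (i, p i)) \<longlongrightarrow> A x $$ (i, p i)) (atin T x)"
      using c[of i "p i"] i x unfolding continuous_map_euclidean_iff by auto
  qed
qed (simp add: det_def'[OF A])

lemma continuous_map_index: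
  assumes "i < N" "j < N"
  shows "continuous_map (GL_topology N) euclidean (\<lambda>g. g $$ (i, j))"
proof (rule continuous_map_eq)
  have "continuous_map euclidean euclidean (\<lambda>a :: nat \<times> nat \<Rightarrow> complex. a (i, j))"
    by simp
  from continuous_map_pullback[OF this]
  show "continuous_map (GL_topology N) euclidean ((\<lambda>a. a (i, j)) \<circ> entries)"
    unfolding GL_topology_def .
  fix g assume "g \<in> topspace (GL_topology N)"
  then show "((\<lambda>a. a (i, j)) \<circ> entries) g = g $$ (i, j)"
    using assms GL_inv(1) by (auto simp: entries_def)
qed

lemma det_GL: "g \<in> GL N \<Longrightarrow> det g \<noteq> 0"
  using det_mult[OF GL_inv(1,2), of g N g] GL_inv(3)[of g N] by auto

text \<open>Cramer's rule; it exhibits the inverse as a rational function of the entries, hence as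
  continuous.\<close>

lemma GL_inv_index:
  assumes g: "g \<in> GL N" and ij: "i < N" "j < N"
  shows "GL_inv N g $$ (i, j) = (-1) ^ (j + i) * det (mat_delete g j i) / det g"
proof -
  note gc = GL_inv(1)[OF g]
  note adj = adj_mat[OF gc]
  have "GL_inv N g = inverse (det g) \<cdot>\<^sub>m adj_mat g"
  proof (rule GL_inv_unique[OF gc])
    show "g * (inverse (det g) \<cdot>\<^sub>m adj_mat g) = 1\<^sub>m N"
      unfolding mult_smult_distrib[OF gc adj(1)] adj(2) using det_GL[OF g] by (auto intro!: eq_matI)
    show "inverse (det g) \<cdot>\<^sub>m adj_mat g * g = 1\<^sub>m N"
      unfolding mult_smult_assoc_mat[OF adj(1) gc] adj(3) using det_GL[OF g] by (auto intro!: eq_matI)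
  qed (use adj in simp)
  then show ?thesis
    using gc ij by (simp add: adj_mat_def cofactor_def field_simps)
qed

lemma continuous_map_GL_inv_index:
  assumes ij: "i < N" "j < N"
  shows "continuous_map (GL_topology N) euclidean (\<lambda>g. GL_inv N g $$ (i, j))"
proof (rule continuous_map_eq)
  have d: "continuous_map (GL_topology N) euclidean (\<lambda>g. det g)"
    by (rule continuous_map_det[of _ _ N]) (auto intro: continuous_map_index GL_inv(1))
  have m: "continuous_map (GL_topology N) euclidean (\<lambda>g. det (mat_delete g j i))"
  proof (rule continuous_map_det[of _ _ "N - 1"])
    show "mat_delete g j i \<in> carrier_mat (N - 1) (N - 1)" if "g \<in> topspace (GL_topology N)" for g
      using that by (intro mat_delete_carrier GL_inv(1)) simp
    fix a b assume ab: "a < N - 1" "b < N - 1"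
    let ?a = "if a < j then a else Suc a" and ?b = "if b < i then b else Suc b"
    show "continuous_map (GL_topology N) euclidean (\<lambda>g. mat_delete g j i $$ (a, b))"
    proof (rule continuous_map_eq)
      show "continuous_map (GL_topology N) euclidean (\<lambda>g. g $$ (?a, ?b))"
        using ab by (intro continuous_map_index) auto
      fix g assume "g \<in> topspace (GL_topology N)"
      then have "g \<in> carrier_mat N N" using GL_inv(1) by auto
      then show "g $$ (?a, ?b) = mat_delete g j i $$ (a, b)"
        using ab by (auto simp: mat_delete_def)
    qed
  qed
  show "continuous_map (GL_topology N) euclidean (\<lambda>g. (-1) ^ (j + i) * det (mat_delete g j i) / det g)"
    using d m unfolding continuous_map_euclidean_iff
    by (auto intro!: tendsto_mult tendsto_divide simp: det_GL)
qed (simp add: GL_inv_index[OF _ ij])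

lemma continuous_map_letter_index:
  assumes ij: "i < N" "j < N"
  shows "continuous_map (GL_topology N) euclidean (\<lambda>g. letter_eval (matrix_algebra N) g l $$ (i, j))"
proof (cases "(undefined :: complex, l)" rule: letter_coeff.cases)
  case 1
  have "letter_eval (matrix_algebra N) g l = g" if "g \<in> GL N" for g
    using 1 by simp
  then show ?thesis using continuous_map_eq[OF continuous_map_index[OF ij]] by simp
next
  case 2
  then show ?thesis
    using continuous_map_eq[OF continuous_map_GL_inv_index[OF ij]] by (simp add: GL_inv_def)
next
  case 3
  have c: "continuous_map (GL_topology N) euclidean (\<lambda>g. cnj (g $$ (j, i)))"
    using continuous_map_index[OF ij(2,1)] unfolding continuous_map_euclidean_iff
    by (auto intro!: tendsto_cnj)
  show ?thesis
  proof (rule continuous_map_eq[OF c])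
    fix g assume "g \<in> topspace (GL_topology N)"
    then have g: "g \<in> GL N" by simp
    from 3 have l: "l = (Gen_star, True)" by simp
    show "cnj (g $$ (j, i)) = letter_eval (matrix_algebra N) g l $$ (i, j)"
      unfolding l letter_eval_matrix(3)[OF g] using ij GL_inv(1)[OF g] by simp
  qed
next
  case 4
  have c: "continuous_map (GL_topology N) euclidean (\<lambda>g. cnj (GL_inv N g $$ (j, i)))"
    using continuous_map_GL_inv_index[OF ij(2,1)] unfolding continuous_map_euclidean_iff
    by (auto intro!: tendsto_cnj)
  show ?thesis
  proof (rule continuous_map_eq[OF c])
    fix g assume "g \<in> topspace (GL_topology N)"
    then have g: "g \<in> GL N" by simp
    from 4 have l: "l = (Gen_star, False)" by simp
    show "cnj (GL_inv N g $$ (j, i)) = letter_eval (matrix_algebra N) g l $$ (i, j)"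
      unfolding l letter_eval_matrix(4)[OF g] using ij GL_inv(2)[OF g] by simp
  qed
qed

lemma continuous_map_word_index:
  assumes ij: "i < N" "j < N"
  shows "continuous_map (GL_topology N) euclidean (\<lambda>g. word_mat N g w $$ (i, j))"
  using ij
proof (induction w arbitrary: i)
  case (Cons l w)
  show ?case
  proof (rule continuous_map_eq)
    show "continuous_map (GL_topology N) euclidean
        (\<lambda>g. \<Sum>k<N. letter_eval (matrix_algebra N) g l $$ (i, k) * word_mat N g w $$ (k, j))"
      using Cons continuous_map_letter_index[of i N _ l] unfolding continuous_map_euclidean_iff
      by (auto intro!: tendsto_sum tendsto_mult)
    fix g assume "g \<in> topspace (GL_topology N)"
    then have g: "g \<in> GL N" by simp
    show "(\<Sum>k<N. letter_eval (matrix_algebra N) g l $$ (i, k) * word_mat N g w $$ (k, j)) =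
        word_mat N g (l # w) $$ (i, j)"
      unfolding word_mat_Cons mat_mult_index[OF letter_eval_carrier[OF g] word_mat_carrier[OF g] Cons.prems] ..
  qed
qed simp

lemma continuous_map_trace_word:
  "continuous_map (GL_topology N) euclidean (\<lambda>g. normalized_trace N (word_mat N g w))"
proof (rule continuous_map_eq)
  show "continuous_map (GL_topology N) euclidean (\<lambda>g. (\<Sum>i<N. word_mat N g w $$ (i, i)) / of_nat N)"
    using continuous_map_word_index[of _ N _ w] unfolding continuous_map_euclidean_iff divide_inverse
    by (auto intro!: tendsto_sum tendsto_mult)
  fix g assume "g \<in> topspace (GL_topology N)"
  then have "dim_row (word_mat N g w) = N" using carrier_matD(1)[OF word_mat_carrier[of g N w]] by simp
  then show "(\<Sum>i<N. word_mat N g w $$ (i, i)) / of_nat N = normalized_trace N (word_mat N g w)"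
    by (simp add: normalized_trace_def mat_trace_def)
qed

lemma continuous_map_trace_state:
  "continuous_map (GL_topology N) euclidean (\<lambda>g. trace_state N g ws)"
proof (induction ws)
  case (Cons w ws)
  then show ?case
    using continuous_map_trace_word[of N w] unfolding continuous_map_euclidean_iff
    by (auto intro!: tendsto_mult)
qed simp

text \<open>Controls \<open>g\<close> and its inverse at once, so that its sublevel sets are compact
  in the group (\<open>compact_gauge_sublevel\<close>).\<close>

definition mat_gauge :: "nat \<Rightarrow> complex mat \<Rightarrow> real" where
  "mat_gauge N g = 1 + sq_norm N g + sq_norm N (GL_inv N g)"

text \<open>Of the same order as \<open>mat_gauge N g ^ m\<close>, but a sum of three trace states,
  so the generator can be applied to it.\<close>

definition barrier :: "nat \<Rightarrow> nat \<Rightarrow> complex mat \<Rightarrow> real" where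
  "barrier N m g = 1 + sq_norm N g ^ m + sq_norm N (GL_inv N g) ^ m"

lemma mat_gauge_ge_1: "1 \<le> mat_gauge N g"
  using sq_norm_nonneg[of N g] sq_norm_nonneg[of N "GL_inv N g"] by (simp add: mat_gauge_def)

lemma barrier_ge_1: "1 \<le> barrier N m g"
  using sq_norm_nonneg[of N g] sq_norm_nonneg[of N "GL_inv N g"] by (simp add: barrier_def)

text \<open>The gauge is at most 3 times the largest of 1 and the two square norms, and the
  \<open>m\<close>-th power of that maximum is one of the three terms of the barrier.\<close>

lemma mat_gauge_power_le_barrier: "mat_gauge N g ^ m \<le> 3 ^ m * barrier N m g"
proof -
  let ?x = "sq_norm N g" and ?y = "sq_norm N (GL_inv N g)"
  let ?M = "max 1 (max ?x ?y)"
  have "mat_gauge N g \<le> 3 * ?M" unfolding mat_gauge_def by linarith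
  then have "mat_gauge N g ^ m \<le> (3 * ?M) ^ m"
    using mat_gauge_ge_1[of N g] by (intro power_mono) auto
  also have "\<dots> = 3 ^ m * ?M ^ m" by (rule power_mult_distrib)
  also have "?M ^ m \<le> barrier N m g"
    using sq_norm_nonneg[of N g] sq_norm_nonneg[of N "GL_inv N g"]
    by (auto simp: barrier_def max_def)
  finally show ?thesis by simp
qed

lemma cmod_index_le:
  assumes "N \<ge> 1" "i < N" "j < N"
  shows "cmod (A $$ (i, j)) \<le> sqrt (real N * sq_norm N A)"
proof -
  have "(cmod (A $$ (i, j)))\<^sup>2 \<le> (\<Sum>j<N. (cmod (A $$ (i, j)))\<^sup>2)"
    using assms by (intro member_le_sum[of j "{..<N}" "\<lambda>j. (cmod (A $$ (i, j)))\<^sup>2"]) auto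
  also have "\<dots> \<le> (\<Sum>i<N. \<Sum>j<N. (cmod (A $$ (i, j)))\<^sup>2)"
    using assms by (intro member_le_sum[of i "{..<N}" "\<lambda>i. \<Sum>j<N. (cmod (A $$ (i, j)))\<^sup>2"]) (auto intro: sum_nonneg)
  also have "\<dots> = real N * sq_norm N A" using assms by (simp add: sq_norm_def)
  finally show ?thesis by (intro real_le_rsqrt)
qed

lemma cmod_letter_le:
  assumes N: "N \<ge> 1" and g: "g \<in> GL N" and ij: "i < N" "j < N"
  shows "cmod (letter_eval (matrix_algebra N) g l $$ (i, j)) \<le> sqrt (real N * mat_gauge N g)"
proof -
  note gc = GL_inv(1,2)[OF g]
  have 1: "cmod (g $$ (i, j)) \<le> sqrt (real N * mat_gauge N g)" if "i < N" "j < N" for i j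
    by (rule order_trans[OF cmod_index_le[OF N that]])
      (auto simp: mat_gauge_def sq_norm_nonneg add_nonneg_nonneg intro!: mult_left_mono)
  have 2: "cmod (GL_inv N g $$ (i, j)) \<le> sqrt (real N * mat_gauge N g)" if "i < N" "j < N" for i j
    by (rule order_trans[OF cmod_index_le[OF N that]])
      (auto simp: mat_gauge_def sq_norm_nonneg add_nonneg_nonneg intro!: mult_left_mono)
  obtain x b where l: "l = (x, b)" by (cases l)
  show ?thesis unfolding l
    by (cases x; cases b; simp only: letter_eval_matrix[OF g]) (use 1 2 ij gc in auto)
qed

text \<open>\<open>N\<close> times a bound on the entries of every letter, because each
  multiplication sums \<open>N\<close> products. Its square is a multiple of the gauge
  (\<open>growth_sq\<close>), which is why even exponents are used below.\<close>

definition growth :: "nat \<Rightarrow> complex mat \<Rightarrow> real" where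
  "growth N g = real N * sqrt (real N * mat_gauge N g)"

lemma growth_ge_1: 
  assumes "N \<ge> 1"
  shows "1 \<le> growth N g"
proof -
  have "1 \<le> real N * mat_gauge N g" using mult_mono[of 1 "real N" 1 "mat_gauge N g"] assms mat_gauge_ge_1 by simp
  then show ?thesis using mult_mono[of 1 "real N" 1 "sqrt (real N * mat_gauge N g)"] assms by (simp add: growth_def)
qed

lemma growth_sq: "(growth N g)\<^sup>2 = real N ^ 3 * mat_gauge N g"
  using mat_gauge_ge_1[of N g] by (simp add: growth_def power_mult_distrib power3_eq_cube power2_eq_square)

lemma cmod_word_le:
  assumes N: "N \<ge> 1" and g: "g \<in> GL N" and ij: "i < N" "j < N"
  shows "cmod (word_mat N g w $$ (i, j)) \<le> growth N g ^ length w"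
  using ij
proof (induction w arbitrary: i)
  case (Cons l w)
  have "cmod (word_mat N g (l # w) $$ (i, j)) \<le>
      (\<Sum>k<N. cmod (letter_eval (matrix_algebra N) g l $$ (i, k) * word_mat N g w $$ (k, j)))"
    unfolding word_mat_Cons mat_mult_index[OF letter_eval_carrier[OF g] word_mat_carrier[OF g] Cons.prems]
    by (rule norm_sum)
  also have "\<dots> \<le> (\<Sum>k<N. sqrt (real N * mat_gauge N g) * growth N g ^ length w)"
    unfolding norm_mult
    using Cons mat_gauge_ge_1[of N g] by (intro sum_mono mult_mono cmod_letter_le[OF N g]) auto
  also have "\<dots> = growth N g ^ length (l # w)" by (simp add: growth_def)
  finally show ?case .
qed auto

lemma cmod_trace_state_le:
  assumes N: "N \<ge> 1" and g: "g \<in> GL N"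
  shows "cmod (trace_state N g ws) \<le> growth N g ^ total_length ws"
proof (induction ws)
  case (Cons w ws)
  have d: "dim_row (word_mat N g w) = N" using word_mat_carrier[OF g, of w] by auto
  have "cmod (\<Sum>i<N. word_mat N g w $$ (i, i)) \<le> (\<Sum>i<N. growth N g ^ length w)"
    by (rule order_trans[OF norm_sum sum_mono]) (use cmod_word_le[OF N g] in auto)
  then have "cmod (normalized_trace N (word_mat N g w)) \<le> growth N g ^ length w"
    using N by (simp add: normalized_trace_def mat_trace_def d norm_divide field_simps)
  then show ?case using Cons growth_ge_1[OF N, of g]
    by (simp add: norm_mult power_add mult_mono)
qed simp

lemma growth_even_le_barrier:
  assumes "N \<ge> 1"
  shows "growth N g ^ (2 * m) \<le> (3 * real N ^ 3) ^ m * barrier N m g"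
proof -
  have "growth N g ^ (2 * m) = (real N ^ 3) ^ m * mat_gauge N g ^ m"
    by (simp add: power_mult growth_sq power_mult_distrib)
  also have "\<dots> \<le> (real N ^ 3) ^ m * (3 ^ m * barrier N m g)"
    by (intro mult_left_mono mat_gauge_power_le_barrier) auto
  finally show ?thesis by (simp add: power_mult_distrib mult_ac)
qed

definition barrier_states :: "nat \<Rightarrow> word list list" where
  "barrier_states m = [[], replicate m [(Gen, True), (Gen_star, True)],
     replicate m [(Gen, False), (Gen_star, False)]]"

lemma barrier_trace_state:
  assumes g: "g \<in> GL N"
  shows "(\<Sum>ws\<leftarrow>barrier_states m. trace_state N g ws) = of_real (barrier N m g)"
proof -
  note gc = GL_inv(1,2)[OF g]
  have r: "trace_state N g (replicate m w) = normalized_trace N (word_mat N g w) ^ m" for w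
    by (induction m) auto
  have 1: "word_mat N g [(Gen, True), (Gen_star, True)] = g * mat_adjoint g"
    using gc by (simp add: letter_eval_matrix[OF g] del: letter_eval.simps)
  have 2: "word_mat N g [(Gen, False), (Gen_star, False)] = GL_inv N g * mat_adjoint (GL_inv N g)"
    using gc by (simp add: letter_eval_matrix[OF g] del: letter_eval.simps)
  show ?thesis
    by (simp add: barrier_states_def barrier_def r 1 2 trace_adjoint_mult gc del: word_mat_Cons)
qed

lemma total_length_barrier_states: 
  "ws \<in> set (barrier_states m) \<Longrightarrow> total_length ws = 0 \<or> total_length ws = 2 * m"
  by (auto simp: barrier_states_def total_length_def sum_list_replicate)

section \<open>Compact sublevel sets of the gauge\<close>

lemma compactin_pullback:
  assumes K: "K \<subseteq> A" and c: "compactin T (f ` K)"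
  shows "compactin (pullback_topology A f T) K"
  unfolding compactin_def
proof (intro conjI allI impI)
  show "K \<subseteq> topspace (pullback_topology A f T)"
    using K compactin_subset_topspace[OF c] by (auto simp: topspace_pullback_topology)
  fix \<U> assume "Ball \<U> (openin (pullback_topology A f T)) \<and> K \<subseteq> \<Union> \<U>"
  then have o: "\<And>U. U \<in> \<U> \<Longrightarrow> \<exists>V. openin T V \<and> U = f -` V \<inter> A" and cov: "K \<subseteq> \<Union> \<U>"
    by (auto simp: openin_pullback_topology)
  from o obtain V where V: "\<And>U. U \<in> \<U> \<Longrightarrow> openin T (V U) \<and> U = f -` V U \<inter> A" by metis
  have 1: "f ` K \<subseteq> \<Union> (V ` \<U>)"
  proof
    fix y assume "y \<in> f ` K"
    then obtain x where x: "x \<in> K" "y = f x" by blast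
    then obtain U where U: "U \<in> \<U>" "x \<in> U" using cov by blast
    then show "y \<in> \<Union> (V ` \<U>)" using V[OF U(1)] x by blast
  qed
  have 2: "\<forall>U\<in>V ` \<U>. openin T U" using V by blast
  from c[unfolded compactin_def] 1 2
  obtain \<F> where "finite \<F>" "\<F> \<subseteq> V ` \<U>" and F: "f ` K \<subseteq> \<Union> \<F>"
    by meson
  then obtain \<G> where G: "finite \<G>" "\<G> \<subseteq> \<U>" "\<F> = V ` \<G>"
    by (meson finite_subset_image)
  have "K \<subseteq> \<Union> \<G>"
  proof
    fix x assume "x \<in> K"
    then obtain U where "U \<in> \<G>" "f x \<in> V U" "x \<in> A" using F G K by blast
    then show "x \<in> \<Union> \<G>" using V[of U] G(2) by blast
  qed
  with G show "\<exists>\<F>. finite \<F> \<and> \<F> \<subseteq> \<U> \<and> K \<subseteq> \<Union> \<F>" by blast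
qed

text \<open>Taking the inverse as a second coordinate turns invertibility into the closed polynomial
  equations \<open>g h = h g = 1\<close>. The sublevel set is then a projection of a compact set of
  pairs.\<close>

lemma compact_gauge_sublevel:
  assumes N: "N \<ge> 1"
  shows "compactin (GL_topology N) {g \<in> GL N. mat_gauge N g \<le> R}"
  unfolding GL_topology_def
proof (rule compactin_pullback)
  let ?r = "sqrt (real N * R)"
  \<comment> \<open>Entries outside the \<open>N\<close> by \<open>N\<close> block are pinned to 0,
    so the product of these sets over all index pairs is compact by Tychonoff's theorem.\<close>
  let ?D = "\<lambda>(i, j). if i < N \<and> j < N then cball 0 ?r else {0 :: complex}"
  define S where "S = (\<Pi>\<^sub>E p\<in>UNIV. ?D p)"
  have S: "compact S"
  proof -
    have "compactin (product_topology (\<lambda>_. euclidean) UNIV) S"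
      unfolding S_def compactin_PiE by (auto split: prod.splits)
    then show ?thesis by (simp add: euclidean_product_topology)
  qed
  have c: "continuous_on UNIV (\<lambda>p :: (nat \<times> nat \<Rightarrow> complex) \<times> (nat \<times> nat \<Rightarrow> complex). fst p q)"
    "continuous_on UNIV (\<lambda>p :: (nat \<times> nat \<Rightarrow> complex) \<times> (nat \<times> nat \<Rightarrow> complex). snd p q)" for q
    using continuous_on_compose[OF continuous_on_fst[OF continuous_on_id] continuous_on_subset[OF continuous_on_product_coordinates], of UNIV q]
      continuous_on_compose[OF continuous_on_snd[OF continuous_on_id] continuous_on_subset[OF continuous_on_product_coordinates], of UNIV q]
    by (simp_all add: o_def)
  let ?q = "\<lambda>a :: nat \<times> nat \<Rightarrow> complex. (\<Sum>i<N. \<Sum>j<N. (cmod (a (i, j)))\<^sup>2) / real N"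
  define C where "C = {p. 1 + ?q (fst p) + ?q (snd p) \<le> R} \<inter>
    (\<Inter>i\<in>{..<N}. \<Inter>k\<in>{..<N}. {p. (\<Sum>j<N. fst p (i, j) * snd p (j, k)) = (if i = k then 1 else 0)} \<inter>
       {p. (\<Sum>j<N. snd p (i, j) * fst p (j, k)) = (if i = k then 1 else 0)})"
  have "closed C"
    unfolding C_def using N
    by (intro closed_Int closed_INT ballI closed_Collect_le closed_Collect_eq continuous_intros c) auto
  then have "compact (C \<inter> (S \<times> S))"
    using compact_Times[OF S S] by (intro closed_Int_compact)
  then have "compact (fst ` (C \<inter> (S \<times> S)))"
    by (intro compact_continuous_image continuous_on_fst continuous_on_id)
  moreover have "entries ` {g \<in> GL N. mat_gauge N g \<le> R} = fst ` (C \<inter> (S \<times> S))"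
  proof (intro equalityI subsetI)
    fix a assume "a \<in> entries ` {g \<in> GL N. mat_gauge N g \<le> R}"
    then obtain g where g: "g \<in> GL N" and R: "mat_gauge N g \<le> R" and a: "a = entries g" by auto
    note gi = GL_inv[OF g]
    let ?b = "entries (GL_inv N g)"
    have e: "entries A (i, j) = A $$ (i, j)" if "A \<in> carrier_mat N N" "i < N" "j < N" for A i j
      using that by (auto simp: entries_def)
    have S: "entries A \<in> S" if A: "A \<in> carrier_mat N N" and le: "sq_norm N A \<le> R" for A
    proof -
      have "cmod (A $$ (i, j)) \<le> ?r" if "i < N" "j < N" for i j
        by (rule order_trans[OF cmod_index_le[OF N that]]) (use le in \<open>auto intro!: mult_left_mono\<close>)
      then show ?thesis using A by (auto simp: S_def entries_def)
    qed
    have "entries g \<in> S" "?b \<in> S"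
      using R sq_norm_nonneg[of N g] sq_norm_nonneg[of N "GL_inv N g"]
      by (auto intro!: S gi simp: mat_gauge_def)
    moreover have "(entries g, ?b) \<in> C"
    proof -
      have "1 + ?q (entries g) + ?q ?b \<le> R"
        using R gi by (simp add: mat_gauge_def sq_norm_def e)
      moreover have "(\<Sum>j<N. g $$ (i, j) * GL_inv N g $$ (j, k)) = (if i = k then 1 else 0)"
        "(\<Sum>j<N. GL_inv N g $$ (i, j) * g $$ (j, k)) = (if i = k then 1 else 0)" if "i < N" "k < N" for i k
        using mat_mult_index[OF gi(1,2) that] mat_mult_index[OF gi(2,1) that] that unfolding gi(3,4) by auto
      ultimately show ?thesis using gi by (simp add: C_def e)
    qed
    ultimately show "a \<in> fst ` (C \<inter> (S \<times> S))" unfolding a by force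
  next
    fix a assume "a \<in> fst ` (C \<inter> (S \<times> S))"
    then obtain b where C: "(a, b) \<in> C" and S: "a \<in> S" "b \<in> S" by auto
    define g where "g = Matrix.mat N N a"
    define h where "h = Matrix.mat N N b"
    have gh: "g \<in> carrier_mat N N" "h \<in> carrier_mat N N" by (auto simp: g_def h_def)
    have "g * h = 1\<^sub>m N" "h * g = 1\<^sub>m N"
      using C by (auto intro!: eq_matI simp: C_def g_def h_def scalar_prod_def lessThan_atLeast0)
    then have g: "g \<in> GL N" "GL_inv N g = h" using GL_I[OF gh] GL_inv_unique[OF gh] by auto
    have "mat_gauge N g \<le> R" using C unfolding mat_gauge_def g(2) by (simp add: C_def sq_norm_def g_def h_def)
    moreover have "entries g = a"
    proof
      fix p :: "nat \<times> nat"
      obtain i j where p: "p = (i, j)" by (cases p)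
      have "a p \<in> ?D p" using S(1) by (auto simp: S_def PiE_iff)
      then show "entries g p = a p" by (auto simp: p entries_def g_def split: if_splits)
    qed
    ultimately show "a \<in> entries ` {g \<in> GL N. mat_gauge N g \<le> R}" using g by blast
  qed
  ultimately show "compactin euclidean (entries ` {g \<in> GL N. mat_gauge N g \<le> R})" by simp
qed auto

lemma continuous_map_gauge: "continuous_map (GL_topology N) euclidean (mat_gauge N)"
proof -
  have "continuous_map (GL_topology N) euclidean (\<lambda>g. cmod (g $$ (i, j)))"
    "continuous_map (GL_topology N) euclidean (\<lambda>g. cmod (GL_inv N g $$ (i, j)))" if "i < N" "j < N" for i j
    using continuous_map_index[OF that] continuous_map_GL_inv_index[OF that]
    unfolding continuous_map_euclidean_iff by (auto intro!: tendsto_norm)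
  then show ?thesis
    unfolding continuous_map_euclidean_iff mat_gauge_def sq_norm_def divide_inverse
    by (intro ballI tendsto_add tendsto_const tendsto_mult tendsto_sum tendsto_power) auto
qed

section \<open>The maximum principle\<close>

text \<open>If \<open>c < 0\<close> at the critical point 0, the first derivative is negative just
  to the right of it and the function drops below its minimum.\<close>

lemma second_derivative_at_min:
  fixes \<phi> \<phi>' :: "real \<Rightarrow> real"
  assumes d: "\<And>x. (\<phi> has_real_derivative \<phi>' x) (at x)"
    and dd: "(\<phi>' has_real_derivative c) (at 0)" and min: "\<And>x. \<phi> 0 \<le> \<phi> x"
  shows "0 \<le> c"
proof (rule ccontr)
  assume "\<not> 0 \<le> c"
  then have c: "c < 0" by simp
  have "\<forall>y. \<bar>0 - y\<bar> < 1 \<longrightarrow> \<phi> 0 \<le> \<phi> y" using min by simp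
  then have "\<phi>' 0 = 0" by (rule DERIV_local_min[OF d, rotated]) simp
  moreover obtain e where e: "0 < e" "\<And>h. 0 < h \<Longrightarrow> h < e \<Longrightarrow> \<phi>' (0 + h) < \<phi>' 0"
    using DERIV_neg_dec_right[OF dd c] by blast
  ultimately have neg: "\<phi>' x < 0" if "0 < x" "x < e" for x using that e(2)[of x] by simp
  have "\<phi> (e / 2) < \<phi> 0"
  proof (rule DERIV_neg_imp_decreasing_open[where f = \<phi> and a = 0 and b = "e / 2"])
    fix x assume "0 < x" "x < e / 2"
    then have "(\<phi> has_real_derivative \<phi>' x) (at x) \<and> \<phi>' x < 0" using d[of x] neg[of x] by simp
    then show "\<exists>y. (\<phi> has_real_derivative y) (at x) \<and> y < 0" by blast
  next
    show "continuous_on {0..e / 2} \<phi>"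
      by (rule continuous_at_imp_continuous_on) (use d DERIV_isCont in blast)
  qed (use e in auto)
  with min[of "e / 2"] show False by simp
qed

text \<open>Near parameter \<open>y\<close> the flow is the flow started at the point reached at
  \<open>y\<close>, so derivatives at 0 on the whole group suffice.\<close>

lemma flow_has_vector_derivative:
  assumes g: "g \<in> GL N" and \<xi>: "\<xi> \<in> carrier_mat N N"
    and f: "\<And>g. g \<in> GL N \<Longrightarrow> ((\<lambda>x. f (flow \<xi> g x)) has_vector_derivative f' g) (at 0)"
  shows "((\<lambda>x. f (flow \<xi> g x)) has_vector_derivative f' (flow \<xi> g y)) (at y)"
proof -
  have s: "((\<lambda>x. x - y) has_vector_derivative (1 :: real)) (at y)"
    using has_vector_derivative_diff[OF has_vector_derivative_id[of "at y"] has_vector_derivative_const[of y "at y"]] by simp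
  have "((\<lambda>x. f (flow \<xi> (flow \<xi> g y) x)) has_vector_derivative f' (flow \<xi> g y)) (at (y - y))"
    using f[OF flow_GL(1)[OF g \<xi>, of y]] by simp
  from vector_diff_chain_at[OF s this]
  show ?thesis by (simp add: o_def flow_add[OF GL_inv(1)[OF g] \<xi>])
qed

lemma Re_has_real_derivative:
  "(f has_vector_derivative c) (at x) \<Longrightarrow> ((\<lambda>x. Re (f x)) has_real_derivative Re c) (at x)"
  unfolding has_real_derivative_iff_has_vector_derivative
  by (rule bounded_linear.has_vector_derivative[OF bounded_linear_Re])

text \<open>Like \<open>finite_functional\<close>, but without a common total length: the barrier
  mixes the empty state with states of length \<open>2 m\<close>.\<close>

definition list_functional :: "((word list \<Rightarrow> complex) \<Rightarrow> complex) \<Rightarrow> bool" where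
  "list_functional \<Lambda> \<longleftrightarrow> (\<exists>L. \<forall>F. \<Lambda> F = (\<Sum>(c, x)\<leftarrow>L. c * F x))"

lemma list_functionalE:
  assumes "list_functional \<Lambda>"
  obtains L where "\<And>F. \<Lambda> F = (\<Sum>p\<leftarrow>L. fst p * F (snd p))"
  using assms unfolding list_functional_def case_prod_unfold by blast

lemma finite_functional_imp_list: "finite_functional n \<Lambda> \<Longrightarrow> list_functional \<Lambda>"
  unfolding finite_functional_def list_functional_def by blast

lemma list_functional_sum_list: "list_functional (\<lambda>F. \<Sum>x\<leftarrow>xs. F x)"
proof -
  have "(\<Sum>x\<leftarrow>xs. F x) = (\<Sum>(c, x)\<leftarrow>map (\<lambda>x. (1, x)) xs. c * F x)" for F :: "word list \<Rightarrow> complex"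
    by (induction xs) auto
  then show ?thesis unfolding list_functional_def by blast
qed

lemma continuous_map_list_functional:
  assumes "list_functional \<Lambda>"
  shows "continuous_map (GL_topology N) euclidean (\<lambda>g. \<Lambda> (trace_state N g))"
proof -
  obtain L where L: "\<And>F. \<Lambda> F = (\<Sum>p\<leftarrow>L. fst p * F (snd p))" using list_functionalE[OF assms] by blast
  show ?thesis unfolding L
  proof (induction L)
    case (Cons p L)
    then show ?case
      using continuous_map_trace_state[of N "snd p"] unfolding continuous_map_euclidean_iff
      by (auto intro!: tendsto_add tendsto_mult)
  qed simp
qed

lemma (in skew_direction) list_functional_deriv:
  assumes "list_functional \<Lambda>" and g: "g \<in> GL N"
  shows "((\<lambda>u. \<Lambda> (trace_state N (flow (z \<cdot>\<^sub>m X) g u))) has_vector_derivative \<Lambda> (d_state z g)) (at 0)"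
    and "((\<lambda>u. \<Lambda> (d_state z (flow (z \<cdot>\<^sub>m X) g u))) has_vector_derivative \<Lambda> (dd_state z g)) (at 0)"
proof -
  obtain L where L: "\<And>F. \<Lambda> F = (\<Sum>p\<leftarrow>L. fst p * F (snd p))" using list_functionalE[OF assms(1)] by blast
  show "((\<lambda>u. \<Lambda> (trace_state N (flow (z \<cdot>\<^sub>m X) g u))) has_vector_derivative \<Lambda> (d_state z g)) (at 0)"
    unfolding L
    by (intro has_vector_derivative_sum_list has_vector_derivative_mult_right trace_state_deriv g)
  show "((\<lambda>u. \<Lambda> (d_state z (flow (z \<cdot>\<^sub>m X) g u))) has_vector_derivative \<Lambda> (dd_state z g)) (at 0)"
    unfolding L
    by (intro has_vector_derivative_sum_list has_vector_derivative_mult_right d_state_deriv g)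
qed

lemma list_functional_lincomb:
  assumes "list_functional \<Lambda>"
  shows "\<Lambda> (\<lambda>x. a * (\<Sum>i\<in>I. F i x) + b * (\<Sum>i\<in>I. F' i x)) =
    a * (\<Sum>i\<in>I. \<Lambda> (F i)) + b * (\<Sum>i\<in>I. \<Lambda> (F' i))"
proof -
  obtain L where L: "\<And>F. \<Lambda> F = (\<Sum>p\<leftarrow>L. fst p * F (snd p))" using list_functionalE[OF assms] by blast
  show ?thesis unfolding L
    by (induction L) (simp_all add: algebra_simps sum.distrib sum_distrib_left)
qed

context u_basis
begin

lemma heat_gen_list_functional:
  assumes \<Lambda>: "list_functional \<Lambda>" and g: "g \<in> GL N"
  shows "\<Lambda> (heat_gen s t (1 / (real N)\<^sup>2) (trace_state N g)) =
    of_real (s - t / 2) * (\<Sum>X\<in>\<beta>. \<Lambda> (skew_direction.dd_state N X 1 g)) +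
    of_real (t / 2) * (\<Sum>X\<in>\<beta>. \<Lambda> (skew_direction.dd_state N X \<i> g))"
  unfolding list_functional_lincomb[OF \<Lambda>, symmetric] heat_gen_trace_state[OF g] ..

text \<open>The parabolic maximum principle.  At a negative space-time minimum of the difference
  \<open>v - Re u\<close> the time derivative is nonpositive and all second derivatives are nonnegative,
  against the strict inequality satisfied by \<open>v\<close>.\<close>

lemma comparison_principle:
  fixes a :: "'j \<Rightarrow> real \<Rightarrow> complex"
  assumes hf: "heat_flow N \<beta> s t f u" and st: "0 \<le> t" "t / 2 \<le> s"
    and J: "finite J" and \<Lambda>: "\<And>j. j \<in> J \<Longrightarrow> list_functional (\<Lambda> j)"
    and a: "\<And>j r. j \<in> J \<Longrightarrow> (a j has_vector_derivative a' j r) (at r)"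
    and v: "\<And>r g. v r g = Re (\<Sum>j\<in>J. a j r * \<Lambda> j (trace_state N g))"
    and strict: "\<And>r g. 0 < r \<Longrightarrow> r \<le> 1 \<Longrightarrow> g \<in> GL N \<Longrightarrow>
      Re (\<Sum>j\<in>J. a j r * \<Lambda> j (heat_gen s t (1 / (real N)\<^sup>2) (trace_state N g))) / 2
        < Re (\<Sum>j\<in>J. a' j r * \<Lambda> j (trace_state N g))"
    and init: "\<And>g. g \<in> GL N \<Longrightarrow> Re (f g) \<le> v 0 g"
    and coercive: "\<And>K. \<exists>R. \<forall>r\<in>{0..1}. \<forall>g\<in>GL N. R < mat_gauge N g \<longrightarrow> K \<le> v r g"
    and r0: "0 \<le> r0" "r0 \<le> 1" and g0: "g0 \<in> GL N"
  shows "Re (u r0 g0) \<le> v r0 g0"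
proof (rule ccontr)
  assume neg: "\<not> Re (u r0 g0) \<le> v r0 g0"
  let ?T = "prod_topology (top_of_set {0::real..}) (GL_topology N)"
  let ?w = "\<lambda>r g. v r g - Re (u r g)"
  from hf obtain K where K: "\<And>r g. 0 \<le> r \<Longrightarrow> g \<in> GL N \<Longrightarrow> cmod (u r g) \<le> K"
    and cont_u: "continuous_map ?T euclidean (\<lambda>(r, g). u r g)"
    and u0: "\<And>g. g \<in> GL N \<Longrightarrow> u 0 g = f g"
    and smooth: "\<And>r. 0 < r \<Longrightarrow> smooth_GL N (u r)"
    and pde: "\<And>r g. 0 < r \<Longrightarrow> g \<in> GL N \<Longrightarrow>
      ((\<lambda>r. u r g) has_vector_derivative (1 / 2) * A_op \<beta> s t (u r) g) (at r)"
    unfolding heat_flow_def by blast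
  \<comment> \<open>Beyond gauge \<open>R\<close> the function \<open>v\<close> is at least the
    bound \<open>K\<close> of the solution, so a negative value of the difference occurs only in a
    compact set.\<close>
  obtain R where R: "\<And>r g. 0 \<le> r \<Longrightarrow> r \<le> 1 \<Longrightarrow> g \<in> GL N \<Longrightarrow> R < mat_gauge N g \<Longrightarrow> K \<le> v r g"
    using coercive[of K] by (auto simp: Ball_def)
  \<comment> \<open>The maximum with the gauge of \<open>g0\<close> keeps the point
    \<open>(r0, g0)\<close>, where the difference is negative, in \<open>S\<close>.\<close>
  define S where "S = {0..1::real} \<times> {g \<in> GL N. mat_gauge N g \<le> max R (mat_gauge N g0)}"
  have cont_w: "continuous_map ?T euclidean (\<lambda>p. ?w (fst p) (snd p))"
  proof -
    have 1: "continuous_map ?T euclidean (\<lambda>p. a j (fst p))" if j: "j \<in> J" for j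
    proof -
      have "continuous_on {0..} (a j)"
        by (rule continuous_at_imp_continuous_on) (use has_vector_derivative_continuous a[OF j] in blast)
      then have "continuous_map (top_of_set {0..}) euclidean (a j)" by simp
      from continuous_map_compose[OF continuous_map_fst this] show ?thesis by (simp add: o_def)
    qed
    have 2: "continuous_map ?T euclidean (\<lambda>p. \<Lambda> j (trace_state N (snd p)))" if j: "j \<in> J" for j
      using continuous_map_compose[OF continuous_map_snd continuous_map_list_functional[OF \<Lambda>[OF j]]]
      by (simp add: o_def)
    show ?thesis
      using 1 2 cont_u unfolding v continuous_map_euclidean_iff case_prod_unfold
      by (intro ballI tendsto_diff tendsto_Re tendsto_sum tendsto_mult) auto
  qed
  have "compactin ?T S"
    unfolding S_def compactin_Times
    using compact_gauge_sublevel[OF N] by (auto simp: compactin_subtopology)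
  from image_compactin[OF this cont_w] have "compact ((\<lambda>p. ?w (fst p) (snd p)) ` S)" by simp
  moreover have p0: "(r0, g0) \<in> S" using r0 g0 by (simp add: S_def)
  ultimately obtain p1 where p1: "p1 \<in> S" "\<And>p. p \<in> S \<Longrightarrow> ?w (fst p1) (snd p1) \<le> ?w (fst p) (snd p)"
    using compact_attains_inf[of "(\<lambda>p. ?w (fst p) (snd p)) ` S"] by (metis (no_types, lifting) empty_iff image_iff)
  define r1 where "r1 = fst p1"
  define g1 where "g1 = snd p1"
  have r1: "0 \<le> r1" "r1 \<le> 1" and g1: "g1 \<in> GL N"
    using p1(1) by (auto simp: S_def r1_def g1_def)
  have w1: "?w r1 g1 < 0" using p1(2)[OF p0] neg by (simp add: r1_def g1_def)
  have min: "?w r1 g1 \<le> ?w r g" if "0 \<le> r" "r \<le> 1" "g \<in> GL N" for r g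
  proof (cases "mat_gauge N g \<le> max R (mat_gauge N g0)")
    case True
    then have "(r, g) \<in> S" using that by (simp add: S_def)
    from p1(2)[OF this] show ?thesis by (simp add: r1_def g1_def)
  next
    case False
    then have "K \<le> v r g" using R that by simp
    moreover have "Re (u r g) \<le> K"
      using K[of r g] complex_Re_le_cmod[of "u r g"] that by linarith
    ultimately show ?thesis using w1 by linarith
  qed
  have "r1 \<noteq> 0" using w1 init[OF g1] u0[OF g1] by auto
  with r1 have r1': "0 < r1" by simp
  let ?vt = "Re (\<Sum>j\<in>J. a' j r1 * \<Lambda> j (trace_state N g1))"
  have "((\<lambda>r. \<Sum>j\<in>J. a j r * \<Lambda> j (trace_state N g1)) has_vector_derivative
      (\<Sum>j\<in>J. a' j r1 * \<Lambda> j (trace_state N g1))) (at r1)"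
    by (intro has_vector_derivative_sum has_vector_derivative_mult_left a)
  from DERIV_diff[OF Re_has_real_derivative[OF this] Re_has_real_derivative[OF pde[OF r1' g1]]]
  have dt: "((\<lambda>r. ?w r g1) has_real_derivative ?vt - Re (1 / 2 * A_op \<beta> s t (u r1) g1)) (at r1)"
    by (simp add: v)
  \<comment> \<open>The minimum may be attained at the final time 1, so only earlier times are
    compared: a positive derivative would give a smaller value just before
    \<open>r1\<close>.\<close>
  have "?vt - Re (1 / 2 * A_op \<beta> s t (u r1) g1) \<le> 0"
  proof (rule ccontr)
    assume "\<not> ?vt - Re (1 / 2 * A_op \<beta> s t (u r1) g1) \<le> 0"
    then obtain e where e: "0 < e" "\<And>h. 0 < h \<Longrightarrow> h < e \<Longrightarrow> ?w (r1 - h) g1 < ?w r1 g1"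
      using DERIV_pos_inc_left[OF dt] by (auto simp: not_le)
    define h where "h = min (e / 2) r1"
    have "0 < h" "h < e" "h \<le> r1" using e r1' by (auto simp: h_def)
    then show False using e(2)[of h] min[of "r1 - h" g1] r1 g1 by simp
  qed
  then have time: "?vt \<le> Re (A_op \<beta> s t (u r1) g1) / 2" by simp
  \<comment> \<open>A one-parameter flow through \<open>g1\<close> stays in the group, so along it
    the difference has a minimum at parameter 0.\<close>
  have space: "Re (left_inv_deriv (z \<cdot>\<^sub>m X) (left_inv_deriv (z \<cdot>\<^sub>m X) (u r1)) g1) \<le>
      Re (\<Sum>j\<in>J. a j r1 * \<Lambda> j (skew_direction.dd_state N X z g1))" if X: "X \<in> \<beta>" for X z
  proof -
    interpret skew_direction N X by (rule skew_direction[OF X])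
    let ?\<xi> = "z \<cdot>\<^sub>m X"
    have \<xi>: "?\<xi> \<in> carrier_mat N N" using X by simp
    let ?D = "left_inv_deriv ?\<xi>"
    have sm: "(\<lambda>x. foldr left_inv_deriv \<xi>s (u r1) (flow ?\<xi> g x)) differentiable (at 0)"
      if "set \<xi>s \<subseteq> carrier_mat N N" "g \<in> GL N" for \<xi>s g
      using smooth[OF r1'] \<xi> that unfolding smooth_GL_def by blast
    have u1: "((\<lambda>x. u r1 (flow ?\<xi> g x)) has_vector_derivative ?D (u r1) g) (at 0)" if "g \<in> GL N" for g
      using sm[of "[]" g] that unfolding left_inv_deriv_def by (simp add: vector_derivative_works)
    have u2: "((\<lambda>x. ?D (u r1) (flow ?\<xi> g x)) has_vector_derivative ?D (?D (u r1)) g) (at 0)" if "g \<in> GL N" for g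
      using sm[of "[?\<xi>]" g] \<xi> that unfolding left_inv_deriv_def[of _ "?D (u r1)"] by (simp add: vector_derivative_works)
    let ?V = "\<lambda>F. \<Sum>j\<in>J. a j r1 * \<Lambda> j F"
    have v1: "((\<lambda>x. ?V (trace_state N (flow ?\<xi> g x))) has_vector_derivative ?V (d_state z g)) (at 0)"
      if "g \<in> GL N" for g
      by (intro has_vector_derivative_sum has_vector_derivative_mult_right list_functional_deriv \<Lambda> that)
    have v2: "((\<lambda>x. ?V (d_state z (flow ?\<xi> g x))) has_vector_derivative ?V (dd_state z g)) (at 0)"
      if "g \<in> GL N" for g
      by (intro has_vector_derivative_sum has_vector_derivative_mult_right list_functional_deriv \<Lambda> that)
    have "0 \<le> Re (?V (dd_state z g1)) - Re (?D (?D (u r1)) g1)"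
    proof (rule second_derivative_at_min)
      show "((\<lambda>x. ?w r1 (flow ?\<xi> g1 x)) has_real_derivative
          Re (?V (d_state z (flow ?\<xi> g1 x))) - Re (?D (u r1) (flow ?\<xi> g1 x))) (at x)" for x
        unfolding v
        by (intro DERIV_diff Re_has_real_derivative)
          (rule flow_has_vector_derivative[where f' = "\<lambda>g. ?V (d_state z g)", OF g1 \<xi> v1] flow_has_vector_derivative[OF g1 \<xi> u1]; assumption)+
      show "((\<lambda>x. Re (?V (d_state z (flow ?\<xi> g1 x))) - Re (?D (u r1) (flow ?\<xi> g1 x))) has_real_derivative
          Re (?V (dd_state z g1)) - Re (?D (?D (u r1)) g1)) (at 0)"
        by (intro DERIV_diff Re_has_real_derivative v2 u2 g1)
      show "?w r1 (flow ?\<xi> g1 0) \<le> ?w r1 (flow ?\<xi> g1 x)" for x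
        using min[OF r1 flow_GL(1)[OF g1 \<xi>, of x]] flow_zero[OF GL_inv(1)[OF g1] \<xi>] by simp
    qed
    then show ?thesis by simp
  qed
  have X1: "X = 1 \<cdot>\<^sub>m X" if "X \<in> \<beta>" for X using basis_carrier[OF that] by (auto intro!: eq_matI)
  have "Re (A_op \<beta> s t (u r1) g1) =
      (s - t / 2) * (\<Sum>X\<in>\<beta>. Re (left_inv_deriv X (left_inv_deriv X (u r1)) g1)) +
      (t / 2) * (\<Sum>X\<in>\<beta>. Re (left_inv_deriv (\<i> \<cdot>\<^sub>m X) (left_inv_deriv (\<i> \<cdot>\<^sub>m X) (u r1)) g1))"
    by (simp add: A_op_def)
  also have "\<dots> \<le> (s - t / 2) * (\<Sum>X\<in>\<beta>. Re (\<Sum>j\<in>J. a j r1 * \<Lambda> j (skew_direction.dd_state N X 1 g1))) +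
      (t / 2) * (\<Sum>X\<in>\<beta>. Re (\<Sum>j\<in>J. a j r1 * \<Lambda> j (skew_direction.dd_state N X \<i> g1)))"
  proof (intro add_mono mult_left_mono sum_mono)
    fix X assume X: "X \<in> \<beta>"
    show "Re (left_inv_deriv X (left_inv_deriv X (u r1)) g1)
        \<le> Re (\<Sum>j\<in>J. a j r1 * \<Lambda> j (skew_direction.dd_state N X 1 g1))"
      using space[OF X, of 1] X1[OF X] by simp
  qed (use space st in auto)
  also have "\<dots> = Re (\<Sum>j\<in>J. a j r1 * \<Lambda> j (heat_gen s t (1 / (real N)\<^sup>2) (trace_state N g1)))"
  proof -
    have "(\<Sum>j\<in>J. a j r1 * \<Lambda> j (heat_gen s t (1 / (real N)\<^sup>2) (trace_state N g1))) =
      (\<Sum>j\<in>J. of_real (s - t / 2) * (\<Sum>X\<in>\<beta>. a j r1 * \<Lambda> j (skew_direction.dd_state N X 1 g1)) +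
        of_real (t / 2) * (\<Sum>X\<in>\<beta>. a j r1 * \<Lambda> j (skew_direction.dd_state N X \<i> g1)))"
      by (intro sum.cong refl)
        (simp add: heat_gen_list_functional[OF \<Lambda> g1] distrib_left sum_distrib_left mult_ac)
    also have "\<dots> = of_real (s - t / 2) * (\<Sum>X\<in>\<beta>. \<Sum>j\<in>J. a j r1 * \<Lambda> j (skew_direction.dd_state N X 1 g1)) +
        of_real (t / 2) * (\<Sum>X\<in>\<beta>. \<Sum>j\<in>J. a j r1 * \<Lambda> j (skew_direction.dd_state N X \<i> g1))"
      unfolding sum.distrib sum_distrib_left[symmetric] by (subst (1 2) sum.swap) (simp add: sum_distrib_left)
    finally show ?thesis by simp
  qed
  also have "\<dots> < 2 * ?vt" using strict[OF r1' r1(2) g1] by simp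
  \<comment> \<open>The chain puts \<open>Re (A_op \<beta> s t (u r1) g1)\<close> strictly below
    \<open>2 * ?vt\<close>; \<open>time\<close> says the opposite.\<close>
  finally show False using time by simp
qed

end

section \<open>Comparison with Taylor polynomials\<close>

lemma trace_state_one:
  assumes "N \<ge> 1"
  shows "trace_state N (1\<^sub>m N) ws = 1"
proof -
  have inv: "GL_inv N (1\<^sub>m N) = 1\<^sub>m N" by (rule GL_inv_unique) auto
  have adj: "mat_adjoint (1\<^sub>m N) = (1\<^sub>m N :: complex mat)" by (auto intro!: eq_matI)
  have l: "letter_eval (matrix_algebra N) (1\<^sub>m N) l = 1\<^sub>m N" for l
    by (cases l, cases "fst l"; cases "snd l")
      (simp_all only: letter_eval_matrix[OF one_in_GL] inv adj fst_conv snd_conv)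
  have w: "word_mat N (1\<^sub>m N) w = 1\<^sub>m N" for w by (induction w) (simp_all add: l)
  have "normalized_trace N (1\<^sub>m N) = 1" using assms by (simp add: normalized_trace_def mat_trace_def)
  then show ?thesis by (induction ws) (simp_all add: w)
qed

lemma barrier_one: "N \<ge> 1 \<Longrightarrow> barrier N m (1\<^sub>m N) = 3"
  using barrier_trace_state[OF one_in_GL, of N m] 
  by (simp add: trace_state_one barrier_states_def flip: of_real_eq_iff[where 'a = complex])

definition heat_partial :: "real \<Rightarrow> real \<Rightarrow> real \<Rightarrow> nat \<Rightarrow> word list \<Rightarrow> complex" where
  "heat_partial s t \<kappa> K ws = (\<Sum>k\<le>K. (heat_gen s t \<kappa> ^^ k) (\<lambda>_. 1) ws / (2 ^ k * fact k))"

lemma heat_partial_tendsto: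
  assumes "0 \<le> t" "t / 2 \<le> s" "0 \<le> \<kappa>" "\<kappa> \<le> 1"
  shows "(\<lambda>K. heat_partial s t \<kappa> K ws) \<longlonglongrightarrow> heat_moment s t \<kappa> ws"
  unfolding heat_partial_def heat_moment_def
  by (rule summable_LIMSEQ', rule summable_norm_cancel, rule summable_norm_heat_moment(1)[OF assms])

text \<open>The coefficients of the Taylor polynomial of \<open>e\<^bsup>rA/2\<^esup>\<close>.\<close>

definition taylor_coeff :: "nat \<Rightarrow> real \<Rightarrow> complex" where
  "taylor_coeff k r = of_real ((r / 2) ^ k / fact k)"

definition taylor_coeff' :: "nat \<Rightarrow> real \<Rightarrow> complex" where
  "taylor_coeff' k r = (case k of 0 \<Rightarrow> 0 | Suc k \<Rightarrow> taylor_coeff k r / 2)"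

lemma taylor_coeff_deriv: "(taylor_coeff k has_vector_derivative taylor_coeff' k r) (at r)"
proof (cases k)
  case 0
  then show ?thesis by (simp add: taylor_coeff_def[abs_def] taylor_coeff'_def)
next
  case (Suc j)
  have "((\<lambda>r. (r / 2) ^ k / fact k) has_real_derivative ((r / 2) ^ j / fact j) / 2) (at r)"
    by (auto intro!: derivative_eq_intros simp: Suc divide_simps simp del: of_nat_Suc)
      (cases j; simp add: algebra_simps)
  then have "((\<lambda>r. complex_of_real ((r / 2) ^ k / fact k)) has_vector_derivative
      of_real (((r / 2) ^ j / fact j) / 2)) (at r)"
    unfolding has_real_derivative_iff_has_vector_derivative 
        by (rule bounded_linear.has_vector_derivative[OF bounded_linear_of_real])
  then show ?thesis by (simp add: taylor_coeff_def[abs_def] taylor_coeff'_def Suc)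
qed

text \<open>Differentiation lowers the index by one, so the Taylor polynomial solves the heat
  equation up to its top term, which remains as a defect.\<close>

lemma sum_taylor_coeff':
  "(\<Sum>k\<le>K. taylor_coeff' k r * H k) = (\<Sum>k\<le>K. taylor_coeff k r * H (Suc k)) / 2 - taylor_coeff K r * H (Suc K) / 2"
proof (induction K)
  case 0
  show ?case by (simp add: taylor_coeff'_def taylor_coeff_def)
next
  case (Suc K)
  then show ?case by (simp add: taylor_coeff'_def field_simps)
qed

context u_basis
begin

definition barrier_const :: "nat \<Rightarrow> real" where
  "barrier_const m = (3 * real N ^ 3) ^ m"

lemma kappa: "0 \<le> 1 / (real N)\<^sup>2" "1 / (real N)\<^sup>2 \<le> 1"
  using N by (simp_all add: field_simps)

text \<open>The comparison function is the real part of \<open>\<zeta>\<close> times the Taylor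
  polynomial plus \<open>e * exp (C * r)\<close> times the barrier. The degree \<open>Suc m\<close>
  is one more than the state requires and gives coercivity; \<open>small\<close> bounds the Taylor
  defect; the final factor 3 is the barrier at the identity. With \<open>K\<close> finite no series
  has to be differentiated.\<close>

lemma comparison_taylor:
  assumes hf: "heat_flow N \<beta> s t f u" and st: "0 \<le> t" "t / 2 \<le> s"
    and n: "total_length ws \<le> 2 * m" and e: "0 < e"
    and init: "\<And>g. g \<in> GL N \<Longrightarrow> Re (f g) \<le> Re (\<zeta> * trace_state N g ws) + e * barrier N (Suc m) g"
    and small: "cmod \<zeta> * (2 * s * (real (total_length ws))\<^sup>2) ^ Suc K / (2 ^ Suc K * fact K) *
      barrier_const (Suc m) \<le> e"
  shows "Re (u 1 (1\<^sub>m N)) \<le> Re (\<zeta> * heat_partial s t (1 / (real N)\<^sup>2) K ws) +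
    3 * e * exp (3 * s * (2 * real (Suc m))\<^sup>2 * barrier_const (Suc m) + 2)"
proof -
  let ?G = "heat_gen s t (1 / (real N)\<^sup>2)" and ?M = "Suc m"
  let ?F = "trace_state N" and ?b = "barrier N (Suc m)"
  let ?n = "total_length ws"
  define B where "B = 2 * s * (real ?n)\<^sup>2"
  define D where "D = barrier_const ?M"
  \<comment> \<open>Bounds half the generator of the barrier relative to the barrier: three states
    of length at most \<open>2 * ?M\<close>, each contributing at most
    \<open>2 * s * (2 * real ?M)^2 * D\<close> times it.\<close>
  define C0 where "C0 = 3 * s * (2 * real ?M)\<^sup>2 * D"
  \<comment> \<open>One unit of the extra 2 pays for the Taylor defect, the other makes the
    inequality strict.\<close>
  define C where "C = C0 + 2"
  have s: "0 \<le> s" using st by linarith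
  have B: "0 \<le> B" and D: "0 \<le> D" using s by (simp_all add: B_def D_def barrier_const_def)
  have C0: "0 \<le> C0" using s D by (simp add: C0_def)
  \<comment> \<open>\<open>Some k\<close> indexes the Taylor terms and \<open>None\<close> the
    barrier.\<close>
  define a where "a = (\<lambda>j r. case j of Some k \<Rightarrow> \<zeta> * taylor_coeff k r | None \<Rightarrow> of_real (e * exp (C * r)))"
  define a' where "a' = (\<lambda>j r. case j of Some k \<Rightarrow> \<zeta> * taylor_coeff' k r | None \<Rightarrow> of_real (e * (C * exp (C * r))))"
  define \<Lambda> where "\<Lambda> = (\<lambda>j F. case j of Some k \<Rightarrow> (?G ^^ k) F ws | None \<Rightarrow> (\<Sum>x\<leftarrow>barrier_states ?M. F x))"
  define J where "J = insert None (Some ` {..K})"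
  have J: "finite J" by (simp add: J_def)
  have sumJ: "(\<Sum>j\<in>J. f j) = f None + (\<Sum>k\<le>K. f (Some k))" for f :: "nat option \<Rightarrow> complex"
    by (simp add: J_def sum.reindex)
  have bar: "(\<Sum>x\<leftarrow>barrier_states ?M. ?F g x) = of_real (?b g)" if "g \<in> GL N" for g
    by (rule barrier_trace_state[OF that])
  have F_le: "cmod (?F g x) \<le> growth N g ^ total_length x" if "g \<in> GL N" for g x
    by (rule cmod_trace_state_le[OF N that])
  have growth_mono: "growth N g ^ i \<le> growth N g ^ j" if "i \<le> j" for i j g
    using growth_ge_1[OF N, of g] that by (intro power_increasing) auto
  have H_le: "cmod ((?G ^^ k) (?F g) ws) \<le> B ^ k * growth N g ^ ?n" if "g \<in> GL N" for g k
    unfolding B_def using F_le[OF that] by (intro heat_gen_iterate_bound[OF st kappa]) metis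
  define v where "v = (\<lambda>r g. Re (\<Sum>j\<in>J. a j r * \<Lambda> j (?F g)))"
  have v_eq: "v r g = e * exp (C * r) * ?b g + Re (\<zeta> * (\<Sum>k\<le>K. taylor_coeff k r * (?G ^^ k) (?F g) ws))"
    if "g \<in> GL N" for r g
  proof -
    have "v r g = Re (of_real (e * exp (C * r)) * (\<Sum>x\<leftarrow>barrier_states ?M. ?F g x) +
        \<zeta> * (\<Sum>k\<le>K. taylor_coeff k r * (?G ^^ k) (?F g) ws))"
      unfolding v_def sumJ by (simp add: a_def \<Lambda>_def sum_distrib_left mult.assoc)
    then show ?thesis unfolding bar[OF that] by simp
  qed
  have "Re (u 1 (1\<^sub>m N)) \<le> v 1 (1\<^sub>m N)"
  proof (rule comparison_principle[OF hf st J, where a = a and a' = a' and \<Lambda> = \<Lambda>])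
    show "list_functional (\<Lambda> j)" if "j \<in> J" for j
      using finite_functional_imp_list[OF finite_functional_iterate] list_functional_sum_list
      by (cases j) (simp_all add: \<Lambda>_def)
    show "(a j has_vector_derivative a' j r) (at r)" if "j \<in> J" for j r
    proof (cases j)
      case None
      have "((\<lambda>r. e * exp (C * r)) has_real_derivative e * (C * exp (C * r))) (at r)"
        by (auto intro!: derivative_eq_intros)
      then have "((\<lambda>r. complex_of_real (e * exp (C * r))) has_vector_derivative of_real (e * (C * exp (C * r)))) (at r)"
        unfolding has_real_derivative_iff_has_vector_derivative 
        by (rule bounded_linear.has_vector_derivative[OF bounded_linear_of_real])
      then show ?thesis by (simp add: None a_def a'_def)
    next
      case (Some k)
      then show ?thesis
        using has_vector_derivative_mult_right[OF taylor_coeff_deriv[of k r], of \<zeta>] by (simp add: a_def a'_def)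
    qed
    show "v r g = Re (\<Sum>j\<in>J. a j r * \<Lambda> j (?F g))" for r g by (simp add: v_def)
    show "Re (f g) \<le> v 0 g" if g: "g \<in> GL N" for g
    proof -
      have "(\<Sum>k\<le>K. taylor_coeff k 0 * (?G ^^ k) (?F g) ws) = (\<Sum>k\<le>K. if k = 0 then ?F g ws else 0)"
        by (intro sum.cong refl) (simp add: taylor_coeff_def)
      then show ?thesis using init[OF g] by (simp add: v_eq[OF g])
    qed
    show "Re (\<Sum>j\<in>J. a j r * \<Lambda> j (?G (?F g))) / 2 < Re (\<Sum>j\<in>J. a' j r * \<Lambda> j (?F g))"
      if r: "0 < r" "r \<le> 1" and g: "g \<in> GL N" for r g
    proof -
      let ?H = "\<lambda>k. (?G ^^ k) (?F g) ws"
      let ?E = "e * exp (C * r)"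
      have b1: "1 \<le> ?b g" by (rule barrier_ge_1)
      have growth_b: "growth N g ^ (2 * ?M) \<le> D * ?b g"
        unfolding D_def barrier_const_def by (rule growth_even_le_barrier[OF N])
      \<comment> \<open>\<open>r \<le> 1\<close> bounds the Taylor coefficient, the assumption
        \<open>n\<close> lets the barrier dominate the growth of the state, and \<open>small\<close>
        supplies the factor \<open>e\<close>.\<close>
      have rem: "cmod (\<zeta> * (taylor_coeff K r * ?H (Suc K) / 2)) \<le> e * ?b g"
      proof -
        have "cmod (taylor_coeff K r) \<le> (1 / 2) ^ K / fact K"
          unfolding taylor_coeff_def norm_of_real using r
          by (auto intro!: divide_right_mono power_mono)
        moreover have "growth N g ^ ?n \<le> D * ?b g"
          using growth_mono[of ?n "2 * ?M" g] growth_b n by simp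
        then have "cmod (?H (Suc K)) \<le> B ^ Suc K * (D * ?b g)"
          using H_le[OF g, of "Suc K"] B by (meson mult_left_mono order_trans zero_le_power)
        ultimately have "cmod \<zeta> * (cmod (taylor_coeff K r) * cmod (?H (Suc K)) / 2) \<le>
            cmod \<zeta> * ((1 / 2) ^ K / fact K * (B ^ Suc K * (D * ?b g)) / 2)"
          by (intro mult_left_mono divide_right_mono mult_mono) auto
        also have "\<dots> = (cmod \<zeta> * B ^ Suc K / (2 ^ Suc K * fact K) * D) * ?b g"
          by (simp add: power_one_over field_simps)
        also have "\<dots> \<le> e * ?b g"
          using small b1 by (intro mult_right_mono) (auto simp: B_def D_def)
        finally show ?thesis by (simp add: norm_mult norm_divide)
      qed
      have GB: "cmod (\<Sum>x\<leftarrow>barrier_states ?M. ?G (?F g) x) \<le> 2 * (C0 * ?b g)"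
      proof -
        have le: "cmod (?G (?F g) x) \<le> 2 * s * (2 * real ?M)\<^sup>2 * (D * ?b g)" if x: "x \<in> set (barrier_states ?M)" for x
        proof -
          have "cmod (?G (?F g) x) \<le> 2 * s * (real (total_length x))\<^sup>2 * growth N g ^ total_length x"
            using F_le[OF g] by (intro heat_gen_bound[OF st kappa]) metis
          also have "\<dots> \<le> 2 * s * (2 * real ?M)\<^sup>2 * (D * ?b g)"
          proof (cases "total_length x = 0")
            case True
            then show ?thesis using s D b1 by simp
          next
            case False
            then have "total_length x = 2 * ?M" using total_length_barrier_states[OF x] by simp
            then show ?thesis using growth_b s by (simp add: mult_left_mono)
          qed
          finally show ?thesis .
        qed
        have len: "real (length (barrier_states ?M)) = 3" by (simp add: barrier_states_def)
        have "cmod (\<Sum>x\<leftarrow>barrier_states ?M. ?G (?F g) x) \<le> 3 * (2 * s * (2 * real ?M)\<^sup>2 * (D * ?b g))"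
          using cmod_sum_list_le[of "barrier_states ?M" "?G (?F g)", OF le] unfolding len .
        then show ?thesis by (simp add: C0_def mult_ac)
      qed
      have "(\<Sum>j\<in>J. a' j r * \<Lambda> j (?F g)) = of_real (?E * C * ?b g) + \<zeta> * (\<Sum>k\<le>K. taylor_coeff' k r * ?H k)"
        unfolding sumJ by (simp add: a'_def \<Lambda>_def sum_distrib_left mult.assoc bar[OF g])
      then have 1: "Re (\<Sum>j\<in>J. a' j r * \<Lambda> j (?F g)) = ?E * C * ?b g +
          Re (\<zeta> * (\<Sum>k\<le>K. taylor_coeff k r * ?H (Suc k))) / 2 - Re (\<zeta> * (taylor_coeff K r * ?H (Suc K) / 2))"
        unfolding sum_taylor_coeff' by (simp add: right_diff_distrib)
      have "(\<Sum>j\<in>J. a j r * \<Lambda> j (?G (?F g))) = of_real ?E * (\<Sum>x\<leftarrow>barrier_states ?M. ?G (?F g) x) +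
          \<zeta> * (\<Sum>k\<le>K. taylor_coeff k r * ?H (Suc k))"
        unfolding sumJ by (simp add: a_def \<Lambda>_def sum_distrib_left mult.assoc funpow_swap1)
      then have 2: "Re (\<Sum>j\<in>J. a j r * \<Lambda> j (?G (?F g))) / 2 = ?E * Re (\<Sum>x\<leftarrow>barrier_states ?M. ?G (?F g) x) / 2 +
          Re (\<zeta> * (\<Sum>k\<le>K. taylor_coeff k r * ?H (Suc k))) / 2"
        by (simp add: add_divide_distrib)
      have E: "e \<le> ?E" using e C0 r by (simp add: C_def)
      have "?E * Re (\<Sum>x\<leftarrow>barrier_states ?M. ?G (?F g) x) / 2 \<le> ?E * (2 * (C0 * ?b g)) / 2"
        using GB complex_Re_le_cmod[of "\<Sum>x\<leftarrow>barrier_states ?M. ?G (?F g) x"] e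
        by (intro divide_right_mono mult_left_mono) auto
      also have "\<dots> = ?E * C * ?b g - 2 * (?E * ?b g)"
        by (simp add: C_def algebra_simps)
      also have "\<dots> < ?E * C * ?b g - e * ?b g"
      proof -
        have "0 < e * ?b g" using e b1 by simp
        moreover have "e * ?b g \<le> ?E * ?b g" using E b1 by (intro mult_right_mono) auto
        ultimately show ?thesis by linarith
      qed
      also have "\<dots> \<le> ?E * C * ?b g - Re (\<zeta> * (taylor_coeff K r * ?H (Suc K) / 2))"
        using rem complex_Re_le_cmod[of "\<zeta> * (taylor_coeff K r * ?H (Suc K) / 2)"] by linarith
      finally show ?thesis unfolding 1 2 by linarith
    qed
    show "\<exists>R. \<forall>r\<in>{0..1}. \<forall>g\<in>GL N. R < mat_gauge N g \<longrightarrow> L \<le> v r g" for L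
    proof -
      define A where "A = cmod \<zeta> * (\<Sum>k\<le>K. B ^ k)"
      \<comment> \<open>The solution of
        \<open>e * R / 3 ^ ?M = A * (real N ^ 3) ^ m + \<bar>L\<bar>\<close>. For a gauge above
        \<open>R\<close>, multiplication by its \<open>m\<close>-th power leaves the barrier term on
        the left and a bound for the Taylor polynomial and \<open>L\<close> on the right.\<close>
      define R where "R = 3 ^ ?M * (A * (real N ^ 3) ^ m + \<bar>L\<bar>) / e"
      have A: "0 \<le> A" using B by (auto simp: A_def intro!: mult_nonneg_nonneg sum_nonneg)
      have "L \<le> v r g" if r: "r \<in> {0..1}" and g: "g \<in> GL N" and R: "R < mat_gauge N g" for r g
      proof -
        have t1: "cmod (taylor_coeff k r) \<le> 1" for k
        proof -
          have "(r / 2) ^ k \<le> 1" using r by (intro power_le_one) auto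
          also have "1 \<le> (fact k :: real)" by simp
          finally show ?thesis using r by (simp add: taylor_coeff_def norm_divide norm_power flip: of_real_power of_real_divide)
        qed
        have "cmod (\<Sum>k\<le>K. taylor_coeff k r * (?G ^^ k) (?F g) ws) \<le> (\<Sum>k\<le>K. 1 * (B ^ k * growth N g ^ ?n))"
          by (rule order_trans[OF norm_sum sum_mono], unfold norm_mult, rule mult_mono[OF t1 H_le[OF g]]) simp_all
        also have "\<dots> = (\<Sum>k\<le>K. B ^ k) * growth N g ^ ?n" by (simp add: sum_distrib_right)
        finally have "cmod (\<zeta> * (\<Sum>k\<le>K. taylor_coeff k r * (?G ^^ k) (?F g) ws)) \<le> A * growth N g ^ ?n"
          unfolding norm_mult A_def mult.assoc by (rule mult_left_mono) simp
        also have "\<dots> \<le> A * ((real N ^ 3) ^ m * mat_gauge N g ^ m)"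
        proof (rule mult_left_mono[OF _ A])
          have "growth N g ^ ?n \<le> growth N g ^ (2 * m)" by (rule growth_mono[OF n])
          then show "growth N g ^ ?n \<le> (real N ^ 3) ^ m * mat_gauge N g ^ m"
            by (simp add: power_mult growth_sq power_mult_distrib)
        qed
        finally have 1: "- (A * ((real N ^ 3) ^ m * mat_gauge N g ^ m)) \<le>
            Re (\<zeta> * (\<Sum>k\<le>K. taylor_coeff k r * (?G ^^ k) (?F g) ws))"
          using abs_Re_le_cmod[of "\<zeta> * (\<Sum>k\<le>K. taylor_coeff k r * (?G ^^ k) (?F g) ws)"] by linarith
        have gm: "1 \<le> mat_gauge N g ^ m" using mat_gauge_ge_1 by simp
        have "A * (real N ^ 3) ^ m + \<bar>L\<bar> \<le> e * mat_gauge N g / 3 ^ ?M"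
          using R e by (simp add: R_def field_simps)
        then have "mat_gauge N g ^ m * (A * (real N ^ 3) ^ m + \<bar>L\<bar>) \<le> mat_gauge N g ^ m * (e * mat_gauge N g / 3 ^ ?M)"
          using gm by (intro mult_left_mono) auto
        also have "\<dots> = e * (mat_gauge N g ^ ?M / 3 ^ ?M)" by simp
        also have "\<dots> \<le> e * ?b g"
          using mat_gauge_power_le_barrier[of N g ?M] e by (intro mult_left_mono) (auto simp: field_simps)
        also have "\<dots> \<le> e * exp (C * r) * ?b g"
          using e C0 r barrier_ge_1[of N ?M g] by (intro mult_right_mono) (auto simp: C_def)
        finally have 2: "mat_gauge N g ^ m * (A * (real N ^ 3) ^ m + \<bar>L\<bar>) \<le> e * exp (C * r) * ?b g" .
        have "L \<le> mat_gauge N g ^ m * \<bar>L\<bar>" using mult_right_mono[OF gm, of "\<bar>L\<bar>"] by simp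
        then show ?thesis unfolding v_eq[OF g] using 1 2 by (simp add: algebra_simps)
      qed
      then show ?thesis by blast
    qed
  qed (use one_in_GL in auto)
  also have "\<dots> = Re (\<zeta> * heat_partial s t (1 / (real N)\<^sup>2) K ws) + 3 * e * exp C"
  proof -
    have "?F (1\<^sub>m N) = (\<lambda>_. 1)" by (rule ext) (rule trace_state_one[OF N])
    then have "(\<Sum>k\<le>K. taylor_coeff k 1 * (?G ^^ k) (?F (1\<^sub>m N)) ws) = heat_partial s t (1 / (real N)\<^sup>2) K ws"
      by (simp add: heat_partial_def taylor_coeff_def power_one_over)
    then show ?thesis unfolding v_eq[OF one_in_GL] by (simp add: barrier_one[OF N])
  qed
  finally show ?thesis unfolding C_def C0_def D_def .
qed

end

section \<open>Moments of the heat kernel measure\<close>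

lemma space_GL_borel [simp]: "space (GL_borel N) = GL N"
  by (simp add: GL_borel_def space_measure_of_conv)

lemma borel_measurable_GL:
  fixes f :: "complex mat \<Rightarrow> 'b :: topological_space"
  assumes f: "continuous_map (GL_topology N) euclidean f"
  shows "f \<in> borel_measurable (GL_borel N)"
proof (rule borel_measurableI)
  fix S :: "'b set" assume "open S"
  then have "openin (GL_topology N) {g \<in> GL N. f g \<in> S}"
    using f by (simp add: continuous_map_def)
  moreover have "f -` S \<inter> space (GL_borel N) = {g \<in> GL N. f g \<in> S}" by auto
  moreover have "{U. openin (GL_topology N) U} \<subseteq> Pow (GL N)"
    using openin_subset[of "GL_topology N"] by auto
  ultimately show "f -` S \<inter> space (GL_borel N) \<in> sets (GL_borel N)"
    by (simp add: GL_borel_def)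
qed

text \<open>Equals 1 up to gauge \<open>Suc k\<close> and 0 from gauge \<open>2 * Suc k\<close> on;
  \<open>Suc\<close> avoids division by 0.\<close>

definition cutoff :: "nat \<Rightarrow> nat \<Rightarrow> complex mat \<Rightarrow> real" where
  "cutoff N k g = max 0 (min 1 (2 - mat_gauge N g / real (Suc k)))"

lemma cutoff_bounds: "0 \<le> cutoff N k g" "cutoff N k g \<le> 1"
  by (auto simp: cutoff_def)

lemma cutoff_mono: "k \<le> l \<Longrightarrow> cutoff N k g \<le> cutoff N l g"
proof -
  assume "k \<le> l"
  then have "mat_gauge N g / real (Suc l) \<le> mat_gauge N g / real (Suc k)"
    using mat_gauge_ge_1[of N g] by (intro divide_left_mono) auto
  then show ?thesis by (auto simp: cutoff_def)
qed

text \<open>Truncation gains \<open>1 / Suc k\<close> at the cost of one power of the gauge, which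
  the barrier of the next degree absorbs in \<open>integral_trace_state\<close>.\<close>

lemma one_minus_cutoff: "1 - cutoff N k g \<le> mat_gauge N g / real (Suc k)"
proof (cases "mat_gauge N g \<le> real (Suc k)")
  case True
  then have "mat_gauge N g / real (Suc k) \<le> 1" by simp
  moreover have "0 \<le> mat_gauge N g / real (Suc k)" using mat_gauge_ge_1[of N g] by simp
  ultimately show ?thesis by (auto simp: cutoff_def)
next
  case False
  then have "1 \<le> mat_gauge N g / real (Suc k)" by simp
  then show ?thesis using cutoff_bounds[of N k g] by linarith
qed

lemma cutoff_tendsto: "(\<lambda>k. cutoff N k g) \<longlonglongrightarrow> 1"
proof (rule tendsto_eventually)
  obtain K :: nat where K: "mat_gauge N g \<le> real K" using real_arch_simple by blast
  have "cutoff N k g = 1" if "K \<le> k" for k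
  proof -
    have "mat_gauge N g / real (Suc k) \<le> 1" using K that by simp
    then show ?thesis by (auto simp: cutoff_def)
  qed
  then show "\<forall>\<^sub>F k in sequentially. cutoff N k g = 1" using eventually_sequentially by blast
qed

lemma cutoff_Cc:
  assumes N: "N \<ge> 1" and f: "continuous_map (GL_topology N) euclidean f"
  shows "(\<lambda>g. of_real (cutoff N k g) * f g) \<in> Cc_GL N"
proof -
  have "continuous_map (GL_topology N) euclidean (\<lambda>g. of_real (cutoff N k g) * f g)"
    using f continuous_map_gauge[of N] unfolding continuous_map_euclidean_iff cutoff_def divide_inverse
    by (auto intro!: tendsto_mult tendsto_of_real tendsto_max tendsto_min tendsto_diff)
  moreover have "cutoff N k g = 0" if "\<not> mat_gauge N g \<le> 2 * real (Suc k)" for g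
  proof -
    have "2 \<le> mat_gauge N g / real (Suc k)" using that by (simp add: field_simps)
    then show ?thesis by (simp add: cutoff_def)
  qed
  then have "\<forall>g\<in>GL N - {g \<in> GL N. mat_gauge N g \<le> 2 * real (Suc k)}. of_real (cutoff N k g) * f g = 0"
    by simp
  ultimately show ?thesis
    unfolding Cc_GL_def using compact_gauge_sublevel[OF N, of "2 * real (Suc k)"] by blast
qed

locale heat_law = u_basis +
  fixes s t :: real and \<mu> :: "complex mat measure"
  assumes st: "0 \<le> t" "t / 2 \<le> s" and law: "heat_kernel_measure N \<beta> s t \<mu>"
begin

abbreviation moment :: "word list \<Rightarrow> complex" where
  "moment \<equiv> heat_moment s t (1 / (real N)\<^sup>2)"

sublocale prob_space \<mu>
  using law by (simp add: heat_kernel_measure_def)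

lemma sets_law: "sets \<mu> = sets (GL_borel N)"
  using law by (simp add: heat_kernel_measure_def)

lemma space_law: "space \<mu> = GL N"
  using sets_eq_imp_space_eq[OF sets_law] by simp

lemma measurable_law:
  fixes f :: "complex mat \<Rightarrow> 'b :: topological_space"
  assumes "continuous_map (GL_topology N) euclidean f"
  shows "f \<in> borel_measurable \<mu>"
  using borel_measurable_GL[OF assms] measurable_cong_sets[OF sets_law refl] by blast

lemma integrable_Cc:
  assumes f: "f \<in> Cc_GL N"
  shows "integrable \<mu> f"
proof -
  obtain K where K: "compactin (GL_topology N) K" and z: "\<And>g. g \<in> GL N - K \<Longrightarrow> f g = 0"
    and c: "continuous_map (GL_topology N) euclidean f"
    using f by (auto simp: Cc_GL_def)
  have "compact (f ` K)" using image_compactin[OF K c] by simp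
  then obtain B where B: "\<And>g. g \<in> K \<Longrightarrow> norm (f g) \<le> B"
    using compact_imp_bounded bounded_iff by (metis image_eqI)
  show ?thesis
  proof (rule integrable_const_bound[of _ "max B 0"])
    show "AE g in \<mu>. norm (f g) \<le> max B 0"
    proof (rule AE_I2)
      fix g assume "g \<in> space \<mu>"
      then show "norm (f g) \<le> max B 0"
        using B[of g] z[of g] by (cases "g \<in> K") (auto simp: space_law)
    qed
  qed (rule measurable_law[OF c])
qed

text \<open>\<open>K\<close> tends to infinity in \<open>comparison_taylor\<close>: the coefficient
  in \<open>small\<close> is a constant times a term of an exponential series, so it falls below
  \<open>e\<close> eventually.\<close>

lemma integral_Cc_le:
  assumes f: "f \<in> Cc_GL N" and n: "total_length ws \<le> 2 * m" and e: "0 < e"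
    and init: "\<And>g. g \<in> GL N \<Longrightarrow> Re (f g) \<le> Re (\<zeta> * trace_state N g ws) + e * barrier N (Suc m) g"
  shows "Re (\<integral>g. f g \<partial>\<mu>) \<le> Re (\<zeta> * moment ws) +
    3 * e * exp (3 * s * (2 * real (Suc m))\<^sup>2 * barrier_const (Suc m) + 2)"
proof -
  let ?C = "3 * e * exp (3 * s * (2 * real (Suc m))\<^sup>2 * barrier_const (Suc m) + 2)"
  let ?B = "2 * s * (real (total_length ws))\<^sup>2"
  obtain u where hf: "heat_flow N \<beta> s t f u" and u: "(\<integral>g. f g \<partial>\<mu>) = u 1 (1\<^sub>m N)"
    using law f unfolding heat_kernel_measure_def by blast
  have "(\<lambda>K. (?B / 2) ^ K /\<^sub>R fact K) \<longlonglongrightarrow> 0"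
    by (rule summable_LIMSEQ_zero[OF summable_exp_generic])
  then have "(\<lambda>K. (cmod \<zeta> * barrier_const (Suc m) * (?B / 2)) * ((?B / 2) ^ K /\<^sub>R fact K)) \<longlonglongrightarrow>
      (cmod \<zeta> * barrier_const (Suc m) * (?B / 2)) * 0"
    by (rule tendsto_mult_left)
  moreover have "(a * c * (b / 2)) * ((b / 2) ^ K /\<^sub>R fact K) = a * b ^ Suc K / (2 ^ Suc K * fact K) * c"
    for a b c :: real and K
    by (simp add: power_divide field_simps)
  ultimately have "(\<lambda>K. cmod \<zeta> * ?B ^ Suc K / (2 ^ Suc K * fact K) * barrier_const (Suc m)) \<longlonglongrightarrow> 0"
    by (simp only: mult_zero_right)
  then have "\<forall>\<^sub>F K in sequentially. cmod \<zeta> * ?B ^ Suc K / (2 ^ Suc K * fact K) * barrier_const (Suc m) < e"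
    using e by (rule order_tendstoD)
  then have "\<forall>\<^sub>F K in sequentially. Re (u 1 (1\<^sub>m N)) \<le> Re (\<zeta> * heat_partial s t (1 / (real N)\<^sup>2) K ws) + ?C"
    by (rule eventually_mono) (rule comparison_taylor[OF hf st n e init], auto)
  moreover have "(\<lambda>K. Re (\<zeta> * heat_partial s t (1 / (real N)\<^sup>2) K ws) + ?C) \<longlonglongrightarrow>
      Re (\<zeta> * moment ws) + ?C"
    by (intro tendsto_add tendsto_const tendsto_Re tendsto_mult heat_partial_tendsto st kappa)
  ultimately show ?thesis unfolding u by (intro tendsto_lowerbound) auto
qed

lemma continuous_map_barrier: "continuous_map (GL_topology N) euclidean (barrier N m)"
proof -
  have "continuous_map (GL_topology N) euclidean (\<lambda>g. \<Sum>ws\<leftarrow>barrier_states m. trace_state N g ws)"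
    using continuous_map_list_functional[OF list_functional_sum_list] .
  then have "continuous_map (GL_topology N) euclidean (\<lambda>g. Re (\<Sum>ws\<leftarrow>barrier_states m. trace_state N g ws))"
    unfolding continuous_map_euclidean_iff by (auto intro!: tendsto_Re)
  then show ?thesis by (rule continuous_map_eq) (simp add: barrier_trace_state)
qed

text \<open>The truncated barriers have integrals bounded uniformly in the cut-off, by comparison
  with the barrier itself; monotone convergence does the rest.\<close>

lemma integrable_barrier: "integrable \<mu> (barrier N (Suc m))"
proof -
  let ?f = "\<lambda>k g. cutoff N k g * barrier N (Suc m) g"
  let ?C = "3 * exp (3 * s * (2 * real (Suc m))\<^sup>2 * barrier_const (Suc m) + 2)"
  have b: "0 \<le> barrier N (Suc m) g" for g using barrier_ge_1[of N "Suc m" g] by simp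
  have cb: "continuous_map (GL_topology N) euclidean (\<lambda>g. complex_of_real (barrier N (Suc m) g))"
    using continuous_map_barrier[of "Suc m"] unfolding continuous_map_euclidean_iff by (auto intro!: tendsto_of_real)
  have Cc: "(\<lambda>g. complex_of_real (?f k g)) \<in> Cc_GL N" for k
    using cutoff_Cc[OF N cb, of k] by simp
  have int: "integrable \<mu> (?f k)" for k
    using integrable_Re[OF integrable_Cc[OF Cc[of k]]] by simp
  have le: "(\<integral>g. ?f k g \<partial>\<mu>) \<le> ?C" for k
  proof -
    \<comment> \<open>\<open>\<zeta> = 0\<close> and \<open>e = 1\<close> leave only the barrier in
      the comparison function.\<close>
    have "Re (\<integral>g. complex_of_real (?f k g) \<partial>\<mu>) \<le> Re (0 * moment []) +
      3 * 1 * exp (3 * s * (2 * real (Suc m))\<^sup>2 * barrier_const (Suc m) + 2)"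
      using cutoff_bounds[of N k] b
      by (intro integral_Cc_le[OF Cc]) (auto intro: mult_left_le_one_le)
    then show ?thesis by (simp flip: of_real_mult)
  qed
  have mono: "incseq (\<lambda>k. \<integral>g. ?f k g \<partial>\<mu>)"
    by (intro incseq_SucI integral_mono int mult_right_mono cutoff_mono b) auto
  have "\<forall>k. (\<integral>g. ?f k g \<partial>\<mu>) \<le> ?C" using le by blast
  from incseq_convergent[OF mono this]
  obtain L where L: "(\<lambda>k. \<integral>g. ?f k g \<partial>\<mu>) \<longlonglongrightarrow> L" by blast
  show ?thesis
  proof (rule integrable_monotone_convergence[OF int _ _ L])
    show "AE g in \<mu>. mono (\<lambda>k. ?f k g)"
      by (intro AE_I2 monoI mult_right_mono cutoff_mono b)
    show "AE g in \<mu>. (\<lambda>k. ?f k g) \<longlonglongrightarrow> barrier N (Suc m) g"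
      using tendsto_mult[OF cutoff_tendsto tendsto_const] by (intro AE_I2) force
  qed (rule measurable_law[OF continuous_map_barrier])
qed

lemma cmod_trace_state_le_gauge:
  assumes g: "g \<in> GL N" and n: "total_length ws \<le> 2 * m"
  shows "cmod (trace_state N g ws) \<le> (real N ^ 3) ^ m * mat_gauge N g ^ m"
proof -
  have "cmod (trace_state N g ws) \<le> growth N g ^ (2 * m)"
    using cmod_trace_state_le[OF N g, of ws] power_increasing[OF n growth_ge_1[OF N, of g]] by linarith
  then show ?thesis by (simp add: power_mult growth_sq power_mult_distrib)
qed

lemma integrable_trace_state: "integrable \<mu> (\<lambda>g. trace_state N g ws)"
proof -
  let ?m = "Suc (total_length ws)"
  have "cmod (trace_state N g ws) \<le> (real N ^ 3) ^ ?m * (3 ^ ?m * barrier N ?m g)" if "g \<in> GL N" for g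
  proof -
    have "cmod (trace_state N g ws) \<le> (real N ^ 3) ^ ?m * mat_gauge N g ^ ?m"
      by (rule cmod_trace_state_le_gauge[OF that]) simp
    also have "\<dots> \<le> (real N ^ 3) ^ ?m * (3 ^ ?m * barrier N ?m g)"
      by (rule mult_left_mono[OF mat_gauge_power_le_barrier]) simp
    finally show ?thesis .
  qed
  then have "AE g in \<mu>. cmod (trace_state N g ws) \<le> norm ((real N ^ 3) ^ ?m * (3 ^ ?m * barrier N ?m g))"
    by (intro AE_I2) (smt (verit) real_norm_def space_law)
  moreover have "integrable \<mu> (\<lambda>g. (real N ^ 3) ^ ?m * (3 ^ ?m * barrier N ?m g))"
    by (intro integrable_mult_right integrable_barrier)
  ultimately show ?thesis
    using measurable_law[OF continuous_map_trace_state, of ws] Bochner_Integration.integrable_bound by blast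
qed

text \<open>A truncated state differs from the state by at most \<open>?e k\<close> times the
  barrier, with \<open>?e k\<close> of order \<open>1 / Suc k\<close>. So
  \<open>integral_Cc_le\<close> applies with \<open>e\<close> of this size, and \<open>k\<close>
  tends to infinity under dominated convergence.\<close>

lemma integral_trace_state:
  "(\<integral>g. trace_state N g ws \<partial>\<mu>) = moment ws"
proof -
  let ?F = "\<lambda>g. trace_state N g ws" and ?E = "moment ws"
  let ?m = "total_length ws"
  let ?f = "\<lambda>k g. of_real (cutoff N k g) * ?F g"
  let ?c = "(real N ^ 3) ^ ?m * 3 ^ Suc ?m"
  let ?e = "\<lambda>k. ?c / real (Suc k)"
  let ?C = "exp (3 * s * (2 * real (Suc ?m))\<^sup>2 * barrier_const (Suc ?m) + 2)"
  have lim: "(\<lambda>k. \<integral>g. ?f k g \<partial>\<mu>) \<longlonglongrightarrow> (\<integral>g. ?F g \<partial>\<mu>)"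
  proof (rule integral_dominated_convergence[where w = "\<lambda>g. cmod (?F g)"])
    show "?F \<in> borel_measurable \<mu>" "?f k \<in> borel_measurable \<mu>" for k
      using integrable_trace_state integrable_Cc[OF cutoff_Cc[OF N continuous_map_trace_state]] by auto
    show "integrable \<mu> (\<lambda>g. cmod (?F g))" using integrable_trace_state by (rule integrable_norm)
    have "(\<lambda>k. ?f k g) \<longlonglongrightarrow> of_real 1 * ?F g" for g
      by (intro tendsto_mult tendsto_of_real cutoff_tendsto tendsto_const)
    then show "AE g in \<mu>. (\<lambda>k. ?f k g) \<longlonglongrightarrow> ?F g" by simp
    show "AE g in \<mu>. norm (?f k g) \<le> cmod (?F g)" for k
      using cutoff_bounds[of N k] by (intro AE_I2) (auto simp: norm_mult intro: mult_left_le_one_le)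
  qed
  have le: "Re (\<zeta> * ((\<integral>g. ?F g \<partial>\<mu>) - ?E)) \<le> 0" if \<zeta>: "cmod \<zeta> = 1" for \<zeta>
  proof -
    have "Re (\<zeta> * (\<integral>g. ?f k g \<partial>\<mu>)) \<le> Re (\<zeta> * ?E) + 3 * ?e k * ?C" for k
    proof -
      have Cc: "(\<lambda>g. \<zeta> * ?f k g) \<in> Cc_GL N"
      proof -
        have "continuous_map (GL_topology N) euclidean (\<lambda>g. \<zeta> * ?F g)"
          using continuous_map_trace_state[of N ws] unfolding continuous_map_euclidean_iff
          by (auto intro!: tendsto_mult)
        from cutoff_Cc[OF N this, of k] show ?thesis by (simp add: mult.left_commute)
      qed
      have "Re (\<integral>g. \<zeta> * ?f k g \<partial>\<mu>) \<le> Re (\<zeta> * ?E) + 3 * ?e k * ?C"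
      proof (rule integral_Cc_le[OF Cc])
        show "0 < ?e k" using N by simp
        fix g assume g: "g \<in> GL N"
        have g1: "1 \<le> mat_gauge N g" by (rule mat_gauge_ge_1)
        have "Re (\<zeta> * ?f k g) - Re (\<zeta> * ?F g) = Re (\<zeta> * ?F g * of_real (cutoff N k g - 1))"
          by (simp add: algebra_simps)
        also have "\<dots> \<le> cmod (?F g) * (1 - cutoff N k g)"
          using complex_Re_le_cmod[of "\<zeta> * ?F g * of_real (cutoff N k g - 1)"] cutoff_bounds[of N k g] \<zeta>
          unfolding norm_mult norm_of_real by simp
        also have "\<dots> \<le> ((real N ^ 3) ^ ?m * mat_gauge N g ^ ?m) * (mat_gauge N g / real (Suc k))"
          using cutoff_bounds[of N k g] g1
          by (intro mult_mono cmod_trace_state_le_gauge[OF g] one_minus_cutoff) auto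
        also have "\<dots> = (real N ^ 3) ^ ?m / real (Suc k) * mat_gauge N g ^ Suc ?m" by simp
        also have "\<dots> \<le> (real N ^ 3) ^ ?m / real (Suc k) * (3 ^ Suc ?m * barrier N (Suc ?m) g)"
          by (intro mult_left_mono mat_gauge_power_le_barrier) simp
        finally show "Re (\<zeta> * ?f k g) \<le> Re (\<zeta> * ?F g) + ?e k * barrier N (Suc ?m) g"
          by (simp add: field_simps)
      qed simp
      then show ?thesis by simp
    qed
    moreover have "(\<lambda>k. Re (\<zeta> * (\<integral>g. ?f k g \<partial>\<mu>))) \<longlonglongrightarrow> Re (\<zeta> * (\<integral>g. ?F g \<partial>\<mu>))"
      by (intro tendsto_Re tendsto_mult tendsto_const lim)
    moreover have "(\<lambda>k. Re (\<zeta> * ?E) + 3 * ?e k * ?C) \<longlonglongrightarrow> Re (\<zeta> * ?E) + 3 * 0 * ?C"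
    proof -
      have "(\<lambda>k. ?c * inverse (real (Suc k))) \<longlonglongrightarrow> ?c * 0"
        by (intro tendsto_mult_left LIMSEQ_inverse_real_of_nat)
      then have "?e \<longlonglongrightarrow> 0" by (simp add: divide_inverse)
      then show ?thesis by (intro tendsto_add tendsto_mult tendsto_const)
    qed
    ultimately have "Re (\<zeta> * (\<integral>g. ?F g \<partial>\<mu>)) \<le> Re (\<zeta> * ?E) + 3 * 0 * ?C"
      by (intro LIMSEQ_le) auto
    then show ?thesis by (simp add: right_diff_distrib)
  qed
  \<comment> \<open>The one-sided bound at the phases 1 and -1 settles the real part, at
    \<open>\<i>\<close> and \<open>- \<i>\<close> the imaginary part.\<close>
  have "(\<integral>g. ?F g \<partial>\<mu>) - ?E = 0"
    using le[of 1] le[of "- 1"] le[of \<i>] le[of "- \<i>"] by (intro complex_eqI) auto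
  then show ?thesis by simp
qed

end

section \<open>The limit distribution\<close>

lemma (in nc_prob_space) state_zero: "\<tau> \<zero> = 0"
  using state_smult[of \<zero> 0] smult_zero_left[of \<zero>] by simp

lemma (in nc_prob_space) state_finsum:
  assumes "finite S" "\<And>x. x \<in> S \<Longrightarrow> h x \<in> carrier \<A>"
  shows "\<tau> (finsum \<A> h S) = (\<Sum>x\<in>S. \<tau> (h x))"
  using assms
proof (induction S)
  case (insert x S)
  then have "h \<in> S \<rightarrow> carrier \<A>" "h x \<in> carrier \<A>" by auto
  then show ?case using insert by (simp add: finsum_insert state_add)
qed (simp add: state_zero)

text \<open>A tracial state on the group algebra is the distribution of the generator in the
  group algebra itself.\<close>

lemma nc_distribution_of_state:
  assumes \<psi>: "nc_prob_space laurent_algebra \<psi>"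
  shows "is_nc_distribution \<psi>"
proof -
  interpret nc_prob_space laurent_algebra \<psi> by (rule \<psi>)
  let ?s = "\<lambda>w. Poly_Mapping.single (abs_free_group w) (1 :: complex)"
  define A :: laurent where "A = ?s [(Gen, True)]"
  have cancel: "word_equiv [(x, b), (x, \<not> b)] []" for x :: generator and b
    using word_cancel[of "[]" x b "[]"] by simp
  have inv: "?s [(x, b)] * ?s [(x, \<not> b)] = 1" for x :: generator and b
  proof -
    have "abs_free_group [(x, b), (x, \<not> b)] = 0"
      using cancel[of x b] by (simp add: zero_free_group_def free_group.abs_eq_iff)
    then show ?thesis by (simp add: mult_single plus_free_group.abs_eq flip: single_one)
  qed
  have unit: "?s [(x, True)] \<in> Units laurent_algebra" "inv\<^bsub>laurent_algebra\<^esub> ?s [(x, True)] = ?s [(x, False)]" for x :: generator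
    using inv[of x True] inv[of x False] by (auto simp: Units_def intro!: inv_char)
  have U: "A \<in> Units laurent_algebra" unfolding A_def by (rule unit(1))
  have star: "laurent_star A = ?s [(Gen_star, True)]"
    by (simp add: A_def laurent_star_single group_star.abs_eq word_star_def)
  have letter: "letter_eval laurent_algebra A l = ?s [l]" for l
    using unit(2) star by (cases "(laurent_algebra, A, l)" rule: letter_eval.cases) (simp_all add: A_def)
  have word: "word_eval laurent_algebra A w = ?s w" for w
    by (induction w)
      (simp_all add: word_eval_def letter mult_single plus_free_group.abs_eq zero_free_group_def flip: single_one)
  have "laurent_eval laurent_algebra A f = f" for f
    by (induction f rule: laurent_induct)
      (simp_all add: laurent_eval_single[OF U] laurent_eval_add[OF U] word abs_rep_free_group mult_single)
  then have "\<psi> = nc_distribution_of laurent_algebra \<psi> A"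
    by (simp add: fun_eq_iff nc_distribution_of_def)
  with \<psi> U show ?thesis unfolding is_nc_distribution_def by blast
qed

text \<open>All conditions are linear equations or membership in a closed convex cone, so they
  survive averaging (\<open>mean_state\<close>) and pointwise limits
  (\<open>laurent_state_limit\<close>).\<close>

lemma laurent_state_iff:
  "nc_prob_space laurent_algebra \<psi> \<longleftrightarrow>
    (\<forall>f g. \<psi> (f + g) = \<psi> f + \<psi> g) \<and> (\<forall>c f. \<psi> (Poly_Mapping.single 0 c * f) = c * \<psi> f) \<and>
    \<psi> 1 = 1 \<and> (\<forall>f g. \<psi> (f * g) = \<psi> (g * f)) \<and> (\<forall>f. \<psi> (f * laurent_star f) \<in> \<real>\<^sub>\<ge>\<^sub>0)"
  using star_algebra_laurent by (auto simp: nc_prob_space_def nc_prob_space_axioms_def)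

lemma empirical_state:
  assumes N: "N \<ge> 1" and g: "g \<in> GL N"
  shows "nc_prob_space laurent_algebra (empirical_distribution N g)"
proof -
  interpret nc_prob_space "matrix_algebra N" "normalized_trace N" by (rule nc_prob_space_matrix[OF N])
  have U: "g \<in> Units (matrix_algebra N)" using g by (simp add: Units_matrix_algebra)
  note closed = laurent_eval_closed[OF U]
  show ?thesis
    unfolding laurent_state_iff empirical_distribution_def nc_distribution_of_def
  proof (intro conjI allI)
    fix f h :: laurent and c
    show "normalized_trace N (laurent_eval (matrix_algebra N) g (f + h)) =
        normalized_trace N (laurent_eval (matrix_algebra N) g f) + normalized_trace N (laurent_eval (matrix_algebra N) g h)"
      using state_add[OF closed closed] by (simp add: laurent_eval_add[OF U])
    show "normalized_trace N (laurent_eval (matrix_algebra N) g (f * h)) =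
        normalized_trace N (laurent_eval (matrix_algebra N) g (h * f))"
      using state_tracial[OF closed closed] by (simp only: laurent_eval_mult[OF U])
    show "normalized_trace N (laurent_eval (matrix_algebra N) g 1) = 1"
      using state_unital by (simp only: laurent_eval_one[OF U])
    show "normalized_trace N (laurent_eval (matrix_algebra N) g (f * laurent_star f)) \<in> \<real>\<^sub>\<ge>\<^sub>0"
      using state_pos[OF closed] by (simp only: laurent_eval_mult[OF U] laurent_eval_star[OF U])
    show "normalized_trace N (laurent_eval (matrix_algebra N) g (Poly_Mapping.single 0 c * f)) =
        c * normalized_trace N (laurent_eval (matrix_algebra N) g f)"
      using state_smult[OF closed] mult_smult_left[OF one_closed closed] l_one[OF closed]
      by (simp only: laurent_eval_mult[OF U] laurent_eval_single[OF U] word_eval_rep_zero[OF U])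
  qed
qed

text \<open>Linear extension from single words. The chosen representative of a group element need
  not be reduced; the error constants use its length.\<close>

definition laurent_sum :: "(word list \<Rightarrow> complex) \<Rightarrow> laurent \<Rightarrow> complex" where
  "laurent_sum F f = (\<Sum>w\<in>Poly_Mapping.keys f. Poly_Mapping.lookup f w * F [rep_free_group w])"

lemma empirical_distribution_eq:
  assumes N: "N \<ge> 1" and g: "g \<in> GL N"
  shows "empirical_distribution N g f = laurent_sum (trace_state N g) f"
proof -
  interpret nc_prob_space "matrix_algebra N" "normalized_trace N" by (rule nc_prob_space_matrix[OF N])
  have U: "g \<in> Units (matrix_algebra N)" using g by (simp add: Units_matrix_algebra)
  show ?thesis
    unfolding empirical_distribution_def nc_distribution_of_def laurent_eval_def laurent_sum_def
    using state_smult[OF word_eval_closed[OF U]] term_closed[OF U]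
    by (subst state_finsum) auto
qed

section \<open>Covariances of traces\<close>

lemma cnj_trace_state_word:
  assumes N: "N \<ge> 1" and g: "g \<in> GL N"
  shows "cnj (trace_state N g [w]) = trace_state N g [word_star w]"
proof -
  interpret star_algebra "matrix_algebra N" by (rule star_algebra_matrix)
  have U: "g \<in> Units (matrix_algebra N)" using g by (simp add: Units_matrix_algebra)
  have d: "word_mat N g w \<in> carrier_mat N N" using g by simp
  have "word_mat N g (word_star w) = mat_adjoint (word_mat N g w)"
    using word_eval_star[OF U, of w] by simp
  then show ?thesis using d by (simp add: normalized_trace_def mat_trace_def)
qed

lemma length_word_star [simp]: "length (word_star w) = length w"
  by (simp add: word_star_def)

lemma moment_error_nonneg: "0 \<le> s \<Longrightarrow> 0 \<le> moment_error s n"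
  by (simp add: moment_error_def)

definition variance_error :: "real \<Rightarrow> nat \<Rightarrow> real" where
  "variance_error s n = moment_error s (2 * n) + 2 * moment_error s n * exp (s * (real n)\<^sup>2)"

text \<open>At \<open>\<kappa> = 0\<close> the covariance vanishes by multiplicativity, so only the
  errors of moving three moments to \<open>\<kappa> = 0\<close> remain: one for a state of length
  \<open>2 n\<close>, and two of length \<open>n\<close>, each times a moment bounded by
  \<open>?e\<close>.\<close>

lemma heat_moment_cov:
  assumes st: "0 \<le> t" "t / 2 \<le> s" and \<kappa>: "0 \<le> \<kappa>" "\<kappa> \<le> 1" and l: "length v = length w"
  shows "cmod (heat_moment s t \<kappa> [w, v] - heat_moment s t \<kappa> [w] * heat_moment s t \<kappa> [v])
    \<le> \<kappa> * variance_error s (length w)"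
proof -
  let ?m = "heat_moment s t \<kappa>" and ?p = "heat_moment s t 0" and ?n = "length w"
  let ?e = "exp (s * (real ?n)\<^sup>2)"
  have z: "0 \<le> (0::real)" "(0::real) \<le> 1" by auto
  have f: "?p [w, v] = ?p [w] * ?p [v]"
    using heat_moment_zero_append[OF st, of "[w]" "[v]"] by simp
  have tl: "total_length [w, v] = 2 * ?n" "total_length [w] = ?n" "total_length [v] = ?n"
    using l by simp_all
  have d: "cmod (?m [w, v] - ?p [w, v]) \<le> \<kappa> * moment_error s (2 * ?n)"
    "cmod (?m [w] - ?p [w]) \<le> \<kappa> * moment_error s ?n"
    "cmod (?m [v] - ?p [v]) \<le> \<kappa> * moment_error s ?n"
    using heat_moment_diff[OF st \<kappa>, of "[w, v]"] heat_moment_diff[OF st \<kappa>, of "[w]"]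
      heat_moment_diff[OF st \<kappa>, of "[v]"] unfolding tl by blast+
  have b: "cmod (?m [w]) \<le> ?e" "cmod (?p [v]) \<le> ?e"
    using summable_norm_heat_moment(2)[OF st \<kappa>, of "[w]"] summable_norm_heat_moment(2)[OF st z, of "[v]"] l by simp_all
  have "?m [w, v] - ?m [w] * ?m [v] = (?m [w, v] - ?p [w, v]) -
      ((?m [w] - ?p [w]) * ?p [v] + ?m [w] * (?m [v] - ?p [v]))"
    unfolding f by (simp add: algebra_simps)
  also have "cmod \<dots> \<le> cmod (?m [w, v] - ?p [w, v]) +
      (cmod (?m [w] - ?p [w]) * cmod (?p [v]) + cmod (?m [w]) * cmod (?m [v] - ?p [v]))"
    unfolding norm_mult[symmetric]
    by (rule order_trans[OF norm_triangle_ineq4 add_left_mono[OF norm_triangle_ineq]])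
  also have "\<dots> \<le> \<kappa> * moment_error s (2 * ?n) + ((\<kappa> * moment_error s ?n) * ?e + ?e * (\<kappa> * moment_error s ?n))"
    by (intro add_mono mult_mono d b) (use \<kappa> st in \<open>auto intro!: mult_nonneg_nonneg moment_error_nonneg\<close>)
  finally show ?thesis by (simp add: variance_error_def algebra_simps)
qed

lemma Re_mult_cnj: "Re (z * cnj z) = (cmod z)\<^sup>2"
  unfolding cmod_power2 by (simp add: power2_eq_square)

section \<open>Mean and variance under the heat kernel measure\<close>

context heat_law
begin

lemma integrable_empirical: "integrable \<mu> (\<lambda>g. empirical_distribution N g f)"
  and integral_empirical: "(\<integral>g. empirical_distribution N g f \<partial>\<mu>) = laurent_sum (moment) f"
proof -
  have e: "empirical_distribution N g f = laurent_sum (trace_state N g) f" if "g \<in> space \<mu>" for g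
    using empirical_distribution_eq[OF N] that by (simp add: space_law)
  have i: "integrable \<mu> (\<lambda>g. laurent_sum (trace_state N g) f)"
    unfolding laurent_sum_def
    by (intro Bochner_Integration.integrable_sum integrable_mult_right integrable_trace_state)
  then show "integrable \<mu> (\<lambda>g. empirical_distribution N g f)"
    using Bochner_Integration.integrable_cong[of \<mu> \<mu> "\<lambda>g. empirical_distribution N g f", OF refl e] by blast
  have "(\<integral>g. empirical_distribution N g f \<partial>\<mu>) = (\<integral>g. laurent_sum (trace_state N g) f \<partial>\<mu>)"
    by (rule Bochner_Integration.integral_cong[OF refl e])
  also have "\<dots> = laurent_sum (moment) f"
    unfolding laurent_sum_def
    by (subst Bochner_Integration.integral_sum) (simp_all add: integrable_trace_state integral_trace_state del: trace_state_simps)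
  finally show "(\<integral>g. empirical_distribution N g f \<partial>\<mu>) = laurent_sum (moment) f" .
qed

text \<open>Positivity is not visible in the combinatorial series; it is obtained here by averaging
  the states of individual matrices.\<close>

lemma mean_state: "nc_prob_space laurent_algebra (laurent_sum (moment))"
  unfolding laurent_state_iff integral_empirical[symmetric]
proof (intro conjI allI)
  note S = empirical_state[OF N, unfolded laurent_state_iff space_law[symmetric]]
  let ?e = "empirical_distribution N"
  fix f h :: laurent and c
  have "(\<integral>g. ?e g (f + h) \<partial>\<mu>) = (\<integral>g. ?e g f + ?e g h \<partial>\<mu>)"
    using S by (intro Bochner_Integration.integral_cong refl) blast
  then show "(\<integral>g. ?e g (f + h) \<partial>\<mu>) = (\<integral>g. ?e g f \<partial>\<mu>) + (\<integral>g. ?e g h \<partial>\<mu>)"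
    by (simp add: integrable_empirical)
  have "(\<integral>g. ?e g (Poly_Mapping.single 0 c * f) \<partial>\<mu>) = (\<integral>g. c * ?e g f \<partial>\<mu>)"
    using S by (intro Bochner_Integration.integral_cong refl) blast
  then show "(\<integral>g. ?e g (Poly_Mapping.single 0 c * f) \<partial>\<mu>) = c * (\<integral>g. ?e g f \<partial>\<mu>)"
    by simp
  have "(\<integral>g. ?e g 1 \<partial>\<mu>) = (\<integral>g. 1 \<partial>\<mu>)"
    using S by (intro Bochner_Integration.integral_cong refl) blast
  then show "(\<integral>g. ?e g 1 \<partial>\<mu>) = 1" by (simp add: prob_space)
  show "(\<integral>g. ?e g (f * h) \<partial>\<mu>) = (\<integral>g. ?e g (h * f) \<partial>\<mu>)"
    using S by (intro Bochner_Integration.integral_cong refl) blast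
  let ?p = "\<lambda>g. ?e g (f * laurent_star f)"
  have p: "0 \<le> Re (?p g)" "Im (?p g) = 0" if "g \<in> space \<mu>" for g
    using S[of g] that by (auto simp: complex_nonneg_Reals_iff)
  have "0 \<le> Re (\<integral>g. ?p g \<partial>\<mu>)"
    unfolding integral_Re[OF integrable_empirical, symmetric] using p by (intro integral_nonneg_AE AE_I2) auto
  moreover have "Im (\<integral>g. ?p g \<partial>\<mu>) = (\<integral>g. 0 \<partial>\<mu>)"
    unfolding integral_Im[OF integrable_empirical, symmetric]
    using p by (intro Bochner_Integration.integral_cong refl) auto
  ultimately show "(\<integral>g. ?p g \<partial>\<mu>) \<in> \<real>\<^sub>\<ge>\<^sub>0"
    by (simp add: complex_nonneg_Reals_iff)
qed

text \<open>Conjugating a trace stars its word, so the squared modulus is the real part of a trace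
  state whose integral is already known.\<close>

lemma word_sq:
  assumes "g \<in> GL N"
  shows "(cmod (trace_state N g [w]))\<^sup>2 = Re (trace_state N g [w, word_star w])"
proof -
  have "trace_state N g [w, word_star w] = trace_state N g [w] * cnj (trace_state N g [w])"
    unfolding cnj_trace_state_word[OF N assms] by simp
  then show ?thesis by (simp only: Re_mult_cnj)
qed

lemma integrable_word_sq: "integrable \<mu> (\<lambda>g. (cmod (trace_state N g [w]))\<^sup>2)"
  using Bochner_Integration.integrable_cong[of \<mu> \<mu> "\<lambda>g. (cmod (trace_state N g [w]))\<^sup>2", OF refl word_sq]
    integrable_Re[OF integrable_trace_state[of "[w, word_star w]"]]
  by (simp add: space_law del: trace_state_simps)

lemma word_variance:
  defines "m \<equiv> \<lambda>w. moment [w]"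
  shows "integrable \<mu> (\<lambda>g. (cmod (trace_state N g [w] - m w))\<^sup>2)"
    and "(\<integral>g. (cmod (trace_state N g [w] - m w))\<^sup>2 \<partial>\<mu>) \<le> variance_error s (length w) / (real N)\<^sup>2"
proof -
  let ?T = "\<lambda>g. trace_state N g [w]"
  define r where "r = (\<lambda>g. Re (cnj (m w) * ?T g))"
  have e: "(cmod (?T g - m w))\<^sup>2 = (cmod (?T g))\<^sup>2 - 2 * r g + (cmod (m w))\<^sup>2" for g
    unfolding cmod_power2 r_def by (simp add: power2_eq_square algebra_simps del: trace_state_simps)
  have i: "integrable \<mu> r"
    unfolding r_def by (intro integrable_Re integrable_mult_right integrable_trace_state)
  show "integrable \<mu> (\<lambda>g. (cmod (?T g - m w))\<^sup>2)"
    unfolding e using i integrable_word_sq by (intro Bochner_Integration.integrable_add Bochner_Integration.integrable_diff integrable_mult_right) auto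
  have star: "moment [word_star w] = cnj (m w)"
  proof -
    have "moment [word_star w] = (\<integral>g. cnj (?T g) \<partial>\<mu>)"
      unfolding integral_trace_state[symmetric]
      by (intro Bochner_Integration.integral_cong refl) (simp add: space_law cnj_trace_state_word[OF N] del: trace_state_simps)
    then show ?thesis by (simp add: m_def integral_trace_state del: trace_state_simps)
  qed
  have sq: "(\<integral>g. (cmod (?T g))\<^sup>2 \<partial>\<mu>) = Re (moment [w, word_star w])"
  proof -
    have "(\<integral>g. (cmod (?T g))\<^sup>2 \<partial>\<mu>) = (\<integral>g. Re (trace_state N g [w, word_star w]) \<partial>\<mu>)"
      by (intro Bochner_Integration.integral_cong refl word_sq) (simp add: space_law)
    then show ?thesis by (simp add: integral_Re[OF integrable_trace_state] integral_trace_state del: trace_state_simps)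
  qed
  have "(\<integral>g. r g \<partial>\<mu>) = Re (cnj (m w) * m w)"
    unfolding r_def by (subst integral_Re) (simp_all add: m_def integrable_trace_state integral_trace_state del: trace_state_simps)
  also have "\<dots> = (cmod (m w))\<^sup>2" by (simp only: Re_mult_cnj mult.commute[of "cnj (m w)"])
  finally have c: "(\<integral>g. r g \<partial>\<mu>) = (cmod (m w))\<^sup>2" .
  have "(\<integral>g. (cmod (?T g - m w))\<^sup>2 \<partial>\<mu>) = (\<integral>g. (cmod (?T g))\<^sup>2 \<partial>\<mu>) - (cmod (m w))\<^sup>2"
    unfolding e using i integrable_word_sq[of w] c by (simp add: prob_space del: trace_state_simps)
  also have "\<dots> = Re (moment [w, word_star w] - m w * moment [word_star w])"
    by (simp only: sq star minus_complex.sel Re_mult_cnj)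
  also have "\<dots> \<le> 1 / (real N)\<^sup>2 * variance_error s (length w)"
    using heat_moment_cov[OF st kappa, of "word_star w" w] complex_Re_le_cmod order_trans
    unfolding m_def by fastforce
  finally show "(\<integral>g. (cmod (?T g - m w))\<^sup>2 \<partial>\<mu>) \<le> variance_error s (length w) / (real N)\<^sup>2" by simp
qed

lemma empirical_variance:
  shows "integrable \<mu> (\<lambda>g. (cmod (empirical_distribution N g f))\<^sup>2)"
    and "complex_variance \<mu> (\<lambda>g. empirical_distribution N g f) \<le>
      real (card (Poly_Mapping.keys f)) * (\<Sum>w\<in>Poly_Mapping.keys f. (cmod (Poly_Mapping.lookup f w))\<^sup>2 *
        variance_error s (length (rep_free_group w))) / (real N)\<^sup>2"
proof -
  let ?K = "Poly_Mapping.keys f" and ?c = "Poly_Mapping.lookup f" and ?r = rep_free_group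
  let ?m = "moment"
  let ?e = "\<lambda>g. empirical_distribution N g f"
  \<comment> \<open>Cauchy-Schwarz over the finite support of \<open>f\<close>: mixed covariances
    are replaced by variances of single words, at the price of the factor
    \<open>card ?K\<close>.\<close>
  have cs: "(cmod (\<Sum>w\<in>?K. a w))\<^sup>2 \<le> real (card ?K) * (\<Sum>w\<in>?K. (cmod (a w))\<^sup>2)" for a :: "generator free_group \<Rightarrow> complex"
  proof -
    have "(cmod (\<Sum>w\<in>?K. a w))\<^sup>2 \<le> (\<Sum>w\<in>?K. cmod (a w))\<^sup>2"
      by (intro power_mono norm_sum) auto
    also have "\<dots> \<le> (\<Sum>w\<in>?K. (cmod (a w))\<^sup>2) * real (card ?K)"
      by (rule sum_squared_le_sum_of_squares)
    finally show ?thesis by (simp add: mult.commute)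
  qed
  have e: "?e g = (\<Sum>w\<in>?K. ?c w * trace_state N g [?r w])" if "g \<in> space \<mu>" for g
    using empirical_distribution_eq[OF N] that by (simp add: space_law laurent_sum_def del: trace_state_simps)
  have meas: "?e \<in> borel_measurable \<mu>" using integrable_empirical by (rule borel_measurable_integrable)
  show "integrable \<mu> (\<lambda>g. (cmod (?e g))\<^sup>2)"
  proof (rule Bochner_Integration.integrable_bound)
    show "integrable \<mu> (\<lambda>g. real (card ?K) * (\<Sum>w\<in>?K. (cmod (?c w))\<^sup>2 * (cmod (trace_state N g [?r w]))\<^sup>2))"
      by (intro integrable_mult_right Bochner_Integration.integrable_sum integrable_word_sq)
    show "(\<lambda>g. (cmod (?e g))\<^sup>2) \<in> borel_measurable \<mu>" using meas by measurable
    show "AE g in \<mu>. norm ((cmod (?e g))\<^sup>2) \<le>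
        norm (real (card ?K) * (\<Sum>w\<in>?K. (cmod (?c w))\<^sup>2 * (cmod (trace_state N g [?r w]))\<^sup>2))"
    proof (rule AE_I2)
      fix g assume g: "g \<in> space \<mu>"
      show "norm ((cmod (?e g))\<^sup>2) \<le>
        norm (real (card ?K) * (\<Sum>w\<in>?K. (cmod (?c w))\<^sup>2 * (cmod (trace_state N g [?r w]))\<^sup>2))"
        using cs[of "\<lambda>w. ?c w * trace_state N g [?r w]"] unfolding e[OF g]
        by (simp add: norm_mult power_mult_distrib sum_nonneg abs_mult del: trace_state_simps)
    qed
  qed
  have "complex_variance \<mu> ?e \<le>
      (\<integral>g. real (card ?K) * (\<Sum>w\<in>?K. (cmod (?c w))\<^sup>2 * (cmod (trace_state N g [?r w] - ?m [?r w]))\<^sup>2) \<partial>\<mu>)"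
    unfolding complex_variance_def integral_empirical
  proof (rule integral_mono_AE')
    show "integrable \<mu> (\<lambda>g. real (card ?K) * (\<Sum>w\<in>?K. (cmod (?c w))\<^sup>2 * (cmod (trace_state N g [?r w] - ?m [?r w]))\<^sup>2))"
      by (intro integrable_mult_right Bochner_Integration.integrable_sum word_variance)
    show "AE g in \<mu>. (cmod (?e g - laurent_sum ?m f))\<^sup>2 \<le>
        real (card ?K) * (\<Sum>w\<in>?K. (cmod (?c w))\<^sup>2 * (cmod (trace_state N g [?r w] - ?m [?r w]))\<^sup>2)"
    proof (rule AE_I2)
      fix g assume g: "g \<in> space \<mu>"
      show "(cmod (?e g - laurent_sum ?m f))\<^sup>2 \<le>
        real (card ?K) * (\<Sum>w\<in>?K. (cmod (?c w))\<^sup>2 * (cmod (trace_state N g [?r w] - ?m [?r w]))\<^sup>2)"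
      proof -
        have "?e g - laurent_sum ?m f = (\<Sum>w\<in>?K. ?c w * (trace_state N g [?r w] - ?m [?r w]))"
          unfolding e[OF g] laurent_sum_def right_diff_distrib sum_subtractf ..
        then show ?thesis
          using cs[of "\<lambda>w. ?c w * (trace_state N g [?r w] - ?m [?r w])"]
          by (simp only: norm_mult power_mult_distrib)
      qed
    qed
  qed (auto intro!: AE_I2 mult_nonneg_nonneg sum_nonneg simp del: trace_state_simps)
  also have "\<dots> = real (card ?K) * (\<Sum>w\<in>?K. (cmod (?c w))\<^sup>2 * (\<integral>g. (cmod (trace_state N g [?r w] - ?m [?r w]))\<^sup>2 \<partial>\<mu>))"
    by (simp add: word_variance(1) del: trace_state_simps)
  also have "\<dots> \<le> real (card ?K) * (\<Sum>w\<in>?K. (cmod (?c w))\<^sup>2 * (variance_error s (length (?r w)) / (real N)\<^sup>2))"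
    by (intro mult_left_mono sum_mono word_variance(2)) auto
  finally show "complex_variance \<mu> ?e \<le>
      real (card ?K) * (\<Sum>w\<in>?K. (cmod (?c w))\<^sup>2 * variance_error s (length (?r w))) / (real N)\<^sup>2"
    by (simp only: times_divide_eq_right sum_divide_distrib[symmetric])
qed

end

lemma laurent_state_limit:
  assumes F: "F \<noteq> bot" and S: "\<forall>\<^sub>F i in F. nc_prob_space laurent_algebra (\<psi> i)"
    and lim: "\<And>f. ((\<lambda>i. \<psi> i f) \<longlongrightarrow> \<psi>' f) F"
  shows "nc_prob_space laurent_algebra \<psi>'"
  unfolding laurent_state_iff
proof (intro conjI allI)
  note S = S[unfolded laurent_state_iff]
  fix f h :: laurent and c
  have "((\<lambda>i. \<psi> i f + \<psi> i h) \<longlongrightarrow> \<psi>' (f + h)) F"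
    by (rule Lim_transform_eventually[OF lim]) (use S in \<open>auto elim!: eventually_mono\<close>)
  from tendsto_unique[OF F this tendsto_add[OF lim lim]] show "\<psi>' (f + h) = \<psi>' f + \<psi>' h" .
  have "((\<lambda>i. c * \<psi> i f) \<longlongrightarrow> \<psi>' (Poly_Mapping.single 0 c * f)) F"
    by (rule Lim_transform_eventually[OF lim]) (use S in \<open>auto elim!: eventually_mono\<close>)
  from tendsto_unique[OF F this tendsto_mult[OF tendsto_const lim]]
  show "\<psi>' (Poly_Mapping.single 0 c * f) = c * \<psi>' f" .
  have "((\<lambda>i. 1) \<longlongrightarrow> \<psi>' 1) F"
    by (rule Lim_transform_eventually[OF lim]) (use S in \<open>auto elim!: eventually_mono\<close>)
  from tendsto_unique[OF F this tendsto_const] show "\<psi>' 1 = 1" .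
  have "((\<lambda>i. \<psi> i (h * f)) \<longlongrightarrow> \<psi>' (f * h)) F"
    by (rule Lim_transform_eventually[OF lim]) (use S in \<open>auto elim!: eventually_mono\<close>)
  from tendsto_unique[OF F this lim] show "\<psi>' (f * h) = \<psi>' (h * f)" .
  show "\<psi>' (f * laurent_star f) \<in> \<real>\<^sub>\<ge>\<^sub>0"
    by (rule Lim_in_closed_set[OF closed_nonneg_Reals_complex _ F lim])
      (use S in \<open>auto elim!: eventually_mono\<close>)
qed

definition mean_error :: "real \<Rightarrow> laurent \<Rightarrow> real" where
  "mean_error s f = (\<Sum>w\<in>Poly_Mapping.keys f. cmod (Poly_Mapping.lookup f w) *
     moment_error s (length (rep_free_group w)))"

lemma laurent_sum_diff:
  assumes "0 \<le> t" "t / 2 \<le> s" "0 \<le> \<kappa>" "\<kappa> \<le> 1"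
  shows "cmod (laurent_sum (heat_moment s t \<kappa>) f - laurent_sum (heat_moment s t 0) f) \<le> \<kappa> * mean_error s f"
proof -
  have "cmod (laurent_sum (heat_moment s t \<kappa>) f - laurent_sum (heat_moment s t 0) f) =
      cmod (\<Sum>w\<in>Poly_Mapping.keys f. Poly_Mapping.lookup f w *
        (heat_moment s t \<kappa> [rep_free_group w] - heat_moment s t 0 [rep_free_group w]))"
    by (simp add: laurent_sum_def right_diff_distrib sum_subtractf)
  also have "\<dots> \<le> (\<Sum>w\<in>Poly_Mapping.keys f. cmod (Poly_Mapping.lookup f w) *
      (\<kappa> * moment_error s (length (rep_free_group w))))"
  proof (rule order_trans[OF norm_sum sum_mono])
    fix w
    have "cmod (heat_moment s t \<kappa> [rep_free_group w] - heat_moment s t 0 [rep_free_group w]) \<le>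
        \<kappa> * moment_error s (length (rep_free_group w))"
      using heat_moment_diff[OF assms, of "[rep_free_group w]"] by simp
    then show "cmod (Poly_Mapping.lookup f w *
        (heat_moment s t \<kappa> [rep_free_group w] - heat_moment s t 0 [rep_free_group w])) \<le>
      cmod (Poly_Mapping.lookup f w) * (\<kappa> * moment_error s (length (rep_free_group w)))"
      unfolding norm_mult by (rule mult_left_mono) simp
  qed
  finally show ?thesis by (simp add: mean_error_def sum_distrib_left mult_ac)
qed

section \<open>Almost sure convergence\<close>

lemma heat_law_distr:
  assumes "N \<ge> 1" "orthonormal_basis_u N \<beta>" "(s, t) \<in> admissible" "has_heat_kernel_law N \<beta> s t M Z"
  shows "heat_law N \<beta> s t (distr M (GL_borel N) Z)"
  using assms by unfold_locales (auto simp: has_heat_kernel_law_def admissible_def)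

text \<open>The sum of the \<open>D k\<close> has finite expectation, so it is finite almost
  everywhere and its terms tend to 0, whatever the joint law of the matrices of different
  sizes.\<close>

lemma AE_tendsto_zero_of_summable:
  fixes D :: "nat \<Rightarrow> 'w \<Rightarrow> real"
  assumes i: "\<And>k. integrable M (D k)" and nn: "\<And>k \<omega>. 0 \<le> D k \<omega>"
    and le: "\<And>k. (\<integral>\<omega>. D k \<omega> \<partial>M) \<le> b k" and b: "summable b"
  shows "AE \<omega> in M. (\<lambda>k. D k \<omega>) \<longlonglongrightarrow> 0"
proof -
  have b0: "0 \<le> b k" for k
    by (rule order_trans[OF integral_nonneg_AE le]) (simp add: nn)
  have "(\<integral>\<^sup>+\<omega>. suminf (\<lambda>k. ennreal (D k \<omega>)) \<partial>M) = suminf (\<lambda>k. \<integral>\<^sup>+\<omega>. ennreal (D k \<omega>) \<partial>M)"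
    using i by (intro nn_integral_suminf) (auto intro: borel_measurable_integrable)
  also have "\<dots> = suminf (\<lambda>k. ennreal (\<integral>\<omega>. D k \<omega> \<partial>M))"
    using i nn by (simp add: nn_integral_eq_integral)
  also have "\<dots> \<le> suminf (\<lambda>k. ennreal (b k))"
    by (intro suminf_le ennreal_leI le) auto
  also have "\<dots> < \<infinity>"
    using suminf_ennreal2[OF b0 b] by simp
  finally have "(\<integral>\<^sup>+\<omega>. suminf (\<lambda>k. ennreal (D k \<omega>)) \<partial>M) \<noteq> \<infinity>" by simp
  moreover have "(\<lambda>\<omega>. suminf (\<lambda>k. ennreal (D k \<omega>))) \<in> borel_measurable M"
    using i by (intro borel_measurable_suminf_order) (auto intro: borel_measurable_integrable)
  ultimately have "AE \<omega> in M. suminf (\<lambda>k. ennreal (D k \<omega>)) \<noteq> \<infinity>"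
    by (intro nn_integral_PInf_AE)
  then show ?thesis
  proof (rule AE_mp, intro AE_I2 impI)
    fix \<omega> assume "suminf (\<lambda>k. ennreal (D k \<omega>)) \<noteq> \<infinity>"
    then have "summable (\<lambda>k. D k \<omega>)" using nn by (intro summable_suminf_not_top) (auto simp: infinity_ennreal_def)
    then show "(\<lambda>k. D k \<omega>) \<longlonglongrightarrow> 0" by (rule summable_LIMSEQ_zero)
  qed
qed

lemma AE_word_tendsto:
  fixes Z :: "nat \<Rightarrow> 'w \<Rightarrow> complex mat"
  assumes basis: "\<And>N. N \<ge> 1 \<Longrightarrow> orthonormal_basis_u N (\<beta> N)" and st: "(s, t) \<in> admissible"
    and Z: "\<And>N. N \<ge> 1 \<Longrightarrow> has_heat_kernel_law N (\<beta> N) s t M (Z N)"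
  shows "AE \<omega> in M. (\<lambda>k. trace_state (Suc k) (Z (Suc k) \<omega>) [w]) \<longlonglongrightarrow> heat_moment s t 0 [w]"
proof -
  \<comment> \<open>Index \<open>k\<close> stands for the size \<open>Suc k\<close>, which leaves
    out \<open>N = 0\<close>; summability of these squares is what makes the variances
    summable.\<close>
  define \<kappa> where "\<kappa> = (\<lambda>k. 1 / (real (Suc k))\<^sup>2)"
  have \<kappa>: "0 \<le> \<kappa> k" "\<kappa> k \<le> 1" for k by (simp_all add: \<kappa>_def field_simps)
  have st': "0 \<le> t" "t / 2 \<le> s" using st by (auto simp: admissible_def)
  have sum: "summable \<kappa>"
    using inverse_power_summable[of 2, where 'a = real] unfolding \<kappa>_def
    by (subst summable_Suc_iff[of "\<lambda>k. 1 / (real k)\<^sup>2"]) (simp add: inverse_eq_divide)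
  let ?m = "\<lambda>k. heat_moment s t (\<kappa> k) [w]"
  let ?T = "\<lambda>k g. trace_state (Suc k) g [w]"
  define D where "D = (\<lambda>k \<omega>. (cmod (?T k (Z (Suc k) \<omega>) - ?m k))\<^sup>2)"
  have D: "integrable M (D k)" "(\<integral>\<omega>. D k \<omega> \<partial>M) \<le> variance_error s (length w) * \<kappa> k" for k
  proof -
    let ?\<mu> = "distr M (GL_borel (Suc k)) (Z (Suc k))"
    interpret heat_law "Suc k" "\<beta> (Suc k)" s t ?\<mu>
      by (rule heat_law_distr[OF _ basis st Z]) auto
    have mZ: "Z (Suc k) \<in> M \<rightarrow>\<^sub>M GL_borel (Suc k)" using Z[of "Suc k"] by (simp add: has_heat_kernel_law_def)
    have mf: "(\<lambda>g. (cmod (?T k g - ?m k))\<^sup>2) \<in> borel_measurable (GL_borel (Suc k))"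
      using borel_measurable_GL[OF continuous_map_trace_state[of "Suc k" "[w]"]] by measurable
    note v = word_variance[of w, folded \<kappa>_def]
    show "integrable M (D k)"
      using v(1) integrable_distr_eq[OF mZ mf] unfolding D_def \<kappa>_def by simp
    show "(\<integral>\<omega>. D k \<omega> \<partial>M) \<le> variance_error s (length w) * \<kappa> k"
      using v(2) integral_distr[OF mZ mf] unfolding D_def \<kappa>_def by simp
  qed
  have m: "?m \<longlonglongrightarrow> heat_moment s t 0 [w]"
  proof (rule Lim_null_comparison[THEN LIM_zero_cancel])
    show "\<forall>\<^sub>F k in sequentially. norm (?m k - heat_moment s t 0 [w]) \<le> \<kappa> k * moment_error s (length w)"
      using heat_moment_diff[OF st' \<kappa>, of _ "[w]"] by simp
    show "(\<lambda>k. \<kappa> k * moment_error s (length w)) \<longlonglongrightarrow> 0"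
      by (rule tendsto_mult_left_zero[OF summable_LIMSEQ_zero[OF sum]])
  qed
  have "AE \<omega> in M. (\<lambda>k. D k \<omega>) \<longlonglongrightarrow> 0"
  proof (rule AE_tendsto_zero_of_summable[OF D(1) _ D(2)])
    show "0 \<le> D k \<omega>" for k \<omega> by (simp add: D_def)
    show "summable (\<lambda>k. variance_error s (length w) * \<kappa> k)" by (rule summable_mult[OF sum])
  qed
  then show ?thesis
  proof (rule AE_mp, intro AE_I2 impI)
    fix \<omega> assume "(\<lambda>k. D k \<omega>) \<longlonglongrightarrow> 0"
    then have "(\<lambda>k. sqrt (D k \<omega>)) \<longlonglongrightarrow> sqrt 0" by (rule tendsto_real_sqrt)
    then have "(\<lambda>k. norm (?T k (Z (Suc k) \<omega>) - ?m k)) \<longlonglongrightarrow> 0"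
      by (simp add: D_def del: trace_state_simps)
    then have "(\<lambda>k. ?T k (Z (Suc k) \<omega>) - ?m k) \<longlonglongrightarrow> 0"
      by (rule tendsto_norm_zero_cancel)
    from tendsto_add[OF this m] show "(\<lambda>k. ?T k (Z (Suc k) \<omega>)) \<longlonglongrightarrow> heat_moment s t 0 [w]"
      by simp
  qed
qed

text \<open>Positivity of \<open>laurent_sum (heat_moment s t 0)\<close> is inherited from the mean distributions for
  finite \<open>N\<close>, so it is only obtained when heat kernel measures exist for infinitely many \<open>N\<close>.
  The case distinction makes a proof of their existence unnecessary: with finitely many \<open>N\<close>, the
  mean distribution for the largest one is as good a limit, up to a factor \<open>2\<close> in the error.\<close>

definition heat_dims :: "(nat \<Rightarrow> complex mat set) \<Rightarrow> real \<Rightarrow> real \<Rightarrow> nat set" where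
  "heat_dims \<beta> s t = {N. N \<ge> 1 \<and> (\<exists>\<mu>. heat_kernel_measure N (\<beta> N) s t \<mu>)}"

text \<open>If no size carries a heat kernel measure the bounds are vacuous and any state will do;
  the identity of size 1 supplies one.\<close>

definition limit_distribution ::
    "(nat \<Rightarrow> complex mat set) \<Rightarrow> real \<Rightarrow> real \<Rightarrow> laurent \<Rightarrow> complex" where
  "limit_distribution \<beta> s t =
     (if infinite (heat_dims \<beta> s t) then laurent_sum (heat_moment s t 0)
      else if heat_dims \<beta> s t = {} then empirical_distribution 1 (1\<^sub>m 1)
      else laurent_sum (heat_moment s t (1 / (real (Max (heat_dims \<beta> s t)))\<^sup>2)))"

lemma limit_distribution_is_nc:
  assumes basis: "\<And>N. N \<ge> 1 \<Longrightarrow> orthonormal_basis_u N (\<beta> N)" and st: "(s, t) \<in> admissible"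
  shows "is_nc_distribution (limit_distribution \<beta> s t)"
proof (rule nc_distribution_of_state)
  let ?I = "heat_dims \<beta> s t"
  have st': "0 \<le> t" "t / 2 \<le> s" using st by (auto simp: admissible_def)
  have S: "nc_prob_space laurent_algebra (laurent_sum (heat_moment s t (1 / (real N)\<^sup>2)))" if "N \<in> ?I" for N
  proof -
    from that obtain \<mu> where N: "N \<ge> 1" and \<mu>: "heat_kernel_measure N (\<beta> N) s t \<mu>"
      by (auto simp: heat_dims_def)
    interpret heat_law N "\<beta> N" s t \<mu> by unfold_locales (use N basis st' \<mu> in auto)
    show ?thesis by (rule mean_state)
  qed
  consider (inf) "infinite ?I" | (empty) "?I = {}" | (fin) "finite ?I" "?I \<noteq> {}" by blast
  then show "nc_prob_space laurent_algebra (limit_distribution \<beta> s t)"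
  proof cases
    case inf
    define N where "N = enumerate ?I"
    have N: "N i \<in> ?I" "i \<le> N i" for i
      unfolding N_def using inf by (simp_all add: enumerate_in_set le_enumerate)
    have "nc_prob_space laurent_algebra (laurent_sum (heat_moment s t 0))"
    proof (rule laurent_state_limit[of sequentially])
      show "\<forall>\<^sub>F i in sequentially. nc_prob_space laurent_algebra (laurent_sum (heat_moment s t (1 / (real (N i))\<^sup>2)))"
        using S N by simp
      fix f
      show "(\<lambda>i. laurent_sum (heat_moment s t (1 / (real (N i))\<^sup>2)) f) \<longlonglongrightarrow> laurent_sum (heat_moment s t 0) f"
      proof (rule Lim_null_comparison[THEN LIM_zero_cancel])
        show "\<forall>\<^sub>F i in sequentially. norm (laurent_sum (heat_moment s t (1 / (real (N i))\<^sup>2)) f -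
            laurent_sum (heat_moment s t 0) f) \<le> 1 / (real (N i))\<^sup>2 * mean_error s f"
        proof (intro always_eventually allI laurent_sum_diff[OF st'])
          fix i
          have "1 \<le> N i" using N(1)[of i] by (simp add: heat_dims_def)
          then show "1 / (real (N i))\<^sup>2 \<le> 1" by (simp add: field_simps)
        qed simp
        have "filterlim (\<lambda>i. real (N i)) at_top sequentially"
          by (rule filterlim_at_top_mono[OF filterlim_real_sequentially]) (use N(2) in simp)
        then have "(\<lambda>i. 1 / (real (N i))\<^sup>2) \<longlonglongrightarrow> 0"
          by (intro real_tendsto_divide_at_top[OF tendsto_const] filterlim_pow_at_top) auto
        then show "(\<lambda>i. 1 / (real (N i))\<^sup>2 * mean_error s f) \<longlonglongrightarrow> 0"
          by (rule tendsto_mult_left_zero)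
      qed
    qed simp
    then show ?thesis using inf by (simp add: limit_distribution_def)
  next
    case empty
    then show ?thesis using empirical_state[of 1, OF _ one_in_GL] by (simp add: limit_distribution_def)
  next
    case fin
    then show ?thesis using S[OF Max_in[OF fin]] by (simp add: limit_distribution_def)
  qed
qed

lemma limit_distribution_error:
  assumes st: "(s, t) \<in> admissible" and N: "N \<in> heat_dims \<beta> s t"
  shows "cmod (laurent_sum (heat_moment s t (1 / (real N)\<^sup>2)) f - limit_distribution \<beta> s t f)
    \<le> 2 * mean_error s f / (real N)\<^sup>2"
proof -
  let ?I = "heat_dims \<beta> s t" and ?m = "\<lambda>\<kappa>. laurent_sum (heat_moment s t \<kappa>) f"
  have st': "0 \<le> t" "t / 2 \<le> s" "0 \<le> s" using st by (auto simp: admissible_def)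
  have c: "0 \<le> mean_error s f"
    using st'(3) by (auto simp: mean_error_def moment_error_nonneg intro!: sum_nonneg)
  have d: "cmod (?m (1 / (real N)\<^sup>2) - ?m 0) \<le> mean_error s f / (real N)\<^sup>2" if "N \<ge> 1" for N
    using laurent_sum_diff[OF st'(1,2), of "1 / (real N)\<^sup>2" f] that by (simp add: field_simps)
  have N1: "N \<ge> 1" using N by (simp add: heat_dims_def)
  show ?thesis
  proof (cases "finite ?I")
    case False
    have "mean_error s f / (real N)\<^sup>2 \<le> 2 * mean_error s f / (real N)\<^sup>2"
      using c by (intro divide_right_mono) auto
    then show ?thesis using d[OF N1] False by (simp add: limit_distribution_def)
  next
    case True
    let ?N = "Max ?I"
    have le: "N \<le> ?N" using True N by simp
    have N': "?N \<ge> 1" using le N1 by simp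
    \<comment> \<open>\<open>N\<close> is at most the maximum, so the error there is no larger than
      at \<open>N\<close>; the triangle inequality through \<open>?m 0\<close> gives the factor
      2.\<close>
    have "mean_error s f / (real ?N)\<^sup>2 \<le> mean_error s f / (real N)\<^sup>2"
      using le N1 c by (intro divide_left_mono power_mono) auto
    then have "cmod (?m (1 / (real N)\<^sup>2) - ?m 0) + cmod (?m (1 / (real ?N)\<^sup>2) - ?m 0) \<le> 2 * mean_error s f / (real N)\<^sup>2"
      using d[OF N1] d[OF N'] by (simp add: field_simps)
    moreover have "cmod (?m (1 / (real N)\<^sup>2) - ?m (1 / (real ?N)\<^sup>2)) \<le>
        cmod (?m (1 / (real N)\<^sup>2) - ?m 0) + cmod (?m (1 / (real ?N)\<^sup>2) - ?m 0)"
      using norm_triangle_ineq4[of "?m (1 / (real N)\<^sup>2) - ?m 0" "?m (1 / (real ?N)\<^sup>2) - ?m 0"] by simp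
    moreover have "limit_distribution \<beta> s t f = ?m (1 / (real ?N)\<^sup>2)"
      using True N by (auto simp: limit_distribution_def)
    ultimately show ?thesis by simp
  qed
qed

text \<open>Lets one null set serve all words, hence all \<open>f\<close>.\<close>

lemma countable_words: "countable (UNIV :: word set)"
proof -
  have "(UNIV :: (generator \<times> bool) set) \<subseteq> {Gen, Gen_star} \<times> UNIV"
    using generator.exhaust by auto
  then have "finite (UNIV :: (generator \<times> bool) set)"
    by (rule finite_subset) auto
  then have "countable (lists (UNIV :: (generator \<times> bool) set))"
    by (intro countable_lists countable_finite)
  then show ?thesis by simp
qed

theorem theorem1p6:
  fixes \<beta> :: "nat \<Rightarrow> complex mat set"
  assumes "\<And>N. N \<ge> 1 \<Longrightarrow> orthonormal_basis_u N (\<beta> N)"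
  shows "\<exists>(\<phi> :: real \<Rightarrow> real \<Rightarrow> laurent \<Rightarrow> complex)
          (C1 :: real \<Rightarrow> real \<Rightarrow> laurent \<Rightarrow> real) (C2 :: real \<Rightarrow> real \<Rightarrow> laurent \<Rightarrow> real).
     (\<forall>(s, t)\<in>admissible. is_nc_distribution (\<phi> s t)) \<and>
     (\<forall>f. continuous_on admissible (\<lambda>(s, t). C1 s t f) \<and>
          continuous_on admissible (\<lambda>(s, t). C2 s t f)) \<and>
     (\<forall>(s, t)\<in>admissible. \<forall>N\<ge>1. \<forall>(M :: 'w measure) Z.
        has_heat_kernel_law N (\<beta> N) s t M Z \<longrightarrow>
        (\<forall>f. integrable M (\<lambda>\<omega>. empirical_distribution N (Z \<omega>) f) \<and>
             integrable M (\<lambda>\<omega>. (cmod (empirical_distribution N (Z \<omega>) f))\<^sup>2) \<and>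
             cmod ((\<integral>\<omega>. empirical_distribution N (Z \<omega>) f \<partial>M) - \<phi> s t f)
               \<le> C1 s t f / (real N)\<^sup>2 \<and>
             complex_variance M (\<lambda>\<omega>. empirical_distribution N (Z \<omega>) f)
               \<le> C2 s t f / (real N)\<^sup>2)) \<and>
     (\<forall>(s, t)\<in>admissible. \<forall>(M :: 'w measure) Z.
        (\<forall>N\<ge>1. has_heat_kernel_law N (\<beta> N) s t M (Z N)) \<longrightarrow>
        (AE \<omega> in M. \<forall>f. (\<lambda>N. empirical_distribution N (Z N \<omega>) f) \<longlonglongrightarrow> \<phi> s t f))"
proof -
  \<comment> \<open>The 2 comes from the case of finitely many sizes in
    \<open>limit_distribution_error\<close>.\<close>
  define C1 :: "real \<Rightarrow> real \<Rightarrow> laurent \<Rightarrow> real" where "C1 = (\<lambda>s t f. 2 * mean_error s f)"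
  define C2 :: "real \<Rightarrow> real \<Rightarrow> laurent \<Rightarrow> real" where "C2 = (\<lambda>s t f. real (card (Poly_Mapping.keys f)) *
    (\<Sum>w\<in>Poly_Mapping.keys f. (cmod (Poly_Mapping.lookup f w))\<^sup>2 * variance_error s (length (rep_free_group w))))"
  have bounds: "integrable M (\<lambda>\<omega>. empirical_distribution N (Z \<omega>) f) \<and>
      integrable M (\<lambda>\<omega>. (cmod (empirical_distribution N (Z \<omega>) f))\<^sup>2) \<and>
      cmod ((\<integral>\<omega>. empirical_distribution N (Z \<omega>) f \<partial>M) - limit_distribution \<beta> s t f) \<le> C1 s t f / (real N)\<^sup>2 \<and>
      complex_variance M (\<lambda>\<omega>. empirical_distribution N (Z \<omega>) f) \<le> C2 s t f / (real N)\<^sup>2"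
    if adm: "(s, t) \<in> admissible" and N: "1 \<le> N" and Z: "has_heat_kernel_law N (\<beta> N) s t M Z"
    for s t N f and M :: "'w measure" and Z
  proof (intro conjI)
    interpret heat_law N "\<beta> N" s t "distr M (GL_borel N) Z"
      by (rule heat_law_distr[OF N assms[OF N] adm Z])
    let ?e = "\<lambda>g. empirical_distribution N g f"
    have mZ: "Z \<in> M \<rightarrow>\<^sub>M GL_borel N" using Z by (simp add: has_heat_kernel_law_def)
    have me: "?e \<in> borel_measurable (GL_borel N)"
      using borel_measurable_integrable[OF integrable_empirical[of f]] by simp
    have mean: "(\<integral>\<omega>. ?e (Z \<omega>) \<partial>M) = laurent_sum (heat_moment s t (1 / (real N)\<^sup>2)) f"
      using integral_empirical[of f] integral_distr[OF mZ me] by simp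
    show "integrable M (\<lambda>\<omega>. ?e (Z \<omega>))"
      using integrable_empirical[of f] integrable_distr_eq[OF mZ me] by simp
    have m2: "(\<lambda>g. (cmod (?e g))\<^sup>2) \<in> borel_measurable (GL_borel N)" using me by measurable
    show "integrable M (\<lambda>\<omega>. (cmod (?e (Z \<omega>)))\<^sup>2)"
      using empirical_variance(1)[of f] integrable_distr_eq[OF mZ m2] by simp
    have "N \<in> heat_dims \<beta> s t"
      using N Z by (auto simp: heat_dims_def has_heat_kernel_law_def)
    from limit_distribution_error[OF adm this]
    show "cmod ((\<integral>\<omega>. ?e (Z \<omega>) \<partial>M) - limit_distribution \<beta> s t f) \<le> C1 s t f / (real N)\<^sup>2"
      unfolding mean C1_def .
    have m3: "(\<lambda>g. (cmod (?e g - c))\<^sup>2) \<in> borel_measurable (GL_borel N)" for c using me by measurable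
    have "complex_variance M (\<lambda>\<omega>. ?e (Z \<omega>)) = complex_variance (distr M (GL_borel N) Z) ?e"
      unfolding complex_variance_def integral_distr[OF mZ me] integral_distr[OF mZ m3] ..
    then show "complex_variance M (\<lambda>\<omega>. ?e (Z \<omega>)) \<le> C2 s t f / (real N)\<^sup>2"
      using empirical_variance(2)[of f] by (simp add: C2_def)
  qed
  have AE_conv: "AE \<omega> in M. \<forall>f. (\<lambda>N. empirical_distribution N (Z N \<omega>) f) \<longlonglongrightarrow> limit_distribution \<beta> s t f"
    if st: "(s, t) \<in> admissible" and Z: "\<forall>N\<ge>1. has_heat_kernel_law N (\<beta> N) s t M (Z N)"
    for s t and M :: "'w measure" and Z
  proof -
    \<comment> \<open>Every size occurs here, so the limit is the one at
      \<open>\<kappa> = 0\<close>.\<close>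
    have "heat_dims \<beta> s t = {1..}"
      using Z by (auto simp: heat_dims_def has_heat_kernel_law_def)
    then have \<phi>: "limit_distribution \<beta> s t = laurent_sum (heat_moment s t 0)"
      by (simp add: limit_distribution_def infinite_Ici)
    have "AE \<omega> in M. \<forall>w\<in>UNIV. (\<lambda>k. trace_state (Suc k) (Z (Suc k) \<omega>) [w]) \<longlonglongrightarrow> heat_moment s t 0 [w]"
      by (rule AE_ball_countable'[OF AE_word_tendsto[OF assms st] countable_words]) (use Z in auto)
    then show "AE \<omega> in M. \<forall>f. (\<lambda>N. empirical_distribution N (Z N \<omega>) f) \<longlonglongrightarrow> limit_distribution \<beta> s t f"
    proof (rule AE_mp, intro AE_I2 impI allI)
      fix \<omega> f assume \<omega>: "\<omega> \<in> space M"
        and lim: "\<forall>w\<in>UNIV. (\<lambda>k. trace_state (Suc k) (Z (Suc k) \<omega>) [w]) \<longlonglongrightarrow> heat_moment s t 0 [w]"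
      have G: "Z (Suc k) \<omega> \<in> GL (Suc k)" for k
        using Z measurable_space[OF _ \<omega>, of "Z (Suc k)" "GL_borel (Suc k)"] by (simp add: has_heat_kernel_law_def)
      have "(\<lambda>k. laurent_sum (trace_state (Suc k) (Z (Suc k) \<omega>)) f) \<longlonglongrightarrow> laurent_sum (heat_moment s t 0) f"
        unfolding laurent_sum_def using lim by (intro tendsto_sum tendsto_mult tendsto_const) auto
      then have "(\<lambda>k. empirical_distribution (Suc k) (Z (Suc k) \<omega>) f) \<longlonglongrightarrow> limit_distribution \<beta> s t f"
        unfolding \<phi> by (simp add: empirical_distribution_eq[OF _ G])
      \<comment> \<open>The index shift is undone; the term of size 0 does not influence the
        limit.\<close>
      then show "(\<lambda>N. empirical_distribution N (Z N \<omega>) f) \<longlonglongrightarrow> limit_distribution \<beta> s t f"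
        by (rule LIMSEQ_imp_Suc)
    qed
  qed
  show ?thesis
  proof (rule exI[of _ "limit_distribution \<beta>"], rule exI[of _ C1], rule exI[of _ C2], intro conjI)
    show "\<forall>(s, t)\<in>admissible. is_nc_distribution (limit_distribution \<beta> s t)"
      using limit_distribution_is_nc[OF assms] by blast
    show "\<forall>f. continuous_on admissible (\<lambda>(s, t). C1 s t f) \<and> continuous_on admissible (\<lambda>(s, t). C2 s t f)"
      unfolding C1_def C2_def mean_error_def variance_error_def moment_error_def case_prod_unfold
      by (intro allI conjI continuous_intros)
  qed (use bounds AE_conv in blast)+
qed

end
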